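(* Let $1<p_-\le p_+<\infty$, $1<q_-\le q_+<\infty$, $p,q\in\mathcal{P}_{0,\infty}(0,\infty)$, $0\le\lambda<1$, and put $\beta(t)=\frac{1}{p(t)}-\frac{1}{q(t)}$ for $t>0$. Suppose that $$\sup_{r>0}\,[r]_1^{\frac{1}{q(0)}}\,r^{-\frac{\lambda}{q_*(r)}}<\infty,$$ that $\lim_{t\to0}t^{\beta(t)}$ exists and is finite, that $t^{\beta(t)-a}$ and $t^{\frac{\lambda}{q_*(t)}-\beta(t)-a}$ are almost decreasing on $(0,\infty)$ for some $a\in\mathbb{R}$, that $t^{-\beta(t)+b}$ and $t^{\frac{\lambda}{q_*(t)}-\beta(t)+b}$ are almost increasing on $(0,\infty)$ for some $b\in\mathbb{R}$, and that $\frac{\lambda}{q_*(t)}-\frac{1}{q(\infty)}<\beta(t)<\frac{\lambda}{q_*(t)}+\frac{1}{q'(0)}$ for $t>0$. Let $\delta>(n-1)/2$ and $r>0$. Then the Bochner-Riesz operator $B_r^\delta$ is bounded on the local variable Morrey-Lorentz space $\mathcal{M}^{loc}_{p(\cdot),q(\cdot),\lambda}(\mathbb{R}^n)$, i.e. there is $C>0$ such that $\|B_r^\delta(f)\|_{\mathcal{M}^{loc}_{p(\cdot),q(\cdot),\lambda}}\le C\|f\|_{\mathcal{M}^{loc}_{p(\cdot),q(\cdot),\lambda}}$ for all $f\in\mathcal{M}^{loc}_{p(\cdot),q(\cdot),\lambda}(\mathbb{R}^n)$.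
   Context: For a measurable function $p$ on $(0,\infty)$, $p_-=\operatorname{ess\,inf}_{0<t<\infty}p(t)$, $p_+=\operatorname{ess\,sup}_{0<t<\infty}p(t)$, and $p'(t)=\frac{p(t)}{p(t)-1}$. The set $\mathcal{P}_{0,\infty}(0,\infty)$ consists of the bounded measurable functions $p$ on $(0,\infty)$ for which there are numbers $p(0),p(\infty)$ and constants $A_0,A_\infty>0$ with $|p(t)-p(0)|\le\frac{A_0}{|\ln t|}$ for $0<t\le\frac12$ and $|p(t)-p(\infty)|\le\frac{A_\infty}{\ln t}$ for $t\ge2$; $\frac1{q'(0)}=1-\frac1{q(0)}$. Put $[r]_1=\min\{1,r\}$, and $q_*(r)=q(0)$ for $0<r<1$, $q_*(r)=q(\infty)$ for $r\ge1$. A nonnegative function $\varphi$ on $(0,\infty)$ is almost decreasing (almost increasing) if there is $C\ge1$ with $\varphi(t)\le C\varphi(s)$ whenever $t\ge s$ (whenever $t\le s$). For $r\in(0,\infty]$, $\|\varphi\|_{L_{q(\cdot)}(0,r)}=\inf\{\eta>0:\int_0^r|\varphi(s)/\eta|^{q(s)}ds\le1\}$. For measurable $f$ on $\mathbb{R}^n$, $f^*(t)=\inf\{\mu>0:|\{y\in\mathbb{R}^n:|f(y)|>\mu\}|\le t\}$, $t>0$, is its non-increasing rearrangement. The local variable Morrey-Lorentz space $\mathcal{M}^{loc}_{p(\cdot),q(\cdot),\lambda}(\mathbb{R}^n)$ is the space of all measurable $f$ on $\mathbb{R}^n$ with finite quasinorm $$\|f\|_{\mathcal{M}^{loc}_{p(\cdot),q(\cdot),\lambda}}=\sup_{r>0}r^{-\frac{\lambda}{q_*(r)}}\big\|t^{\frac1{p(t)}-\frac1{q(t)}}f^*(t)\big\|_{L_{q(\cdot)}(0,r)}.$$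 For $\delta>(n-1)/2$ and $r>0$ the Bochner-Riesz operator $B_r^\delta$ is given by $\widehat{B_r^\delta(f)}(\xi)=(1-r^2|\xi|^2)_+^\delta\,\hat f(\xi)$; equivalently it is convolution with the kernel $B_r^\delta(x)=r^{-n}B^\delta(x/r)$, where $B^\delta$ is the inverse Fourier transform of $(1-|\xi|^2)_+^\delta$. *)

theory Defs
  imports "HOL-Probability.Essential_Supremum"
begin

section \<open>Variable exponents on the half line\<close>

definition ess_sup :: "(real \<Rightarrow> real) \<Rightarrow> ereal" where
  "ess_sup p = esssup (lebesgue_on {0<..}) (\<lambda>t. ereal (p t))"

definition ess_inf :: "(real \<Rightarrow> real) \<Rightarrow> ereal" where
  "ess_inf p = - esssup (lebesgue_on {0<..}) (\<lambda>t. - ereal (p t))"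

definition log_decay_at_zero :: "(real \<Rightarrow> real) \<Rightarrow> real \<Rightarrow> bool" where
  "log_decay_at_zero p c \<longleftrightarrow>
     (\<exists>A>0. \<forall>t. 0 < t \<and> t \<le> 1/2 \<longrightarrow> \<bar>p t - c\<bar> \<le> A / \<bar>ln t\<bar>)"

definition log_decay_at_infinity :: "(real \<Rightarrow> real) \<Rightarrow> real \<Rightarrow> bool" where
  "log_decay_at_infinity p c \<longleftrightarrow>
     (\<exists>A>0. \<forall>t\<ge>2. \<bar>p t - c\<bar> \<le> A / ln t)"

definition P_0inf :: "(real \<Rightarrow> real) set" where
  "P_0inf = {p. p \<in> borel_measurable (lebesgue_on {0<..})
     \<and> (\<exists>M. \<forall>t>0. \<bar>p t\<bar> \<le> M)
     \<and> (\<exists>c. log_decay_at_zero p c) \<and> (\<exists>c. log_decay_at_infinity p c)}"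

text \<open>
  The numbers written $p(0)$ and $p(\infty)$ are not values of the function \<open>p\<close> (in particular
  not \<open>p 0\<close>, which is irrelevant); they are the limits of \<open>p\<close> at the two ends, and are
  uniquely determined.
\<close>

definition val_zero :: "(real \<Rightarrow> real) \<Rightarrow> real" where
  "val_zero p = (THE c. log_decay_at_zero p c)"

definition val_infinity :: "(real \<Rightarrow> real) \<Rightarrow> real" where
  "val_infinity p = (THE c. log_decay_at_infinity p c)"

lemma log_decay_at_zero_tendsto:
  assumes "log_decay_at_zero p c"
  shows "(p \<longlongrightarrow> c) (at_right 0)"
proof -
  obtain A where A: "\<And>t. 0 < t \<Longrightarrow> t \<le> 1/2 \<Longrightarrow> \<bar>p t - c\<bar> \<le> A / \<bar>ln t\<bar>"
    using assms unfolding log_decay_at_zero_def by blast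
  have "filterlim (\<lambda>t::real. ln t) at_infinity (at_right 0)"
    using ln_at_0 at_bot_le_at_infinity filterlim_mono by blast
  then have "((\<lambda>t. A / ln t) \<longlongrightarrow> 0) (at_right 0)"
    by (intro tendsto_divide_0[OF tendsto_const])
  then have *: "((\<lambda>t. \<bar>A / ln t\<bar>) \<longlongrightarrow> 0) (at_right 0)"
    by (rule tendsto_rabs_zero)
  have "eventually (\<lambda>t. t \<in> {0<..<1/2::real}) (at_right 0)"
    by (rule eventually_at_right_real) simp
  then have "eventually (\<lambda>t. norm (p t - c) \<le> \<bar>A / ln t\<bar>) (at_right 0)"
  proof eventually_elim
    case (elim t)
    have "\<bar>p t - c\<bar> \<le> A / \<bar>ln t\<bar>" using A[of t] elim by simp
    also have "\<dots> \<le> \<bar>A / ln t\<bar>" by (simp add: abs_divide divide_right_mono)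
    finally show ?case by simp
  qed
  then have "((\<lambda>t. p t - c) \<longlongrightarrow> 0) (at_right 0)"
    using * by (rule Lim_null_comparison)
  then show ?thesis by (simp add: LIM_zero_iff)
qed

lemma log_decay_at_infinity_tendsto:
  assumes "log_decay_at_infinity p c"
  shows "(p \<longlongrightarrow> c) at_top"
proof -
  obtain A where A: "\<And>t. 2 \<le> t \<Longrightarrow> \<bar>p t - c\<bar> \<le> A / ln t"
    using assms unfolding log_decay_at_infinity_def by blast
  have "filterlim (\<lambda>t::real. ln t) at_infinity at_top"
    using ln_at_top at_top_le_at_infinity filterlim_mono by blast
  then have *: "((\<lambda>t. A / ln t) \<longlongrightarrow> 0) at_top"
    by (intro tendsto_divide_0[OF tendsto_const])
  have "eventually (\<lambda>t. norm (p t - c) \<le> A / ln t) at_top"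
    using eventually_ge_at_top[of 2] by eventually_elim (use A in simp)
  then have "((\<lambda>t. p t - c) \<longlongrightarrow> 0) at_top"
    using * by (rule Lim_null_comparison)
  then show ?thesis by (simp add: LIM_zero_iff)
qed

lemma val_zero_eq: "log_decay_at_zero p c \<Longrightarrow> val_zero p = c"
  unfolding val_zero_def
  by (rule the_equality)
     (auto intro: tendsto_unique[OF trivial_limit_at_right_real] log_decay_at_zero_tendsto)

lemma val_infinity_eq: "log_decay_at_infinity p c \<Longrightarrow> val_infinity p = c"
  unfolding val_infinity_def
  by (rule the_equality)
     (auto intro: tendsto_unique[OF trivial_limit_at_top_linorder] log_decay_at_infinity_tendsto)

definition q_star :: "(real \<Rightarrow> real) \<Rightarrow> real \<Rightarrow> real" where
  "q_star q r = (if r < 1 then val_zero q else val_infinity q)"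

definition almost_decreasing :: "(real \<Rightarrow> real) \<Rightarrow> bool" where
  "almost_decreasing \<phi> \<longleftrightarrow> (\<forall>t>0. 0 \<le> \<phi> t) \<and> (\<exists>C\<ge>1. \<forall>s>0. \<forall>t\<ge>s. \<phi> t \<le> C * \<phi> s)"

definition almost_increasing :: "(real \<Rightarrow> real) \<Rightarrow> bool" where
  "almost_increasing \<phi> \<longleftrightarrow> (\<forall>t>0. 0 \<le> \<phi> t) \<and> (\<exists>C\<ge>1. \<forall>t>0. \<forall>s\<ge>t. \<phi> t \<le> C * \<phi> s)"


section \<open>The local variable Morrey-Lorentz space\<close>

text \<open>
  Rearrangements and norms take values in \<^typ>\<open>ennreal\<close>, so that the infimum of the empty set
  is \<open>\<infinity>\<close> and a function of infinite norm is not in the space. The power below is only of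
  interest for positive exponents.
\<close>

definition ennreal_powr :: "ennreal \<Rightarrow> real \<Rightarrow> ennreal" where
  "ennreal_powr x a = (if x = \<infinity> then \<infinity> else ennreal (enn2real x powr a))"

definition Lq_norm :: "(real \<Rightarrow> real) \<Rightarrow> real set \<Rightarrow> (real \<Rightarrow> ennreal) \<Rightarrow> ennreal" where
  "Lq_norm q S \<phi> = Inf {ennreal \<eta> |\<eta>. \<eta> > 0 \<and>
     (\<integral>\<^sup>+s\<in>S. ennreal_powr (\<phi> s / ennreal \<eta>) (q s) \<partial>lebesgue) \<le> 1}"

definition rearrangement :: "(real ^ 'n \<Rightarrow> complex) \<Rightarrow> real \<Rightarrow> ennreal" where
  "rearrangement f t = Inf {ennreal \<mu> |\<mu>. \<mu> > 0 \<and>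
     emeasure lebesgue {y. norm (f y) > \<mu>} \<le> ennreal t}"

definition morrey_lorentz_norm ::
    "(real \<Rightarrow> real) \<Rightarrow> (real \<Rightarrow> real) \<Rightarrow> real \<Rightarrow> (real ^ 'n \<Rightarrow> complex) \<Rightarrow> ennreal" where
  "morrey_lorentz_norm p q lam f =
     (SUP r\<in>{0<..}. ennreal (r powr (- (lam / q_star q r))) *
        Lq_norm q {0<..<r} (\<lambda>t. ennreal (t powr (1 / p t - 1 / q t)) * rearrangement f t))"

definition morrey_lorentz ::
    "(real \<Rightarrow> real) \<Rightarrow> (real \<Rightarrow> real) \<Rightarrow> real \<Rightarrow> (real ^ 'n \<Rightarrow> complex) set" where
  "morrey_lorentz p q lam = {f \<in> borel_measurable lebesgue. morrey_lorentz_norm p q lam f < \<infinity>}"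


section \<open>The Bochner-Riesz operator\<close>

text \<open>
  The Fourier transform is normalised as
  $\hat f(\xi) = \int f(x) e^{-2\pi i x\cdot\xi}\,dx$, so that its inverse carries no constant
  factor.
\<close>

definition inverse_fourier :: "(real ^ 'n \<Rightarrow> complex) \<Rightarrow> real ^ 'n \<Rightarrow> complex" where
  "inverse_fourier g x = (LINT \<xi>|lebesgue. g \<xi> * cis (2 * pi * (x \<bullet> \<xi>)))"

definition bochner_riesz_kernel :: "real \<Rightarrow> real ^ 'n \<Rightarrow> complex" where
  "bochner_riesz_kernel \<delta> =
     inverse_fourier (\<lambda>\<xi>. complex_of_real (max 0 (1 - (norm \<xi>)\<^sup>2) powr \<delta>))"

definition bochner_riesz_kernel_scaled :: "real \<Rightarrow> real \<Rightarrow> real ^ 'n \<Rightarrow> complex" where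
  "bochner_riesz_kernel_scaled \<delta> r x = bochner_riesz_kernel \<delta> (x /\<^sub>R r) /\<^sub>R r ^ CARD('n)"

text \<open>
  A function in the Morrey-Lorentz space need not have a Fourier transform given by an integral,
  hence the operator is defined by convolution with its kernel.
\<close>

definition bochner_riesz ::
    "real \<Rightarrow> real \<Rightarrow> (real ^ 'n \<Rightarrow> complex) \<Rightarrow> real ^ 'n \<Rightarrow> complex" where
  "bochner_riesz \<delta> r f x = (LINT y|lebesgue. bochner_riesz_kernel_scaled \<delta> r (x - y) * f y)"

text \<open>The Bochner integral is \<open>0\<close> by convention if it does not exist; this excludes that case.\<close>

definition bochner_riesz_defined ::
    "real \<Rightarrow> real \<Rightarrow> (real ^ 'n \<Rightarrow> complex) \<Rightarrow> bool" where
  "bochner_riesz_defined \<delta> r f \<longleftrightarrow>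
     (AE x in lebesgue. integrable lebesgue (\<lambda>y. bochner_riesz_kernel_scaled \<delta> r (x - y) * f y))"

end

theory Submission
  imports Defs "HOL-Complex_Analysis.Cauchy_Integral_Theorem"
begin

text \<open>
  The operator is convolution with a fixed integrable kernel, and every such convolution is bounded
  on the space; the two halves of this sentence are the two halves of the proof.

  \<^emph>\<open>The kernel is integrable.\<close> The symbol \<open>(1 - |\<xi>|\<^sup>2)\<^sub>+ powr \<delta>\<close> is radial, so that its transform at
  \<open>x\<close> is the transform at \<open>|x|\<close> of its projection onto a line. Integrating out the other
  \<open>n - 1\<close> variables turns the symbol into a multiple of \<open>(1 - s\<^sup>2)\<^sub>+ powr \<nu>\<close> with
  \<open>\<nu> = \<delta> + (n - 1)/2\<close>, and moving the path of integration from \<open>[-1, 1]\<close> into the upper half plane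
  shows that the transform of the latter is \<open>O(t powr (-\<nu> - 1))\<close>
  (\<open>fourier_jacobi_decay\<close>). The hypothesis on \<open>\<delta>\<close> says exactly that \<open>\<nu> + 1 > n\<close>, which makes
  the kernel integrable on the \<open>n\<close>-dimensional space (\<open>bochner_riesz_kernel_scaled_integrable\<close>).

  \<^emph>\<open>From the kernel to a Hardy operator.\<close> Convolution with \<open>k\<close> has norm at most \<open>A = \<parallel>k\<parallel>\<^sub>1\<close>
  both on the integrable and on the bounded functions. Cutting \<open>f\<close> at the height \<open>f\<^sup>*(t)\<close> gives
  \<open>(k * f)\<^sup>*(t) \<le> (2 A / t) \<integral>\<^sub>0\<^sup>t f\<^sup>*\<close> (\<open>convolution_rearrangement\<close>). Up to the factor \<open>2 A\<close> this is the
  Hardy average of \<open>f\<^sup>*\<close>, and on \<open>(0, r)\<close> it only sees the values of \<open>f\<^sup>*\<close> on \<open>(0, r)\<close>. Hence it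
  suffices to bound the Hardy average of \<open>f\<^sup>* 1\<^bsub>(0, r)\<^esub>\<close> in the weighted space on the whole half line,
  with a constant independent of \<open>r\<close>; the factor \<open>r powr (- \<lambda> / q\<^sub>*(r))\<close> of the Morrey norm is then
  carried along unchanged (\<open>Lq_norm_convolution\<close>).

  \<^emph>\<open>The Hardy inequality with variable exponent.\<close> The logarithmic decay conditions allow one to
  replace \<open>q(t)\<close> and \<open>\<beta>(t)\<close> by their limits, those at \<open>0\<close> for \<open>t \<le> 1\<close> and those at \<open>\<infinity>\<close> for \<open>t > 1\<close>:
  a power \<open>Y powr q(t)\<close> changes by a bounded factor as long as \<open>Y\<close> lies between two powers of
  \<open>exp (1 + |ln t|)\<close>, and smaller values of \<open>Y\<close> contribute an integrable error
  (\<open>powr_exchange_exponent\<close>). The required polynomial upper bound for a nonincreasing function follows from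
  its modular (\<open>antimono_modular_growth\<close>). For constant exponents the inequality is the classical
  one with power weights, which needs \<open>\<beta> < 1 - 1/q\<close> at both ends. Since \<open>\<beta> = 1/p - 1/q\<close>, this
  is \<open>p > 1\<close> in the limit and follows from the bound on the essential infimum of \<open>p\<close>.
\<close>

section \<open>The Fourier transform of a power of $1 - s^2$ on an interval\<close>

lemma powr_le_exp_half:
  fixes u \<nu> :: real
  assumes "0 < \<nu>" "0 \<le> u"
  shows "u powr \<nu> \<le> (2 * \<nu>) powr \<nu> * exp (u / 2)"
proof -
  have "u / (2 * \<nu>) \<le> exp (u / (2 * \<nu>))"
    using exp_ge_add_one_self[of "u / (2 * \<nu>)"] by linarith
  then have "(u / (2 * \<nu>)) powr \<nu> \<le> exp (u / (2 * \<nu>)) powr \<nu>"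
    using assms by (intro powr_mono2) auto
  also have "exp (u / (2 * \<nu>)) powr \<nu> = exp (u / 2)"
    using assms by (simp add: powr_def)
  finally show ?thesis
    using assms by (simp add: powr_divide field_simps)
qed

text \<open>
  The analytic continuation of \<open>(1 - s\<^sup>2) powr \<nu> * cis (t * s)\<close> to the strip \<open>|Re z| \<le> 1\<close>, where
  \<open>1 - z\<^sup>2\<close> stays in the closed right half plane and the principal branch of the power is continuous.
\<close>

definition jacobi_wave :: "real \<Rightarrow> real \<Rightarrow> complex \<Rightarrow> complex" where
  "jacobi_wave \<nu> t z = (1 - z\<^sup>2) powr of_real \<nu> * exp (\<i> * of_real t * z)"

lemma norm_jacobi_wave:
  "norm (jacobi_wave \<nu> t z) = norm (1 - z\<^sup>2) powr \<nu> * exp (- t * Im z)"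
  by (simp add: jacobi_wave_def norm_mult norm_powr_real_powr')

lemma Re_one_minus_square: "Re (1 - z\<^sup>2) = (1 - (Re z)\<^sup>2) + (Im z)\<^sup>2"
  by (simp add: power2_eq_square)

lemma continuous_on_jacobi_wave:
  assumes "\<nu> > 0"
  shows "continuous_on {z. \<bar>Re z\<bar> \<le> 1} (jacobi_wave \<nu> t)"
proof -
  have pow: "continuous_on {z. \<bar>Re z\<bar> \<le> 1} (\<lambda>z. (1 - z\<^sup>2) powr complex_of_real \<nu>)"
  proof (rule continuous_on_powr_complex)
    have "0 \<le> Re (1 - z\<^sup>2)" if "\<bar>Re z\<bar> \<le> 1" for z
      using that abs_square_le_1[of "Re z"] unfolding Re_one_minus_square by (intro add_nonneg_nonneg) auto
    then show "{z. \<bar>Re z\<bar> \<le> 1} \<subseteq> {z. 0 \<le> Re (1 - z\<^sup>2) \<or> Im (1 - z\<^sup>2) \<noteq> 0}" by blast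
    show "continuous_on {z::complex. \<bar>Re z\<bar> \<le> 1} (\<lambda>z. 1 - z\<^sup>2)"
      by (intro continuous_on_diff continuous_on_power continuous_on_const continuous_on_id)
  qed (use assms in simp_all)
  show ?thesis
    unfolding jacobi_wave_def[abs_def]
    by (rule continuous_on_mult[OF pow])
       (rule continuous_on_exp, rule continuous_on_mult_left, rule continuous_on_id)
qed

lemma jacobi_wave_field_differentiable:
  assumes "\<bar>Re z\<bar> < 1"
  shows "jacobi_wave \<nu> t field_differentiable at z"
proof -
  have "0 < Re (1 - z\<^sup>2)"
    using assms abs_square_less_1[of "Re z"] unfolding Re_one_minus_square by (intro add_pos_nonneg) auto
  then have n: "1 - z\<^sup>2 \<notin> \<real>\<^sub>\<le>\<^sub>0" by (simp add: complex_nonpos_Reals_iff)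
  have "((\<lambda>w. 1 - w\<^sup>2) has_field_derivative - (2 * z)) (at z)"
    by (auto intro!: derivative_eq_intros)
  from DERIV_chain2[OF has_field_derivative_powr[OF n] this]
  have "(\<lambda>w. (1 - w\<^sup>2) powr of_real \<nu>) field_differentiable at z"
    unfolding field_differentiable_def by blast
  moreover have "(\<lambda>w. exp (\<i> * of_real t * w)) field_differentiable at z"
    unfolding field_differentiable_def by (rule exI) (auto intro!: derivative_eq_intros)
  ultimately show ?thesis
    unfolding jacobi_wave_def[abs_def] by (rule field_differentiable_mult)
qed

text \<open>
  At \<open>z = c + i y\<close> the modulus of \<open>1 - z\<^sup>2\<close> is at most \<open>3 y\<close> and that of the exponential is
  \<open>exp (- t y)\<close>. Integrating \<open>y powr \<nu> * exp (- t y)\<close> produces the decay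
  \<open>t powr (- \<nu> - 1)\<close>: the two end points of the interval alone determine it.
\<close>

lemma vertical_side_bound:
  assumes \<nu>: "\<nu> > 0" and t: "t > 0" and c: "c = 1 \<or> c = - 1"
  shows "norm (contour_integral (linepath (of_real c) (of_real c + \<i>)) (jacobi_wave \<nu> t))
           \<le> 2 * (6 * \<nu>) powr \<nu> * t powr (- \<nu> - 1)"
proof -
  define F where "F = jacobi_wave \<nu> t"
  define M where "M = 3 powr \<nu> * ((2 * \<nu>) powr \<nu> * t powr (- \<nu>))"
  have lp: "linepath (of_real c) (of_real c + \<i>) y = of_real c + \<i> * of_real y" for y
    by (simp add: linepath_def algebra_simps scaleR_conv_of_real)
  have cont: "continuous_on (closed_segment (of_real c) (of_real c + \<i>)) F"
    unfolding F_def
  proof (rule continuous_on_subset[OF continuous_on_jacobi_wave[OF \<nu>]])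
    show "closed_segment (complex_of_real c) (of_real c + \<i>) \<subseteq> {z. \<bar>Re z\<bar> \<le> 1}"
      using c by (auto simp: closed_segment_def algebra_simps)
  qed
  have eq: "contour_integral (linepath (of_real c) (of_real c + \<i>)) F =
        integral {0..1} (\<lambda>y. F (of_real c + \<i> * of_real y) * \<i>)"
    unfolding contour_integral_integral by (simp add: lp)
  have int: "(\<lambda>y. F (of_real c + \<i> * of_real y) * \<i>) integrable_on {0..1}"
    using contour_integrable_continuous_linepath[OF cont]
    by (auto simp: contour_integrable_on lp)
  have hg: "((\<lambda>y. M * exp (- (t/2) * y)) has_integral (M * (2/t) * (1 - exp (-t/2)))) {0..1}"
  proof -
    have "((\<lambda>y. M * exp (- (t/2) * y)) has_integral
        (- M * (2/t) * exp (- (t/2) * 1)) - (- M * (2/t) * exp (- (t/2) * 0))) {0..1}"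
      using t by (intro fundamental_theorem_of_calculus)
         (auto intro!: derivative_eq_intros simp flip: has_real_derivative_iff_has_vector_derivative)
    then show ?thesis by (simp add: algebra_simps)
  qed
  have bd: "norm (F (of_real c + \<i> * of_real y) * \<i>) \<le> M * exp (- (t/2) * y)" if "y \<in> {0..1}" for y
  proof -
    have y: "0 \<le> y" "y \<le> 1" using that by auto
    have yn: "y powr \<nu> * exp (- t * y) \<le> (2 * \<nu>) powr \<nu> * t powr (- \<nu>) * exp (- (t/2) * y)"
    proof -
      have "(t * y) powr \<nu> \<le> (2 * \<nu>) powr \<nu> * exp (t * y / 2)"
        using \<nu> t y by (intro powr_le_exp_half) auto
      then have "t powr (- \<nu>) * (t * y) powr \<nu> * exp (- t * y) \<le>
          t powr (- \<nu>) * ((2 * \<nu>) powr \<nu> * exp (t * y / 2)) * exp (- t * y)"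
        by (intro mult_right_mono mult_left_mono) auto
      moreover have "t powr (- \<nu>) * (t * y) powr \<nu> = y powr \<nu>"
        using t y by (simp add: powr_mult powr_minus)
      moreover have "exp (t * y / 2) * exp (- t * y) = exp (- (t/2) * y)"
        by (simp flip: exp_add)
      ultimately show ?thesis by (metis (no_types, lifting) mult.assoc mult.commute)
    qed
    have "norm (F (of_real c + \<i> * of_real y) * \<i>) \<le> 3 powr \<nu> * (y powr \<nu> * exp (- t * y))"
    proof -
      have "1 - (of_real c + \<i> * of_real y)\<^sup>2 = of_real y * (of_real y - 2 * \<i> * of_real c)"
        using c by (auto simp: power2_eq_square algebra_simps)
      moreover have "norm (complex_of_real y - 2 * \<i> * of_real c) \<le> 3"
        using norm_triangle_ineq4[of "complex_of_real y" "2 * \<i> * of_real c"] c y by (auto simp: norm_mult)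
      ultimately have "norm (1 - (of_real c + \<i> * complex_of_real y)\<^sup>2) \<le> y * 3"
        using y by (simp add: norm_mult mult_left_mono)
      then have "norm (1 - (of_real c + \<i> * complex_of_real y)\<^sup>2) powr \<nu> \<le> (y * 3) powr \<nu>"
        using \<nu> by (intro powr_mono2) auto
      then have "norm (F (of_real c + \<i> * of_real y) * \<i>) \<le> (y * 3) powr \<nu> * exp (- t * y)"
        by (simp add: F_def norm_jacobi_wave norm_mult mult_right_mono)
      then show ?thesis by (simp add: powr_mult mult_ac)
    qed
    also have "\<dots> \<le> 3 powr \<nu> * ((2 * \<nu>) powr \<nu> * t powr (- \<nu>) * exp (- (t/2) * y))"
      by (intro mult_left_mono yn) auto
    finally show ?thesis by (simp add: M_def mult_ac)
  qed
  have M0: "M \<ge> 0" by (simp add: M_def)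
  have "norm (contour_integral (linepath (of_real c) (of_real c + \<i>)) F)
      \<le> integral {0..1} (\<lambda>y. M * exp (- (t/2) * y))"
    unfolding eq using int hg bd by (intro integral_norm_bound_integral) auto
  also have "\<dots> = M * (2/t) * (1 - exp (-t/2))" by (rule integral_unique[OF hg])
  also have "\<dots> \<le> M * (2/t) * 1" using M0 t by (intro mult_left_mono) auto
  also have "\<dots> = 2 * (6 * \<nu>) powr \<nu> * t powr (- \<nu> - 1)"
    using t \<nu> powr_mult[of 3 "2 * \<nu>" \<nu>] by (simp add: M_def powr_diff)
  finally show ?thesis by (simp add: F_def)
qed

text \<open>
  At height one the integrand is exponentially small in \<open>t\<close>, which is better than any power.
\<close>

lemma horizontal_side_bound:
  assumes \<nu>: "\<nu> > 0" and t: "t > 0"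
  shows "norm (contour_integral (linepath (1 + \<i>) (- 1 + \<i>)) (jacobi_wave \<nu> t))
           \<le> 2 * (9 powr \<nu> * (2 * (\<nu> + 1)) powr (\<nu> + 1)) * t powr (- \<nu> - 1)"
proof -
  define F where "F = jacobi_wave \<nu> t"
  define B where "B = 9 powr \<nu> * exp (- t)"
  have re_im: "\<bar>Re z\<bar> \<le> 1 \<and> Im z = 1" if z: "z \<in> closed_segment (1 + \<i>) (- 1 + \<i>)" for z
  proof -
    obtain u where u: "0 \<le> u" "u \<le> 1" "z = (1 - u) *\<^sub>R (1 + \<i>) + u *\<^sub>R (- 1 + \<i>)"
      using z by (auto simp: closed_segment_def)
    then have "Re z = 1 - 2 * u" "Im z = 1" by simp_all
    then show ?thesis using u by linarith
  qed
  then have seg: "closed_segment (1 + \<i>) (- 1 + \<i>) \<subseteq> {z. \<bar>Re z\<bar> \<le> 1}" by blast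
  have "norm (F z) \<le> B" if z: "z \<in> closed_segment (1 + \<i>) (- 1 + \<i>)" for z
  proof -
    have re: "\<bar>Re z\<bar> \<le> 1" and im: "Im z = 1" using re_im[OF z] by auto
    have "norm z \<le> 2" using cmod_le[of z] re im by simp
    then have "norm (1 - z\<^sup>2) \<le> 9"
      using norm_triangle_ineq4[of 1 "z\<^sup>2"] power_mono[of "norm z" 2 2] by (simp add: norm_power)
    then have "norm (1 - z\<^sup>2) powr \<nu> * exp (- t) \<le> 9 powr \<nu> * exp (- t)"
      using \<nu> by (intro mult_right_mono powr_mono2) auto
    then show ?thesis unfolding F_def norm_jacobi_wave B_def using im by simp
  qed
  moreover have "F contour_integrable_on linepath (1 + \<i>) (- 1 + \<i>)"
    unfolding F_def
    using seg by (rule contour_integrable_continuous_linepath[OF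
          continuous_on_subset[OF continuous_on_jacobi_wave[OF \<nu>]]])
  ultimately have "norm (contour_integral (linepath (1 + \<i>) (- 1 + \<i>)) F) \<le> B * norm ((- 1 + \<i>) - (1 + \<i>))"
    by (intro contour_integral_bound_linepath) (auto simp: B_def)
  also have "\<dots> = 2 * B" by simp
  also have "\<dots> \<le> 2 * (9 powr \<nu> * (2 * (\<nu> + 1)) powr (\<nu> + 1)) * t powr (- \<nu> - 1)"
  proof -
    have "t powr (\<nu> + 1) \<le> (2 * (\<nu> + 1)) powr (\<nu> + 1) * exp (t / 2)"
      using \<nu> t by (intro powr_le_exp_half) auto
    also have "\<dots> \<le> (2 * (\<nu> + 1)) powr (\<nu> + 1) * exp t"
      using t by (intro mult_left_mono) auto
    finally have "exp (- t) * t powr (\<nu> + 1) \<le> (2 * (\<nu> + 1)) powr (\<nu> + 1)"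
      by (simp add: exp_minus field_simps)
    then have "exp (- t) * t powr (\<nu> + 1) * t powr (- \<nu> - 1) \<le> (2 * (\<nu> + 1)) powr (\<nu> + 1) * t powr (- \<nu> - 1)"
      by (rule mult_right_mono) simp
    moreover have "t powr (\<nu> + 1) * t powr (- \<nu> - 1) = 1"
      using t powr_add[of t "\<nu> + 1" "- \<nu> - 1"] by simp
    ultimately have "exp (- t) \<le> (2 * (\<nu> + 1)) powr (\<nu> + 1) * t powr (- \<nu> - 1)"
      by (simp add: mult_ac)
    then show ?thesis unfolding B_def
      using mult_left_mono[of "exp (- t)" _ "2 * 9 powr \<nu>"] by (simp only: mult.assoc) simp
  qed
  finally show ?thesis by (simp add: F_def)
qed

abbreviation fourier_jacobi :: "real \<Rightarrow> real \<Rightarrow> complex" where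
  "fourier_jacobi \<nu> t \<equiv> integral {-1..1} (\<lambda>s. complex_of_real ((1 - s\<^sup>2) powr \<nu>) * cis (t * s))"

text \<open>
  Cauchy's theorem on the rectangle over \<open>[-1, 1]\<close> of height one replaces the integral over the bottom side by
  the integrals over the three other sides. At the corners \<open>\<plusminus>1\<close> the integrand is continuous but in
  general not differentiable, so that the version for functions differentiable in the interior is used.
\<close>

lemma fourier_jacobi_decay:
  assumes \<nu>: "\<nu> > 0"
  obtains C where "C \<ge> 0"
    "\<And>t. t > 0 \<Longrightarrow> norm (fourier_jacobi \<nu> t)
        \<le> C * t powr (- \<nu> - 1)"
proof
  define C where "C = 4 * (6 * \<nu>) powr \<nu> + 2 * (9 powr \<nu> * (2 * (\<nu> + 1)) powr (\<nu> + 1))"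
  show "C \<ge> 0" by (simp add: C_def)
  fix t :: real assume t: "t > 0"
  define F where "F = jacobi_wave \<nu> t"
  define S where "S = {z. -1 \<le> Re z \<and> Re z \<le> 1 \<and> 0 \<le> Im z \<and> Im z \<le> 1}"
  have S: "S = cbox (-1) (1 + \<i>)" by (auto simp: S_def in_cbox_complex_iff)
  have cont: "continuous_on S F" unfolding F_def
    by (rule continuous_on_subset[OF continuous_on_jacobi_wave[OF \<nu>]]) (auto simp: S_def)
  have seg: "closed_segment a b \<subseteq> S" if "a \<in> S" "b \<in> S" for a b
    using that closed_segment_subset[of a S b] by (auto simp: S)
  have int: "F contour_integrable_on linepath a b" if "a \<in> S" "b \<in> S" for a b
    using contour_integrable_continuous_linepath continuous_on_subset[OF cont seg[OF that]] by blast
  define g where "g = linepath (-1) 1 +++ linepath 1 (1 + \<i>) +++ linepath (1 + \<i>) (-1 + \<i>) +++ linepath (-1 + \<i>) (-1)"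
  have corners: "-1 \<in> S" "1 \<in> S" "1 + \<i> \<in> S" "-1 + \<i> \<in> S" by (auto simp: S_def)
  have "(F has_contour_integral 0) g"
  proof (rule Cauchy_theorem_convex[OF cont, where K = "{}"])
    show "convex S" by (simp add: S)
    show "F field_differentiable at z" if "z \<in> interior S - {}" for z
      using that unfolding F_def
      by (intro jacobi_wave_field_differentiable) (auto simp: S interior_cbox in_box_complex_iff)
    show "valid_path g" by (auto simp: g_def intro!: valid_path_join)
    show "path_image g \<subseteq> S" using corners seg by (auto simp: g_def path_image_join)
    show "pathfinish g = pathstart g" by (simp add: g_def)
  qed auto
  moreover have "(F has_contour_integral (contour_integral (linepath (-1) 1) F +
      (contour_integral (linepath 1 (1 + \<i>)) F + (contour_integral (linepath (1 + \<i>) (-1 + \<i>)) F +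
       contour_integral (linepath (-1 + \<i>) (-1)) F)))) g"
    unfolding g_def using int corners
    by (intro has_contour_integral_join valid_path_join has_contour_integral_integral) simp_all
  ultimately have "contour_integral (linepath (-1) 1) F +
      (contour_integral (linepath 1 (1 + \<i>)) F + (contour_integral (linepath (1 + \<i>) (-1 + \<i>)) F +
       contour_integral (linepath (-1 + \<i>) (-1)) F)) = 0"
    using has_contour_integral_unique by blast
  moreover have "contour_integral (linepath (-1 + \<i>) (-1)) F = - contour_integral (linepath (-1) (-1 + \<i>)) F"
    using corners by (intro contour_integral_reverse_linepath continuous_on_subset[OF cont seg]) auto
  ultimately have "contour_integral (linepath (-1) 1) F =
      contour_integral (linepath (-1) (-1 + \<i>)) F - contour_integral (linepath 1 (1 + \<i>)) F
      - contour_integral (linepath (1 + \<i>) (-1 + \<i>)) F"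
    by algebra
  note eq = this
  have "norm (contour_integral (linepath (-1) 1) F) \<le>
      norm (contour_integral (linepath 1 (1 + \<i>)) F) + norm (contour_integral (linepath (1 + \<i>) (-1 + \<i>)) F)
      + norm (contour_integral (linepath (-1) (-1 + \<i>)) F)"
    unfolding eq using norm_triangle_ineq4[of "contour_integral (linepath (-1) (-1 + \<i>)) F - contour_integral (linepath 1 (1 + \<i>)) F"
        "contour_integral (linepath (1 + \<i>) (-1 + \<i>)) F"]
      norm_triangle_ineq4[of "contour_integral (linepath (-1) (-1 + \<i>)) F" "contour_integral (linepath 1 (1 + \<i>)) F"]
    by linarith
  also have "\<dots> \<le> C * t powr (- \<nu> - 1)"
    using vertical_side_bound[OF \<nu> t, of 1] vertical_side_bound[OF \<nu> t, of "-1"] horizontal_side_bound[OF \<nu> t]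
    by (simp add: C_def F_def algebra_simps)
  finally have "norm (contour_integral (linepath (-1) 1) F) \<le> C * t powr (- \<nu> - 1)" .
  moreover have "contour_integral (linepath (-1) 1) F = integral {-1..1} (\<lambda>x. F (of_real x))"
    by (rule contour_integral_linepath_Reals_eq[of "-1" 1, simplified])
  moreover have "integral {-1..1} (\<lambda>x. F (of_real x)) =
      fourier_jacobi \<nu> t"
  proof (rule integral_cong)
    fix s :: real assume s: "s \<in> {-1..1}"
    have "s\<^sup>2 \<le> 1" using s by (simp add: abs_square_le_1 abs_le_iff)
    then have "(1 - (complex_of_real s)\<^sup>2) powr of_real \<nu> = of_real ((1 - s\<^sup>2) powr \<nu>)"
      using powr_of_real[of "1 - s\<^sup>2" \<nu>] by simp
    then show "F (of_real s) = complex_of_real ((1 - s\<^sup>2) powr \<nu>) * cis (t * s)"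
      by (simp add: F_def jacobi_wave_def cis_conv_exp mult_ac)
  qed
  ultimately show "norm (fourier_jacobi \<nu> t)
        \<le> C * t powr (- \<nu> - 1)" by simp
qed

section \<open>Orthogonal invariance and marginals of the symbol\<close>

lemma nn_integral_lborel_translate:
  fixes g :: "'a::euclidean_space \<Rightarrow> ennreal"
  assumes [measurable]: "g \<in> borel_measurable borel"
  shows "(\<integral>\<^sup>+x. g (c + x) \<partial>lborel) = (\<integral>\<^sup>+x. g x \<partial>lborel)"
proof -
  have "distr lborel borel (\<lambda>x. c + x) = (lborel :: 'a measure)"
    using lborel_affine[of 1 c] by (simp add: density_1)
  then show ?thesis
    using nn_integral_distr[of "\<lambda>x. c + x" "lborel :: 'a measure" borel g] by simp
qed

text \<open>
  Uniqueness of the translation invariant measure, in the form needed: by Fubini and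
  translation invariance, \<open>\<integral> g \<cdot> \<integral> h(f y) dy = \<integral>\<integral> g(x) h(x + f y) = \<integral> h \<cdot> \<integral> g(- f y) dy\<close>.
  For \<open>h\<close> the indicator of the unit ball, \<open>h \<circ> f = h\<close>, and the common factor \<open>\<integral> h\<close> cancels.
\<close>

lemma orthogonal_nn_integral_reflected:
  fixes f :: "'a::euclidean_space \<Rightarrow> 'a" and g :: "'a \<Rightarrow> ennreal"
  assumes f: "orthogonal_transformation f" and g[measurable]: "g \<in> borel_measurable borel"
  shows "(\<integral>\<^sup>+y. g (- f y) \<partial>lborel) = (\<integral>\<^sup>+x. g x \<partial>lborel)"
proof -
  have lin: "linear f" using f by (rule orthogonal_transformation_linear)
  have [measurable]: "f \<in> borel_measurable borel"
    using lin by (intro borel_measurable_continuous_onI linear_continuous_on) (simp add: linear_conv_bounded_linear)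
  (* Any set of finite positive measure invariant under f would do. *)
  define h :: "'a \<Rightarrow> ennreal" where "h = indicator (ball 0 1)"
  have [measurable]: "h \<in> borel_measurable borel" unfolding h_def by (intro borel_measurable_indicator) auto
  have hf: "h (f y) = h y" for y
    by (simp add: h_def indicator_def orthogonal_transformation_norm[OF f])
  define I where "I = (\<integral>\<^sup>+y. h y \<partial>lborel)"
  have I: "I = emeasure lborel (ball (0::'a) 1)" by (simp add: I_def h_def)
  have "0 < I" unfolding I by (simp add: emeasure_ball)
  moreover have "I < \<infinity>" unfolding I by (rule emeasure_lborel_ball_finite)
  ultimately have I': "I \<noteq> 0" "I \<noteq> \<infinity>" by auto
  have inner: "(\<integral>\<^sup>+y. h (x + f y) \<partial>lborel) = I" for x
  proof -
    obtain z where z: "f z = x"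
      using orthogonal_transformation_surj[OF f] by (metis surjD)
    have "h (x + f y) = h (z + y)" for y
      using hf[of "z + y"] by (simp add: z linear_add[OF lin])
    then show ?thesis
      using nn_integral_lborel_translate[of h z] by (simp add: I_def)
  qed
  have inner2: "(\<integral>\<^sup>+x. g x * h (x + f y) \<partial>lborel) = (\<integral>\<^sup>+x. g (x - f y) * h x \<partial>lborel)" for y
    using nn_integral_lborel_translate[of "\<lambda>x. g (x - f y) * h x" "f y"] by (simp add: add.commute)
  have inner3: "(\<integral>\<^sup>+y. g (x - f y) \<partial>lborel) = (\<integral>\<^sup>+y. g (- f y) \<partial>lborel)" for x
  proof -
    obtain z where z: "f z = x"
      using orthogonal_transformation_surj[OF f] by (metis surjD)
    have "g (- f y) = g (x - f (z + y))" for y by (simp add: z linear_add[OF lin])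
    then show ?thesis
      using nn_integral_lborel_translate[of "\<lambda>y. g (x - f y)" z] by simp
  qed
  have "(\<integral>\<^sup>+x. g x \<partial>lborel) * I = (\<integral>\<^sup>+x. g x * (\<integral>\<^sup>+y. h (x + f y) \<partial>lborel) \<partial>lborel)"
    by (simp add: inner nn_integral_multc)
  also have "\<dots> = (\<integral>\<^sup>+x. (\<integral>\<^sup>+y. g x * h (x + f y) \<partial>lborel) \<partial>lborel)"
    by (simp add: nn_integral_cmult)
  also have "\<dots> = (\<integral>\<^sup>+y. (\<integral>\<^sup>+x. g x * h (x + f y) \<partial>lborel) \<partial>lborel)"
    by (rule lborel_pair.Fubini') simp
  also have "\<dots> = (\<integral>\<^sup>+y. (\<integral>\<^sup>+x. g (x - f y) * h x \<partial>lborel) \<partial>lborel)"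
    by (simp add: inner2)
  also have "\<dots> = (\<integral>\<^sup>+x. (\<integral>\<^sup>+y. g (x - f y) * h x \<partial>lborel) \<partial>lborel)"
    by (rule lborel_pair.Fubini') simp
  also have "\<dots> = (\<integral>\<^sup>+y. g (- f y) \<partial>lborel) * I"
    by (simp add: nn_integral_multc inner3 nn_integral_cmult I_def)
  finally show ?thesis using I' by (simp add: mult.commute[of _ I] ennreal_mult_cancel_left)
qed

lemma distr_lborel_orthogonal:
  fixes f :: "'a::euclidean_space \<Rightarrow> 'a"
  assumes f: "orthogonal_transformation f"
  shows "distr lborel borel f = lborel"
proof (rule measure_eqI)
  have [measurable]: "f \<in> borel_measurable borel"
    using orthogonal_transformation_linear[OF f]
    by (intro borel_measurable_continuous_onI linear_continuous_on) (simp add: linear_conv_bounded_linear)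
  fix A assume "A \<in> sets (distr lborel borel f)"
  then have [measurable]: "A \<in> sets borel" by simp
  have "emeasure (distr lborel borel f) A = (\<integral>\<^sup>+y. indicator A (f y) \<partial>lborel)"
    by (simp add: nn_integral_indicator[symmetric] nn_integral_distr del: nn_integral_indicator)
  also have "\<dots> = (\<integral>\<^sup>+x. indicator A x \<partial>lborel)"
    using orthogonal_nn_integral_reflected[of "\<lambda>x. - f x" "indicator A"] f
    by (simp add: orthogonal_transformation_neg)
  finally show "emeasure (distr lborel borel f) A = emeasure lborel A" by simp
qed simp

text \<open>
  Substituting \<open>y = sqrt c * u\<close> extracts the power of \<open>c\<close>.
\<close>

lemma nn_integral_paraboloid_1:
  fixes \<mu> :: real
  assumes "\<mu> > 0"
  obtains K where "K \<ge> 0"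
    "\<And>c. (\<integral>\<^sup>+y. ennreal (max 0 (c - y\<^sup>2) powr \<mu>) \<partial>lborel) = ennreal (K * max 0 c powr (\<mu> + 1/2))"
proof -
  define J where "J = (\<integral>\<^sup>+y. ennreal (max 0 (1 - y\<^sup>2) powr \<mu>) \<partial>lborel)"
  have "J \<le> (\<integral>\<^sup>+y. indicator {-1..1::real} y \<partial>lborel)"
    unfolding J_def
  proof (rule nn_integral_mono)
    fix y :: real
    show "ennreal (max 0 (1 - y\<^sup>2) powr \<mu>) \<le> indicator {-1..1} y"
    proof (cases "y \<in> {-1..1}")
      case True
      have "max 0 (1 - y\<^sup>2) powr \<mu> \<le> 1 powr \<mu>" using assms by (intro powr_mono2) auto
      then show ?thesis using True by simp
    next
      case False
      then have "1 < \<bar>y\<bar>" by auto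
      then have "1 \<le> y\<^sup>2" using abs_le_square_iff[of 1 y] by simp
      then show ?thesis using assms by simp
    qed
  qed
  also have "\<dots> < \<infinity>" by simp
  finally obtain K where K: "K \<ge> 0" "J = ennreal K" by (cases J) auto
  have "(\<integral>\<^sup>+y. ennreal (max 0 (c - y\<^sup>2) powr \<mu>) \<partial>lborel) = ennreal (K * max 0 c powr (\<mu> + 1/2))" for c
  proof (cases "c > 0")
    case False
    then have "max 0 (c - y\<^sup>2) = 0" for y by (simp add: max_def) (smt (verit) zero_le_power2)
    then show ?thesis using False assms by (simp add: max_def)
  next
    case True
    define s where "s = sqrt c"
    have s: "s > 0" "s\<^sup>2 = c" using True by (auto simp: s_def)
    have "max 0 (c - (0 + s * y)\<^sup>2) powr \<mu> = c powr \<mu> * max 0 (1 - y\<^sup>2) powr \<mu>" for y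
    proof -
      have "max 0 (c - (0 + s * y)\<^sup>2) = c * max 0 (1 - y\<^sup>2)"
        using True max_mult_distrib_left[of c 0 "1 - y\<^sup>2"] by (simp add: power_mult_distrib s algebra_simps)
      then show ?thesis using True by (simp add: powr_mult)
    qed
    then have "(\<integral>\<^sup>+y. ennreal (max 0 (c - y\<^sup>2) powr \<mu>) \<partial>lborel)
        = ennreal s * (\<integral>\<^sup>+y. ennreal (c powr \<mu>) * ennreal (max 0 (1 - y\<^sup>2) powr \<mu>) \<partial>lborel)"
      using s by (subst nn_integral_real_affine[where c = s and t = 0]) (auto simp: ennreal_mult)
    also have "\<dots> = ennreal s * (ennreal (c powr \<mu>) * J)"
      by (simp add: nn_integral_cmult J_def)
    also have "\<dots> = ennreal (K * (c powr \<mu> * s))"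
      using s K by (simp add: ennreal_mult' mult_ac)
    also have "c powr \<mu> * s = max 0 c powr (\<mu> + 1/2)"
      using True by (simp add: s_def powr_add powr_half_sqrt)
    finally show ?thesis .
  qed
  then show ?thesis using that K by blast
qed

text \<open>
  Integrating out one variable raises the exponent by \<open>1/2\<close>. Both sides vanish for \<open>c \<le> 0\<close>; the
  statement for all \<open>c\<close> is what the induction needs, where \<open>c\<close> becomes \<open>c - y\<^sup>2\<close>.
\<close>

lemma nn_integral_paraboloid:
  fixes \<delta> :: real
  assumes "finite A" "\<delta> > 0"
  shows "\<exists>K\<ge>0. \<forall>c. (\<integral>\<^sup>+x. ennreal (max 0 (c - (\<Sum>i\<in>A. (x i)\<^sup>2)) powr \<delta>) \<partial>(\<Pi>\<^sub>M i\<in>A. lborel))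
            = ennreal (K * max 0 c powr (\<delta> + card A / 2))"
  using assms(1)
proof (induction A)
  case empty
  show ?case
    by (rule exI[of _ 1]) (simp add: PiM_empty nn_integral_count_space_finite)
next
  case (insert i A)
  interpret product_sigma_finite "\<lambda>_. lborel :: real measure" by standard
  obtain K where K: "K \<ge> 0" "\<And>c. (\<integral>\<^sup>+x. ennreal (max 0 (c - (\<Sum>i\<in>A. (x i)\<^sup>2)) powr \<delta>) \<partial>(\<Pi>\<^sub>M i\<in>A. lborel))
            = ennreal (K * max 0 c powr (\<delta> + card A / 2))"
    using insert.IH by auto
  have "\<delta> + card A / 2 > 0" using assms(2) by (simp add: add_pos_nonneg)
  then obtain K' where K': "K' \<ge> 0"
    "\<And>c. (\<integral>\<^sup>+y. ennreal (max 0 (c - y\<^sup>2) powr (\<delta> + card A / 2)) \<partial>lborel)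
       = ennreal (K' * max 0 c powr ((\<delta> + card A / 2) + 1/2))"
    using nn_integral_paraboloid_1 by metis
  have "(\<integral>\<^sup>+x. ennreal (max 0 (c - (\<Sum>j\<in>insert i A. (x j)\<^sup>2)) powr \<delta>) \<partial>(\<Pi>\<^sub>M i\<in>insert i A. lborel))
      = ennreal ((K * K') * max 0 c powr (\<delta> + card (insert i A) / 2))" for c
  proof -
    have "(\<integral>\<^sup>+x. ennreal (max 0 (c - (\<Sum>j\<in>insert i A. (x j)\<^sup>2)) powr \<delta>) \<partial>(\<Pi>\<^sub>M i\<in>insert i A. lborel))
      = (\<integral>\<^sup>+y. (\<integral>\<^sup>+x. ennreal (max 0 (c - (\<Sum>j\<in>insert i A. ((x(i := y)) j)\<^sup>2)) powr \<delta>) \<partial>(\<Pi>\<^sub>M i\<in>A. lborel)) \<partial>lborel)"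
      using insert.hyps by (subst product_nn_integral_insert_rev) auto
    also have "\<dots> = (\<integral>\<^sup>+y. (\<integral>\<^sup>+x. ennreal (max 0 ((c - y\<^sup>2) - (\<Sum>j\<in>A. (x j)\<^sup>2)) powr \<delta>) \<partial>(\<Pi>\<^sub>M i\<in>A. lborel)) \<partial>lborel)"
    proof (intro nn_integral_cong)
      fix x :: "'a \<Rightarrow> real" and y :: real
      have "(\<Sum>j\<in>insert i A. ((x(i := y)) j)\<^sup>2) = y\<^sup>2 + (\<Sum>j\<in>A. ((x(i := y)) j)\<^sup>2)"
        using insert.hyps by simp
      also have "(\<Sum>j\<in>A. ((x(i := y)) j)\<^sup>2) = (\<Sum>j\<in>A. (x j)\<^sup>2)"
        using insert.hyps by (intro sum.cong) auto
      finally show "ennreal (max 0 (c - (\<Sum>j\<in>insert i A. ((x(i := y)) j)\<^sup>2)) powr \<delta>) =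
          ennreal (max 0 ((c - y\<^sup>2) - (\<Sum>j\<in>A. (x j)\<^sup>2)) powr \<delta>)"
        by (simp add: algebra_simps)
    qed
    also have "\<dots> = (\<integral>\<^sup>+y. ennreal K * ennreal (max 0 (c - y\<^sup>2) powr (\<delta> + card A / 2)) \<partial>lborel)"
      using K by (simp add: ennreal_mult)
    also have "\<dots> = ennreal K * ennreal (K' * max 0 c powr ((\<delta> + card A / 2) + 1/2))"
      by (subst nn_integral_cmult) (auto simp: K')
    also have "\<dots> = ennreal ((K * K') * max 0 c powr (\<delta> + card (insert i A) / 2))"
      using K(1) K'(1) insert.hyps by (simp add: ennreal_mult[symmetric] add_divide_distrib mult_ac add_ac)
    finally show ?thesis .
  qed
  then show ?case using K(1) K'(1) by (intro exI[of _ "K * K'"]) auto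
qed

section \<open>Decay and integrability of the Bochner-Riesz kernel\<close>

abbreviation ball_power :: "real \<Rightarrow> 'a::real_normed_vector \<Rightarrow> real" where
  "ball_power \<delta> \<xi> \<equiv> max 0 (1 - (norm \<xi>)\<^sup>2) powr \<delta>"

lemma borel_measurable_cis[measurable (raw)]:
  "f \<in> borel_measurable M \<Longrightarrow> (\<lambda>x. cis (f x)) \<in> borel_measurable M"
  using borel_measurable_continuous_onI[OF continuous_on_cis[OF continuous_on_id]] by (rule measurable_compose_rev)

text \<open>
  The marginal of the symbol in one coordinate direction, stated as an equality of measures so that
  it applies to every integrand depending on that coordinate only.
\<close>

lemma bochner_riesz_symbol_projection:
  fixes \<delta> :: real and e :: "'a::euclidean_space"
  assumes "\<delta> > 0" and e: "e \<in> Basis"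
  obtains K where "K \<ge> 0"
    "distr (density lborel (\<lambda>\<xi>. ennreal (ball_power \<delta> \<xi>))) borel (\<lambda>\<xi>. \<xi> \<bullet> e)
      = density lborel (\<lambda>s. ennreal (K * max 0 (1 - s\<^sup>2) powr (\<delta> + (real DIM('a) - 1) / 2)))"
proof -
  interpret product_sigma_finite "\<lambda>_::'a. lborel :: real measure" by standard
  define A where "A = Basis - {e}"
  have A: "finite A" "e \<notin> A" "insert e A = Basis" using e by (auto simp: A_def)
  have card: "real (card A) = real DIM('a) - 1"
    using e by (simp add: A_def of_nat_diff)
  obtain K where K: "K \<ge> 0" "\<And>c. (\<integral>\<^sup>+x. ennreal (max 0 (c - (\<Sum>i\<in>A. (x i)\<^sup>2)) powr \<delta>) \<partial>(\<Pi>\<^sub>M i\<in>A. lborel))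
            = ennreal (K * max 0 c powr (\<delta> + card A / 2))"
    using nn_integral_paraboloid[OF A(1) assms(1)] by auto
  define w where "w = (\<lambda>\<xi>::'a. ennreal (ball_power \<delta> \<xi>))"
  define v where "v = (\<lambda>s. ennreal (K * max 0 (1 - s\<^sup>2) powr (\<delta> + (real DIM('a) - 1) / 2)))"
  have [measurable]: "w \<in> borel_measurable borel" "v \<in> borel_measurable borel"
    unfolding w_def v_def by measurable
  have "distr (density lborel w) borel (\<lambda>\<xi>. \<xi> \<bullet> e) = density lborel v"
  proof (rule measure_eqI)
    fix S assume "S \<in> sets (distr (density lborel w) borel (\<lambda>\<xi>. \<xi> \<bullet> e))"
    then have [measurable]: "S \<in> sets borel" by simp
    have "emeasure (distr (density lborel w) borel (\<lambda>\<xi>. \<xi> \<bullet> e)) S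
        = (\<integral>\<^sup>+\<xi>. w \<xi> * indicator S (\<xi> \<bullet> e) \<partial>lborel)"
      by (simp add: emeasure_distr emeasure_density indicator_def vimage_def)
    also have "\<dots> = (\<integral>\<^sup>+x. w (\<Sum>b\<in>Basis. x b *\<^sub>R b) * indicator S ((\<Sum>b\<in>Basis. x b *\<^sub>R b) \<bullet> e)
           \<partial>(\<Pi>\<^sub>M b\<in>(Basis::'a set). lborel))"
      by (subst lborel_eq) (simp add: nn_integral_distr)
    also have "\<dots> = (\<integral>\<^sup>+x. ennreal (max 0 (1 - (\<Sum>i\<in>insert e A. (x i)\<^sup>2)) powr \<delta>) * indicator S (x e)
           \<partial>(\<Pi>\<^sub>M b\<in>insert e A. lborel))"
      unfolding A(3)
    proof (intro nn_integral_cong)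
      fix x :: "'a \<Rightarrow> real"
      have "(norm (\<Sum>b\<in>Basis. x b *\<^sub>R b))\<^sup>2 = (\<Sum>b\<in>(Basis::'a set). (x b)\<^sup>2)"
        by (subst power2_norm_eq_inner, subst euclidean_inner) (simp add: power2_eq_square)
      then show "w (\<Sum>b\<in>Basis. x b *\<^sub>R b) * indicator S ((\<Sum>b\<in>Basis. x b *\<^sub>R b) \<bullet> e) =
          ennreal (max 0 (1 - (\<Sum>i\<in>Basis. (x i)\<^sup>2)) powr \<delta>) * indicator S (x e)"
        using e by (simp add: w_def)
    qed
    also have "\<dots> = (\<integral>\<^sup>+s. (\<integral>\<^sup>+x. ennreal (max 0 (1 - (\<Sum>i\<in>insert e A. ((x(e := s)) i)\<^sup>2)) powr \<delta>) * indicator S s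
           \<partial>(\<Pi>\<^sub>M b\<in>A. lborel)) \<partial>lborel)"
      using A(1,2) by (subst product_nn_integral_insert_rev) auto
    also have "\<dots> = (\<integral>\<^sup>+s. (\<integral>\<^sup>+x. ennreal (max 0 ((1 - s\<^sup>2) - (\<Sum>i\<in>A. (x i)\<^sup>2)) powr \<delta>) * indicator S s
           \<partial>(\<Pi>\<^sub>M b\<in>A. lborel)) \<partial>lborel)"
    proof (intro nn_integral_cong)
      fix x :: "'a \<Rightarrow> real" and s :: real
      have "(\<Sum>i\<in>insert e A. ((x(e := s)) i)\<^sup>2) = s\<^sup>2 + (\<Sum>i\<in>A. ((x(e := s)) i)\<^sup>2)"
        using A(1,2) by simp
      also have "(\<Sum>i\<in>A. ((x(e := s)) i)\<^sup>2) = (\<Sum>i\<in>A. (x i)\<^sup>2)"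
        using A by (intro sum.cong) auto
      finally show "ennreal (max 0 (1 - (\<Sum>i\<in>insert e A. ((x(e := s)) i)\<^sup>2)) powr \<delta>) * indicator S s =
         ennreal (max 0 ((1 - s\<^sup>2) - (\<Sum>i\<in>A. (x i)\<^sup>2)) powr \<delta>) * indicator S s"
        by (simp add: algebra_simps)
    qed
    also have "\<dots> = (\<integral>\<^sup>+s. v s * indicator S s \<partial>lborel)"
      by (simp add: nn_integral_multc K v_def card)
    also have "\<dots> = emeasure (density lborel v) S"
      by (simp add: emeasure_density)
    finally show "emeasure (distr (density lborel w) borel (\<lambda>\<xi>. \<xi> \<bullet> e)) S = emeasure (density lborel v) S" .
  qed simp
  then show ?thesis using that[OF K(1)] unfolding w_def v_def by simp
qed

lemma bochner_riesz_kernel_lborel: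
  "bochner_riesz_kernel \<delta> x =
     (LINT \<xi>|lborel. complex_of_real (ball_power \<delta> \<xi>) * cis (2 * pi * (x \<bullet> \<xi>)))"
  unfolding bochner_riesz_kernel_def inverse_fourier_def
  by (rule integral_completion) measurable

text \<open>
  A rotation takes \<open>x\<close> to a multiple of a basis vector without changing the symbol, and then the
  phase depends on one coordinate only.
\<close>

lemma bochner_riesz_kernel_eq_fourier_jacobi:
  fixes \<delta> :: real
  assumes "\<delta> > 0"
  obtains K :: real where "K \<ge> 0"
    "\<And>x :: real ^ 'n. bochner_riesz_kernel \<delta> x =
       of_real K * fourier_jacobi (\<delta> + (real CARD('n) - 1) / 2) (2 * pi * norm x)"
proof -
  obtain k :: 'n where True by simp
  define e :: "real ^ 'n" where "e = axis k 1"
  have e: "e \<in> Basis" "norm e = 1" by (auto simp: e_def axis_in_Basis_iff)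
  define \<nu> where "\<nu> = \<delta> + (real CARD('n) - 1) / 2"
  obtain K where K: "K \<ge> 0" "distr (density lborel (\<lambda>\<xi>::real^'n. ennreal (ball_power \<delta> \<xi>))) borel (\<lambda>\<xi>. \<xi> \<bullet> e)
      = density lborel (\<lambda>s. ennreal (K * max 0 (1 - s\<^sup>2) powr \<nu>))"
    using bochner_riesz_symbol_projection[OF assms e(1)] by (auto simp: \<nu>_def)
  have "bochner_riesz_kernel \<delta> x =
       K * fourier_jacobi \<nu> (2 * pi * norm x)" for x :: "real ^ 'n"
  proof -
    obtain f where f: "orthogonal_transformation f" "f (norm x *\<^sub>R e) = x"
      using orthogonal_transformation_exists[of "norm x *\<^sub>R e" x] e by auto
    have [measurable]: "f \<in> borel_measurable borel"
      using orthogonal_transformation_linear[OF f(1)]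
      by (intro borel_measurable_continuous_onI linear_continuous_on) (simp add: linear_conv_bounded_linear)
    have dot: "x \<bullet> f \<xi> = norm x * (\<xi> \<bullet> e)" for \<xi>
    proof -
      have "x \<bullet> f \<xi> = f (norm x *\<^sub>R e) \<bullet> f \<xi>" by (simp only: f(2))
      then show ?thesis using f(1) by (simp add: orthogonal_transformation_def inner_commute)
    qed
    define u where "u = (\<lambda>\<xi>::real^'n. ball_power \<delta> \<xi>)"
    have [measurable]: "u \<in> borel_measurable borel" unfolding u_def by measurable
    have "bochner_riesz_kernel \<delta> x = (LINT \<xi>|distr lborel borel f. complex_of_real (u \<xi>) * cis (2 * pi * (x \<bullet> \<xi>)))"
      by (simp add: bochner_riesz_kernel_lborel distr_lborel_orthogonal[OF f(1)] u_def)
    also have "\<dots> = (LINT \<xi>|lborel. complex_of_real (u (f \<xi>)) * cis (2 * pi * (x \<bullet> f \<xi>)))"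
      by (rule integral_distr) measurable
    also have "\<dots> = (LINT \<xi>|lborel. u \<xi> *\<^sub>R cis (2 * pi * norm x * (\<xi> \<bullet> e)))"
      by (simp add: u_def orthogonal_transformation_norm[OF f(1)] dot scaleR_conv_of_real mult.assoc)
    also have "\<dots> = (LINT \<xi>|density lborel u. cis (2 * pi * norm x * (\<xi> \<bullet> e)))"
      by (rule integral_density[symmetric]) (auto simp: u_def)
    also have "\<dots> = (LINT s|distr (density lborel u) borel (\<lambda>\<xi>. \<xi> \<bullet> e). cis (2 * pi * norm x * s))"
      by (rule integral_distr[symmetric]) measurable
    also have "\<dots> = (LINT s|density lborel (\<lambda>s. ennreal (K * max 0 (1 - s\<^sup>2) powr \<nu>)). cis (2 * pi * norm x * s))"
      using K(2) by (simp add: u_def)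
    also have "\<dots> = (LINT s|lborel. (K * max 0 (1 - s\<^sup>2) powr \<nu>) *\<^sub>R cis (2 * pi * norm x * s))"
      using K(1) by (intro integral_density) auto
    also have "\<dots> = (LINT s|lborel. indicator {-1..1} s *\<^sub>R (of_real K * (complex_of_real ((1 - s\<^sup>2) powr \<nu>) * cis (2 * pi * norm x * s))))"
    proof (rule Bochner_Integration.integral_cong)
      fix s :: real
      show "(K * max 0 (1 - s\<^sup>2) powr \<nu>) *\<^sub>R cis (2 * pi * norm x * s) =
        indicator {-1..1} s *\<^sub>R (of_real K * (complex_of_real ((1 - s\<^sup>2) powr \<nu>) * cis (2 * pi * norm x * s)))"
      proof (cases "s \<in> {-1..1}")
        case True
        then have "s\<^sup>2 \<le> 1" by (simp add: abs_square_le_1 abs_le_iff)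
        then show ?thesis using True by (simp add: scaleR_conv_of_real max_def mult.assoc)
      next
        case False
        then have "1 < \<bar>s\<bar>" by auto
        then have "1 \<le> s\<^sup>2" using abs_le_square_iff[of 1 s] by simp
        then show ?thesis using False by simp
      qed
    qed simp
    also have "\<dots> = integral {-1..1} (\<lambda>s. of_real K * (complex_of_real ((1 - s\<^sup>2) powr \<nu>) * cis (2 * pi * norm x * s)))"
    proof -
      have "continuous_on {-1..1} (\<lambda>s. of_real K * (complex_of_real ((1 - s\<^sup>2) powr \<nu>) * cis (2 * pi * norm x * s)))"
      proof -
        have "\<nu> > 0" using assms by (simp add: \<nu>_def add_pos_nonneg)
        then have "continuous_on {-1..1} (\<lambda>s::real. (1 - s\<^sup>2) powr \<nu>)"
          by (intro continuous_on_powr' continuous_on_diff continuous_on_power continuous_on_const continuous_on_id)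
             (simp add: abs_square_le_1 abs_le_iff)
        then show ?thesis
          by (intro continuous_on_mult continuous_on_of_real continuous_on_cis continuous_on_const continuous_on_id)
      qed
      then have "set_integrable lborel {-1..1} (\<lambda>s. of_real K * (complex_of_real ((1 - s\<^sup>2) powr \<nu>) * cis (2 * pi * norm x * s)))"
        unfolding set_integrable_def by (intro borel_integrable_compact) auto
      then show ?thesis
        by (rule set_borel_integral_eq_integral(2)[unfolded set_lebesgue_integral_def])
    qed
    also have "\<dots> = K * fourier_jacobi \<nu> (2 * pi * norm x)"
      by simp
    finally show ?thesis .
  qed
  then show ?thesis using that[OF K(1)] unfolding \<nu>_def by simp
qed

lemma ennreal_le_suminf:
  fixes f :: "nat \<Rightarrow> ennreal"
  shows "f k \<le> (\<Sum>j. f j)"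
  using sum_le_suminf[of f "{k}"] by simp

text \<open>
  On the shell where \<open>1 + |x|\<close> is comparable to \<open>2 ^ k\<close> the integral is at most a multiple of
  \<open>2 powr (k (n - \<kappa>))\<close>, the term of a convergent geometric series.
\<close>

lemma nn_integral_decay_finite:
  fixes \<kappa> :: real
  assumes \<kappa>: "\<kappa> > real DIM('a::euclidean_space)"
  shows "(\<integral>\<^sup>+x. ennreal ((1 + norm x) powr (- \<kappa>)) \<partial>(lborel :: 'a measure)) < \<infinity>"
proof -
  define n where "n = real DIM('a)"
  define V where "V = unit_ball_vol n"
  have V: "V \<ge> 0" by (simp add: V_def n_def)
  define \<rho> where "\<rho> = 2 powr (n - \<kappa>)"
  have \<rho>: "0 < \<rho>" "\<rho> < 1" using \<kappa> powr_less_mono[of "n - \<kappa>" 0 2] by (auto simp: \<rho>_def n_def)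
  have m: "(\<lambda>x::'a. ennreal (2 powr (- \<kappa> * real k)) * indicator (ball 0 (2 ^ Suc k)) x) \<in> borel_measurable lborel" for k
    by (intro borel_measurable_times_ennreal borel_measurable_const borel_measurable_indicator) auto
  have "(\<integral>\<^sup>+x. ennreal ((1 + norm x) powr (- \<kappa>)) \<partial>(lborel :: 'a measure))
     \<le> (\<integral>\<^sup>+x. (\<Sum>k. ennreal (2 powr (- \<kappa> * real k)) * indicator (ball 0 (2 ^ Suc k)) x) \<partial>(lborel :: 'a measure))"
  proof (rule nn_integral_mono)
    fix x :: 'a
    define k where "k = nat \<lfloor>log 2 (1 + norm x)\<rfloor>"
    have l: "log 2 (1 + norm x) \<ge> 0" by (subst zero_le_log_cancel_iff) (auto simp: add_pos_nonneg)
    have "real k \<le> log 2 (1 + norm x)" "log 2 (1 + norm x) < real k + 1"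
      using l of_int_floor_le[of "log 2 (1 + norm x)"] real_of_int_floor_add_one_gt[of "log 2 (1 + norm x)"]
      by (simp_all add: k_def)
    then have k: "2 powr real k \<le> 1 + norm x" "1 + norm x < 2 powr (real k + 1)"
      by (simp_all add: le_log_iff log_less_iff add_pos_nonneg)
    have "(1 + norm x) powr (- \<kappa>) \<le> (2 powr real k) powr (- \<kappa>)"
      using k(1) \<kappa> by (intro powr_mono2') (auto simp: n_def)
    also have "\<dots> = 2 powr (- \<kappa> * real k)" by (simp add: powr_powr mult.commute)
    finally have 1: "(1 + norm x) powr (- \<kappa>) \<le> 2 powr (- \<kappa> * real k)" .
    have "norm x < 2 powr (real k + 1)" using k(2) by linarith
    also have "2 powr (real k + 1) = 2 ^ Suc k" using powr_realpow[of 2 "Suc k"] by (simp add: add.commute)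
    finally have "x \<in> ball 0 (2 ^ Suc k)" by simp
    then have "ennreal ((1 + norm x) powr (- \<kappa>)) \<le> ennreal (2 powr (- \<kappa> * real k)) * indicator (ball 0 (2 ^ Suc k)) x"
      using 1 by (simp add: ennreal_leI)
    also have "\<dots> \<le> (\<Sum>k. ennreal (2 powr (- \<kappa> * real k)) * indicator (ball 0 (2 ^ Suc k)) x)"
      by (rule ennreal_le_suminf)
    finally show "ennreal ((1 + norm x) powr (- \<kappa>)) \<le> (\<Sum>k. ennreal (2 powr (- \<kappa> * real k)) * indicator (ball 0 (2 ^ Suc k)) x)" .
  qed
  also have "\<dots> = (\<Sum>k. (\<integral>\<^sup>+x. ennreal (2 powr (- \<kappa> * real k)) * indicator (ball 0 (2 ^ Suc k)) x \<partial>(lborel :: 'a measure)))"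
    by (rule nn_integral_suminf[OF m])
  also have "\<dots> = (\<Sum>k. ennreal (V * 2 ^ DIM('a) * \<rho> ^ k))"
  proof (intro suminf_cong)
    fix k :: nat
    have "2 powr (n * real k) = 2 powr real (k * DIM('a))" by (simp add: n_def mult.commute)
    also have "\<dots> = 2 ^ (k * DIM('a))" by (rule powr_realpow) simp
    also have "\<dots> = (2 ^ k) ^ DIM('a)" by (rule power_mult)
    finally have "(2 ^ Suc k) ^ DIM('a) = 2 ^ DIM('a) * 2 powr (n * real k)"
      by (simp only: power_Suc power_mult_distrib)
    moreover have "2 powr (- \<kappa> * real k) * 2 powr (n * real k) = \<rho> ^ k"
    proof -
      have "2 powr (- \<kappa> * real k) * 2 powr (n * real k) = 2 powr ((n - \<kappa>) * real k)"
        by (subst powr_add[symmetric]) (simp add: algebra_simps)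
      then show ?thesis using powr_realpow[OF \<rho>(1), of k] by (simp only: \<rho>_def powr_powr)
    qed
    ultimately have eq: "2 powr (- \<kappa> * real k) * (V * (2 ^ Suc k) ^ DIM('a)) = V * 2 ^ DIM('a) * \<rho> ^ k"
      by (simp only: mult_ac)
    have "(\<integral>\<^sup>+x. ennreal (2 powr (- \<kappa> * real k)) * indicator (ball 0 (2 ^ Suc k)) x \<partial>(lborel :: 'a measure))
       = ennreal (2 powr (- \<kappa> * real k)) * emeasure lborel (ball (0::'a) (2 ^ Suc k))"
      by (rule nn_integral_cmult_indicator) auto
    also have "\<dots> = ennreal (2 powr (- \<kappa> * real k) * (V * (2 ^ Suc k) ^ DIM('a)))"
      using emeasure_ball[of "2 ^ Suc k" "0::'a"] V by (simp add: V_def n_def ennreal_mult)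
    finally show "(\<integral>\<^sup>+x. ennreal (2 powr (- \<kappa> * real k)) * indicator (ball 0 (2 ^ Suc k)) x \<partial>(lborel :: 'a measure))
       = ennreal (V * 2 ^ DIM('a) * \<rho> ^ k)" by (simp only: eq)
  qed
  also have "\<dots> < \<infinity>"
  proof -
    have "summable (\<lambda>k. V * 2 ^ DIM('a) * \<rho> ^ k)" using \<rho> by (intro summable_mult summable_geometric) auto
    then have "(\<Sum>k. ennreal (V * 2 ^ DIM('a) * \<rho> ^ k)) = ennreal (\<Sum>k. V * 2 ^ DIM('a) * \<rho> ^ k)"
      using V \<rho> by (intro suminf_ennreal2) auto
    then show ?thesis by simp
  qed
  finally show ?thesis .
qed

lemma bochner_riesz_kernel_bounded:
  fixes \<delta> :: real
  assumes "\<delta> > 0"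
  obtains B where "B \<ge> 0" "\<And>x :: real ^ 'n. norm (bochner_riesz_kernel \<delta> x) \<le> B"
proof -
  define u where "u = (\<lambda>\<xi>::real^'n. ennreal (ball_power \<delta> \<xi>))"
  define J where "J = (\<integral>\<^sup>+\<xi>. u \<xi> \<partial>lborel)"
  have "J \<le> (\<integral>\<^sup>+\<xi>. indicator (ball 0 1) (\<xi>::real^'n) \<partial>lborel)"
    unfolding J_def
  proof (rule nn_integral_mono)
    fix \<xi> :: "real^'n"
    show "u \<xi> \<le> indicator (ball 0 1) \<xi>"
    proof (cases "norm \<xi> < 1")
      case True
      have "ball_power \<delta> \<xi> \<le> 1 powr \<delta>" using assms by (intro powr_mono2) auto
      then show ?thesis using True by (simp add: u_def)
    next
      case False
      then have "1 \<le> (norm \<xi>)\<^sup>2" by (simp add: one_le_power)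
      then show ?thesis using assms by (simp add: u_def)
    qed
  qed
  also have "\<dots> = emeasure lborel (ball (0::real^'n) 1)"
    by (rule nn_integral_indicator) auto
  also have "\<dots> < \<infinity>" by (rule emeasure_lborel_ball_finite)
  finally have J: "J < \<infinity>" .
  show ?thesis
  proof
    show "0 \<le> enn2real J" by simp
    fix x :: "real^'n"
    define g where "g = (\<lambda>\<xi>::real^'n. complex_of_real (ball_power \<delta> \<xi>) * cis (2 * pi * (x \<bullet> \<xi>)))"
    have [measurable]: "g \<in> borel_measurable borel" unfolding g_def by measurable
    have n: "(\<integral>\<^sup>+\<xi>. norm (g \<xi>) \<partial>lborel) = J"
      by (simp add: g_def J_def u_def norm_mult)
    then have "integrable lborel g" using J by (intro integrableI_bounded) auto
    then have "ennreal (norm (LINT \<xi>|lborel. g \<xi>)) \<le> (\<integral>\<^sup>+\<xi>. norm (g \<xi>) \<partial>lborel)"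
      by (rule integral_norm_bound_ennreal)
    then have "ennreal (norm (bochner_riesz_kernel \<delta> x)) \<le> J"
      unfolding n bochner_riesz_kernel_lborel by (simp add: g_def)
    then show "norm (bochner_riesz_kernel \<delta> x) \<le> enn2real J"
      using J enn2real_mono[of "ennreal (norm (bochner_riesz_kernel \<delta> x))" J] by simp
  qed
qed

text \<open>
  The oscillatory estimate degenerates at the origin, where the trivial bound by the integral of
  the symbol takes over.
\<close>

lemma bochner_riesz_kernel_decay:
  fixes \<delta> :: real
  assumes \<delta>: "\<delta> > 0"
  defines "\<kappa> \<equiv> \<delta> + (real CARD('n) - 1) / 2 + 1"
  obtains B where "B \<ge> 0" "\<And>x :: real ^ 'n. norm (bochner_riesz_kernel \<delta> x) \<le> B * (1 + norm x) powr (- \<kappa>)"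
proof -
  define \<nu> where "\<nu> = \<delta> + (real CARD('n) - 1) / 2"
  have \<nu>: "\<nu> > 0" "\<kappa> = \<nu> + 1" using \<delta> by (auto simp: \<nu>_def \<kappa>_def add_pos_nonneg)
  obtain K :: real where K: "K \<ge> 0" "\<And>x :: real ^ 'n. bochner_riesz_kernel \<delta> x =
       of_real K * fourier_jacobi \<nu> (2 * pi * norm x)"
    by (rule bochner_riesz_kernel_eq_fourier_jacobi[OF \<delta>, where 'n = 'n]) (simp add: \<nu>_def)
  obtain C where C: "C \<ge> 0"
    "\<And>t. t > 0 \<Longrightarrow> norm (fourier_jacobi \<nu> t)
        \<le> C * t powr (- \<nu> - 1)"
    by (rule fourier_jacobi_decay[OF \<nu>(1)]) blast
  obtain B where B: "B \<ge> 0" "\<And>x :: real ^ 'n. norm (bochner_riesz_kernel \<delta> x) \<le> B"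
    by (rule bochner_riesz_kernel_bounded[OF \<delta>, where 'n = 'n]) blast
  show ?thesis
  proof
    show "0 \<le> 2 powr \<kappa> * (B + K * C)" using B K C by simp
    fix x :: "real ^ 'n"
    show "norm (bochner_riesz_kernel \<delta> x) \<le> 2 powr \<kappa> * (B + K * C) * (1 + norm x) powr (- \<kappa>)"
    proof (cases "norm x \<le> 1")
      case True
      have "2 powr (- \<kappa>) \<le> (1 + norm x) powr (- \<kappa>)"
        using True \<nu> by (intro powr_mono2') (auto simp: add_pos_nonneg)
      then have "2 powr \<kappa> * (B + K * C) * 2 powr (- \<kappa>) \<le> 2 powr \<kappa> * (B + K * C) * (1 + norm x) powr (- \<kappa>)"
        using B K C by (intro mult_left_mono) auto
      moreover have "2 powr \<kappa> * (B + K * C) * 2 powr (- \<kappa>) = B + K * C"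
        by (simp add: powr_minus)
      moreover have "B \<le> B + K * C" using K C by simp
      ultimately show ?thesis using B(2)[of x] by linarith
    next
      case False
      then have x0: "norm x > 0" by linarith
      have "norm (bochner_riesz_kernel \<delta> x) \<le> K * (C * (2 * pi * norm x) powr (- \<kappa>))"
        using C(2)[of "2 * pi * norm x"] K(1) x0 \<nu>
        by (simp add: K(2) norm_mult mult_left_mono)
      also have "(2 * pi * norm x) powr (- \<kappa>) \<le> ((1 + norm x) / 2) powr (- \<kappa>)"
      proof (rule powr_mono2')
        have "(1 + norm x) / 2 \<le> 1 * norm x" using False by simp
        also have "\<dots> \<le> 2 * pi * norm x" using pi_gt3 by (intro mult_right_mono) auto
        finally show "(1 + norm x) / 2 \<le> 2 * pi * norm x" .
      qed (use \<nu> in \<open>auto simp: add_pos_nonneg\<close>)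
      also have "((1 + norm x) / 2) powr (- \<kappa>) = 2 powr \<kappa> * (1 + norm x) powr (- \<kappa>)"
        by (simp add: powr_divide powr_minus field_simps)
      finally have "norm (bochner_riesz_kernel \<delta> x) \<le> K * (C * (2 powr \<kappa> * (1 + norm x) powr (- \<kappa>)))"
        using K C by (simp add: mult_left_mono)
      also have "\<dots> \<le> 2 powr \<kappa> * (B + K * C) * (1 + norm x) powr (- \<kappa>)"
        using B(1) by (simp add: algebra_simps)
      finally show ?thesis .
    qed
  qed
qed

lemma borel_measurable_bochner_riesz_kernel[measurable]:
  "(bochner_riesz_kernel \<delta> :: real ^ 'n \<Rightarrow> complex) \<in> borel_measurable borel"
proof -
  have "(\<lambda>x :: real ^ 'n. LINT \<xi>|lborel. complex_of_real (ball_power \<delta> \<xi>) * cis (2 * pi * (x \<bullet> \<xi>)))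
     \<in> borel_measurable borel"
    by (rule lborel.borel_measurable_lebesgue_integral) measurable
  then show ?thesis by (simp add: bochner_riesz_kernel_lborel[abs_def])
qed

lemma borel_measurable_bochner_riesz_kernel_scaled[measurable]:
  "(bochner_riesz_kernel_scaled \<delta> r :: real ^ 'n \<Rightarrow> complex) \<in> borel_measurable borel"
  unfolding bochner_riesz_kernel_scaled_def[abs_def] by measurable

lemma bochner_riesz_kernel_scaled_integrable:
  fixes \<delta> r :: real
  assumes \<delta>: "\<delta> > (real CARD('n) - 1) / 2" and r: "r > 0"
  shows "(\<integral>\<^sup>+x. ennreal (norm (bochner_riesz_kernel_scaled \<delta> r x)) \<partial>(lborel :: (real ^ 'n) measure)) < \<infinity>"
proof -
  define \<kappa> where "\<kappa> = \<delta> + (real CARD('n) - 1) / 2 + 1"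
  have card: "real CARD('n) \<ge> 1" by (simp add: Suc_leI)
  have "0 \<le> (real CARD('n) - 1) / 2" using card by simp
  then have \<delta>0: "\<delta> > 0" using \<delta> by (rule order_le_less_trans)
  have \<kappa>: "\<kappa> > real DIM(real ^ 'n)" "\<kappa> > 0" using \<delta> card by (auto simp: \<kappa>_def field_simps)
  obtain B where B: "B \<ge> 0" "\<And>x :: real ^ 'n. norm (bochner_riesz_kernel \<delta> x) \<le> B * (1 + norm x) powr (- \<kappa>)"
    by (rule bochner_riesz_kernel_decay[OF \<delta>0, where 'n = 'n]) (simp add: \<kappa>_def)
  define m where "m = min 1 (1 / r)"
  have m: "0 < m" "m \<le> 1" "m \<le> 1 / r" using r by (auto simp: m_def)
  have "norm (bochner_riesz_kernel_scaled \<delta> r x) \<le> (B * m powr (- \<kappa>) / r ^ CARD('n)) * (1 + norm x) powr (- \<kappa>)" for x :: "real ^ 'n"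
  proof -
    have "(1 + norm (x /\<^sub>R r)) powr (- \<kappa>) \<le> (m * (1 + norm x)) powr (- \<kappa>)"
    proof (rule powr_mono2')
      have "m * norm x \<le> 1 / r * norm x" using m by (intro mult_right_mono) auto
      moreover have "norm (x /\<^sub>R r) = 1 / r * norm x" using r by (simp add: divide_inverse)
      moreover have "m * (1 + norm x) = m + m * norm x" by (simp add: algebra_simps)
      ultimately show "m * (1 + norm x) \<le> 1 + norm (x /\<^sub>R r)" using m(2) by linarith
    qed (use m \<kappa> in \<open>auto simp: add_pos_nonneg\<close>)
    also have "\<dots> = m powr (- \<kappa>) * (1 + norm x) powr (- \<kappa>)" using m by (simp add: powr_mult)
    finally have "B * (1 + norm (x /\<^sub>R r)) powr (- \<kappa>) \<le> B * (m powr (- \<kappa>) * (1 + norm x) powr (- \<kappa>))"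
      using B(1) by (rule mult_left_mono)
    then have "norm (bochner_riesz_kernel \<delta> (x /\<^sub>R r)) \<le> B * (m powr (- \<kappa>) * (1 + norm x) powr (- \<kappa>))"
      using B(2) order_trans by blast
    then have "norm (bochner_riesz_kernel \<delta> (x /\<^sub>R r)) / r ^ CARD('n) \<le> B * (m powr (- \<kappa>) * (1 + norm x) powr (- \<kappa>)) / r ^ CARD('n)"
      using r by (intro divide_right_mono) auto
    then show ?thesis using r by (simp add: bochner_riesz_kernel_scaled_def divide_inverse mult_ac)
  qed
  then have "(\<integral>\<^sup>+x. ennreal (norm (bochner_riesz_kernel_scaled \<delta> r x)) \<partial>(lborel :: (real ^ 'n) measure))
     \<le> (\<integral>\<^sup>+x. ennreal (B * m powr (- \<kappa>) / r ^ CARD('n)) * ennreal ((1 + norm x) powr (- \<kappa>)) \<partial>(lborel :: (real ^ 'n) measure))"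
    using B(1) r by (intro nn_integral_mono) (simp add: ennreal_mult[symmetric] ennreal_leI)
  also have "\<dots> = ennreal (B * m powr (- \<kappa>) / r ^ CARD('n)) * (\<integral>\<^sup>+x. ennreal ((1 + norm x) powr (- \<kappa>)) \<partial>(lborel :: (real ^ 'n) measure))"
    by (rule nn_integral_cmult) measurable
  also have "\<dots> < \<infinity>"
    using nn_integral_decay_finite[OF \<kappa>(1)] by (simp add: ennreal_mult_less_top)
  finally show ?thesis .
qed

section \<open>Rearrangements and convolution\<close>

lemma superlevel_sets_lebesgue:
  fixes f :: "real ^ 'n \<Rightarrow> complex"
  assumes f: "f \<in> borel_measurable lebesgue"
  shows "{y. norm (f y) > c} \<in> sets lebesgue"
proof -
  have "{y \<in> space lebesgue. norm (f y) > c} \<in> sets lebesgue" using f by measurable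
  then show ?thesis by simp
qed

text \<open>
  The infimum that defines the rearrangement is attained, because the distribution function is
  continuous from the right.
\<close>

lemma rearrangement_le_iff:
  fixes f :: "real ^ 'n \<Rightarrow> complex"
  assumes f: "f \<in> borel_measurable lebesgue" and \<mu>: "\<mu> \<ge> 0"
  shows "rearrangement f t \<le> ennreal \<mu> \<longleftrightarrow> emeasure lebesgue {y. norm (f y) > \<mu>} \<le> ennreal t"
proof
  note sets = superlevel_sets_lebesgue[OF f]
  assume le: "rearrangement f t \<le> ennreal \<mu>"
  define E where "E = (\<lambda>k::nat. {y. norm (f y) > \<mu> + 1 / Suc k})"
  have "(SUP k. emeasure lebesgue (E k)) = emeasure lebesgue (\<Union>k. E k)"
  proof (rule SUP_emeasure_incseq)
    show "range E \<subseteq> sets lebesgue" using sets by (auto simp: E_def)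
    show "incseq E"
    proof (rule incseq_SucI)
      fix k
      have "1 / real (Suc (Suc k)) \<le> 1 / real (Suc k)" by (simp add: frac_le)
      then show "E k \<le> E (Suc k)" unfolding E_def by (smt (verit) Collect_mono_iff)
    qed
  qed
  moreover have "(\<Union>k. E k) = {y. norm (f y) > \<mu>}"
  proof
    show "(\<Union>k. E k) \<subseteq> {y. norm (f y) > \<mu>}"
    proof
      fix y assume "y \<in> (\<Union>k. E k)"
      then obtain k where "norm (f y) > \<mu> + 1 / Suc k" by (auto simp: E_def)
      moreover have "0 < 1 / real (Suc k)" by simp
      ultimately have "norm (f y) > \<mu>" by linarith
      then show "y \<in> {y. norm (f y) > \<mu>}" by simp
    qed
    show "{y. norm (f y) > \<mu>} \<subseteq> (\<Union>k. E k)"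
    proof
      fix y assume "y \<in> {y. norm (f y) > \<mu>}"
      then have "0 < norm (f y) - \<mu>" by simp
      then obtain k where "inverse (real (Suc k)) < norm (f y) - \<mu>"
        using reals_Archimedean by blast
      then have "y \<in> E k" unfolding E_def inverse_eq_divide by (simp del: of_nat_Suc)
      then show "y \<in> (\<Union>k. E k)" by blast
    qed
  qed
  moreover have "emeasure lebesgue (E k) \<le> ennreal t" for k
  proof -
    have "ennreal \<mu> < ennreal (\<mu> + 1 / Suc k)" using \<mu> by (simp add: ennreal_less_iff)
    with le have "rearrangement f t < ennreal (\<mu> + 1 / Suc k)" by (rule order_le_less_trans)
    then obtain \<mu>' where \<mu>': "\<mu>' > 0" "emeasure lebesgue {y. norm (f y) > \<mu>'} \<le> ennreal t"
        "ennreal \<mu>' < ennreal (\<mu> + 1 / Suc k)"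
      unfolding rearrangement_def Inf_less_iff by auto
    then have "\<mu>' < \<mu> + 1 / Suc k" by (simp add: ennreal_less_iff)
    then have "E k \<subseteq> {y. norm (f y) > \<mu>'}" by (auto simp: E_def)
    then have "emeasure lebesgue (E k) \<le> emeasure lebesgue {y. norm (f y) > \<mu>'}"
      using sets by (intro emeasure_mono) auto
    then show ?thesis using \<mu>'(2) by (rule order_trans)
  qed
  ultimately show "emeasure lebesgue {y. norm (f y) > \<mu>} \<le> ennreal t"
    by (metis SUP_least)
next
  note sets = superlevel_sets_lebesgue[OF f]
  assume le: "emeasure lebesgue {y. norm (f y) > \<mu>} \<le> ennreal t"
  show "rearrangement f t \<le> ennreal \<mu>"
  proof (rule ennreal_le_epsilon)
    fix e :: real assume e: "0 < e"
    have "emeasure lebesgue {y. norm (f y) > \<mu> + e} \<le> emeasure lebesgue {y. norm (f y) > \<mu>}"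
      using e sets by (intro emeasure_mono) auto
    then have "emeasure lebesgue {y. norm (f y) > \<mu> + e} \<le> ennreal t" using le by (rule order_trans)
    then have "rearrangement f t \<le> ennreal (\<mu> + e)"
      using \<mu> e unfolding rearrangement_def
      by (intro Inf_lower CollectI exI[of _ "\<mu> + e"]) auto
    then show "rearrangement f t \<le> ennreal \<mu> + ennreal e" using \<mu> e by simp
  qed
qed

lemma rearrangement_antimono: "s \<le> t \<Longrightarrow> rearrangement f t \<le> rearrangement f s"
  unfolding rearrangement_def
  by (rule Inf_superset_mono) (blast intro: order_trans ennreal_leI)

lemma borel_measurable_antimono_ennreal:
  fixes g :: "real \<Rightarrow> ennreal"
  assumes "\<And>s t. s \<le> t \<Longrightarrow> g t \<le> g s"
  shows "g \<in> borel_measurable borel"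
proof (rule borel_measurableI_less)
  fix y
  have "is_interval {u. g u < y}"
    unfolding is_interval_1 using assms by (auto intro: order_le_less_trans)
  then have "{u. g u < y} \<in> sets borel" by (rule real_interval_borel_measurable)
  then show "{u \<in> space borel. g u < y} \<in> sets borel" by simp
qed

lemma borel_measurable_rearrangement[measurable]: "rearrangement f \<in> borel_measurable borel"
  by (intro borel_measurable_antimono_ennreal rearrangement_antimono)

lemma rearrangement_cong_AE:
  fixes f g :: "real ^ 'n \<Rightarrow> complex"
  assumes "f \<in> borel_measurable lebesgue" "g \<in> borel_measurable lebesgue" "AE y in lebesgue. f y = g y"
  shows "rearrangement f = rearrangement g"
proof -
  have "emeasure lebesgue {y. norm (f y) > c} = emeasure lebesgue {y. norm (g y) > c}" for c
    using assms by (intro emeasure_eq_AE superlevel_sets_lebesgue) auto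
  then show ?thesis by (simp add: rearrangement_def[abs_def])
qed

lemma nn_integral_layer_cake:
  fixes g :: "'a::euclidean_space \<Rightarrow> real"
  assumes [measurable]: "g \<in> borel_measurable borel"
  shows "(\<integral>\<^sup>+x. ennreal (g x) \<partial>lborel) = (\<integral>\<^sup>+s. indicator {0<..} s * emeasure lborel {x. g x > s} \<partial>lborel)"
proof -
  have [measurable]: "{x. g x > s} \<in> sets borel" for s by measurable
  have "(\<integral>\<^sup>+x. ennreal (g x) \<partial>lborel) = (\<integral>\<^sup>+x. (\<integral>\<^sup>+s. (if 0 < s \<and> s < g x then 1 else 0) \<partial>lborel) \<partial>lborel)"
  proof (rule nn_integral_cong)
    fix x :: 'a
    have "(\<integral>\<^sup>+s. (if 0 < s \<and> s < g x then 1 else 0) \<partial>lborel) = (\<integral>\<^sup>+s. indicator {0<..<g x} s \<partial>lborel)"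
      by (intro nn_integral_cong) (auto simp: indicator_def)
    also have "\<dots> = emeasure lborel {0<..<g x}" by simp
    also have "\<dots> = ennreal (g x)"
      by (cases "0 \<le> g x") (auto simp: ennreal_neg)
    finally show "ennreal (g x) = (\<integral>\<^sup>+s. (if 0 < s \<and> s < g x then 1 else 0) \<partial>lborel)" by simp
  qed
  also have "\<dots> = (\<integral>\<^sup>+s. (\<integral>\<^sup>+x. (if 0 < s \<and> s < g x then 1 else 0) \<partial>lborel) \<partial>lborel)"
    by (rule lborel_pair.Fubini') measurable
  also have "\<dots> = (\<integral>\<^sup>+s. indicator {0<..} s * emeasure lborel {x. g x > s} \<partial>lborel)"
  proof (rule nn_integral_cong)
    fix s :: real
    have "(\<integral>\<^sup>+x. (if 0 < s \<and> s < g x then 1 else 0) \<partial>lborel)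
        = (\<integral>\<^sup>+x. indicator {0<..} s * indicator {x. g x > s} x \<partial>lborel)"
      by (intro nn_integral_cong) (auto simp: indicator_def)
    also have "\<dots> = indicator {0<..} s * emeasure lborel {x. g x > s}"
      by (rule nn_integral_cmult_indicator) measurable
    finally show "(\<integral>\<^sup>+x. (if 0 < s \<and> s < g x then 1 else 0) \<partial>lborel)
        = indicator {0<..} s * emeasure lborel {x. g x > s}" .
  qed
  finally show ?thesis .
qed

abbreviation rearrangement_integral :: "(real ^ 'n \<Rightarrow> complex) \<Rightarrow> real \<Rightarrow> ennreal" where
  "rearrangement_integral f t \<equiv> \<integral>\<^sup>+u. rearrangement f u * indicator {0<..<t} u \<partial>lborel"

text \<open>
  Both integrals are computed from their level sets. For \<open>s > 0\<close> the set \<open>{|f| > \<tau> + s}\<close> has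
  measure \<open>c \<le> t\<close> since \<open>f\<^sup>*(t) \<le> \<tau>\<close>, and \<open>f\<^sup>* \<ge> s\<close> on \<open>(0, c)\<close>, which lies in \<open>(0, t)\<close>.
\<close>

lemma nn_integral_excess_le_rearrangement:
  fixes f :: "real ^ 'n \<Rightarrow> complex"
  assumes f[measurable]: "f \<in> borel_measurable borel"
    and \<tau>: "\<tau> \<ge> 0" "rearrangement f t \<le> ennreal \<tau>" and t: "t > 0"
  shows "(\<integral>\<^sup>+y. ennreal (norm (f y) - \<tau>) \<partial>lborel) \<le> rearrangement_integral f t"
proof -
  have fl: "f \<in> borel_measurable lebesgue" using f by (simp add: measurable_completion)
  have [measurable]: "{y. norm (f y) > c} \<in> sets borel" for c by measurable
  have leb: "emeasure lebesgue {y. norm (f y) > c} = emeasure lborel {y. norm (f y) > c}" for c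
  proof -
    have "{y. norm (f y) > c} \<in> sets lborel" by measurable
    then show ?thesis by simp
  qed
  have "(\<integral>\<^sup>+y. ennreal (norm (f y) - \<tau>) \<partial>lborel)
      = (\<integral>\<^sup>+s. indicator {0<..} s * emeasure lborel {y. norm (f y) - \<tau> > s} \<partial>lborel)"
    by (rule nn_integral_layer_cake) measurable
  also have "\<dots> \<le> (\<integral>\<^sup>+s. (\<integral>\<^sup>+u. (if 0 < s \<and> 0 < u \<and> u < t \<and> ennreal s \<le> rearrangement f u then 1 else 0) \<partial>lborel) \<partial>lborel)"
    (is "integral\<^sup>N _ ?f \<le> integral\<^sup>N _ ?g")
  proof (rule nn_integral_mono)
    fix s :: real
    show "?f s \<le> ?g s"
    proof (cases "s > 0")
      case s: True
      have set_eq: "{y. norm (f y) - \<tau> > s} = {y. norm (f y) > \<tau> + s}" by auto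
      have "rearrangement f t \<le> ennreal (\<tau> + s)" using \<tau> s by (auto intro: order_trans ennreal_leI)
      then have "emeasure lborel {y. norm (f y) > \<tau> + s} \<le> ennreal t"
        using rearrangement_le_iff[OF fl, of "\<tau> + s" t] \<tau> s by (simp add: leb)
      then obtain c where c: "c \<ge> 0" "c \<le> t" "emeasure lborel {y. norm (f y) > \<tau> + s} = ennreal c"
        using t by (cases "emeasure lborel {y. norm (f y) > \<tau> + s}") (auto simp: top_unique)
      have "ennreal c = (\<integral>\<^sup>+u. indicator {0<..<c} u \<partial>lborel)" using c by simp
      also have "\<dots> \<le> (\<integral>\<^sup>+u. (if 0 < s \<and> 0 < u \<and> u < t \<and> ennreal s \<le> rearrangement f u then 1 else 0) \<partial>lborel)"
      proof (rule nn_integral_mono)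
        fix u :: real
        have "ennreal s \<le> rearrangement f u" if u: "0 < u" "u < c"
        proof (rule ccontr)
          assume "\<not> ennreal s \<le> rearrangement f u"
          then have "rearrangement f u \<le> ennreal s" by simp
          also have "\<dots> \<le> ennreal (\<tau> + s)" using \<tau> by (intro ennreal_leI) simp
          finally have "emeasure lborel {y. norm (f y) > \<tau> + s} \<le> ennreal u"
            using rearrangement_le_iff[OF fl, of "\<tau> + s" u] \<tau> s by (simp add: leb)
          then show False using c u by (simp add: ennreal_le_iff)
        qed
        then show "indicator {0<..<c} u \<le> (if 0 < s \<and> 0 < u \<and> u < t \<and> ennreal s \<le> rearrangement f u then 1 else (0::ennreal))"
          using c s by (auto simp: indicator_def)
      qed
      finally show ?thesis using s c(3) by (simp add: set_eq)
    qed simp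
  qed
  also have "\<dots> = (\<integral>\<^sup>+u. (\<integral>\<^sup>+s. (if 0 < s \<and> 0 < u \<and> u < t \<and> ennreal s \<le> rearrangement f u then 1 else 0) \<partial>lborel) \<partial>lborel)"
    by (rule lborel_pair.Fubini') measurable
  also have "\<dots> \<le> rearrangement_integral f t"
    (is "integral\<^sup>N _ ?f \<le> integral\<^sup>N _ ?g")
  proof (rule nn_integral_mono)
    fix u :: real
    show "?f u \<le> ?g u"
    proof (cases "0 < u \<and> u < t")
      case u: True
      show ?thesis
      proof (cases "rearrangement f u")
        case (real a)
        have "(\<integral>\<^sup>+s. (if 0 < s \<and> 0 < u \<and> u < t \<and> ennreal s \<le> rearrangement f u then 1 else 0) \<partial>lborel)
            = (\<integral>\<^sup>+s. indicator {0<..a} s \<partial>lborel)"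
          using u real by (intro nn_integral_cong) (auto simp: indicator_def ennreal_le_iff)
        also have "\<dots> = emeasure lborel {0<..a}" by (rule nn_integral_indicator) simp
        also have "\<dots> = ennreal a" using real by simp
        finally show ?thesis using u real by simp
      qed (use u in auto)
    qed auto
  qed
  finally show ?thesis .
qed

abbreviation convolve :: "'a::ab_group_add measure \<Rightarrow> ('a \<Rightarrow> complex) \<Rightarrow> ('a \<Rightarrow> complex) \<Rightarrow> 'a \<Rightarrow> complex" where
  "convolve M k f \<equiv> \<lambda>x. LINT y|M. k (x - y) * f y"

abbreviation convolution_exists :: "(real ^ 'n \<Rightarrow> complex) \<Rightarrow> (real ^ 'n \<Rightarrow> complex) \<Rightarrow> bool" where
  "convolution_exists k f \<equiv> AE x in lebesgue. integrable lebesgue (\<lambda>y. k (x - y) * f y)"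

text \<open>
  Fubini's theorem is applied to Borel functions: for a merely Lebesgue measurable \<open>f\<close> the integrand
  \<open>k(x - y) f(y)\<close> is not measurable for the product of the Borel measures in general.
\<close>

lemma borel_representative:
  fixes f :: "real ^ 'n \<Rightarrow> complex"
  assumes f: "f \<in> borel_measurable lebesgue"
  obtains g where "g \<in> borel_measurable borel" "AE y in lebesgue. f y = g y"
proof -
  have re: "(\<lambda>y. Re (f y)) \<in> borel_measurable lebesgue" using f by measurable
  have im: "(\<lambda>y. Im (f y)) \<in> borel_measurable lebesgue" using f by measurable
  obtain a where a: "a \<in> borel_measurable lborel" "AE y in lborel. Re (f y) = a y"
    using completion_ex_borel_measurable_real[OF re] by blast
  obtain b where b: "b \<in> borel_measurable lborel" "AE y in lborel. Im (f y) = b y"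
    using completion_ex_borel_measurable_real[OF im] by blast
  have "AE y in lborel. f y = Complex (a y) (b y)"
    using a(2) b(2) by eventually_elim (simp add: complex_eq_iff)
  then have "AE y in lebesgue. f y = Complex (a y) (b y)" by (rule AE_completion)
  moreover have "(\<lambda>y. Complex (a y) (b y)) \<in> borel_measurable borel"
    using a(1) b(1) by (simp add: borel_measurable_complex_iff)
  ultimately show ?thesis using that[of "\<lambda>y. Complex (a y) (b y)"] by simp
qed

lemma nn_integral_convolution:
  fixes k h :: "'a::euclidean_space \<Rightarrow> ennreal"
  assumes [measurable]: "k \<in> borel_measurable borel" "h \<in> borel_measurable borel"
  shows "(\<integral>\<^sup>+x. (\<integral>\<^sup>+y. k (x - y) * h y \<partial>lborel) \<partial>lborel) = (\<integral>\<^sup>+x. k x \<partial>lborel) * (\<integral>\<^sup>+y. h y \<partial>lborel)"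
proof -
  have "(\<integral>\<^sup>+x. (\<integral>\<^sup>+y. k (x - y) * h y \<partial>lborel) \<partial>lborel) = (\<integral>\<^sup>+y. (\<integral>\<^sup>+x. k (x - y) * h y \<partial>lborel) \<partial>lborel)"
    by (rule lborel_pair.Fubini') measurable
  also have "\<dots> = (\<integral>\<^sup>+y. (\<integral>\<^sup>+x. k x \<partial>lborel) * h y \<partial>lborel)"
  proof (rule nn_integral_cong)
    fix y :: 'a
    have "(\<integral>\<^sup>+x. k (x - y) * h y \<partial>lborel) = (\<integral>\<^sup>+x. k (x - y) \<partial>lborel) * h y"
      by (rule nn_integral_multc) measurable
    also have "(\<integral>\<^sup>+x. k (x - y) \<partial>lborel) = (\<integral>\<^sup>+x. k x \<partial>lborel)"
      using nn_integral_lborel_translate[of k "- y"] by simp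
    finally show "(\<integral>\<^sup>+x. k (x - y) * h y \<partial>lborel) = (\<integral>\<^sup>+x. k x \<partial>lborel) * h y" .
  qed
  also have "\<dots> = (\<integral>\<^sup>+x. k x \<partial>lborel) * (\<integral>\<^sup>+y. h y \<partial>lborel)"
    by (rule nn_integral_cmult) measurable
  finally show ?thesis .
qed

lemma nn_integral_lborel_reflect:
  fixes k :: "'a::euclidean_space \<Rightarrow> ennreal"
  assumes [measurable]: "k \<in> borel_measurable borel"
  shows "(\<integral>\<^sup>+y. k (x - y) \<partial>lborel) = (\<integral>\<^sup>+y. k y \<partial>lborel)"
proof -
  have "(\<integral>\<^sup>+y. k (x - y) \<partial>lborel) = (\<integral>\<^sup>+y. k (x + y) \<partial>lborel)"
    using orthogonal_nn_integral_reflected[of "\<lambda>y. y" "\<lambda>y. k (x + y)"] by simp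
  then show ?thesis using nn_integral_lborel_translate[of k x] by simp
qed

lemma emeasure_Markov:
  assumes [measurable]: "T \<in> borel_measurable M" and t: "0 < t" and c: "0 \<le> c"
    and le: "(\<integral>\<^sup>+x. T x \<partial>M) \<le> ennreal (c * t)"
  shows "emeasure M {x \<in> space M. ennreal c < T x} \<le> ennreal t"
proof (cases "c = 0")
  case True
  then have "(\<integral>\<^sup>+x. T x \<partial>M) = 0" using le by simp
  then have "AE x in M. T x = 0" by (subst (asm) nn_integral_0_iff_AE) auto
  then have "emeasure M {x \<in> space M. ennreal c < T x} = emeasure M {}"
    using True by (intro emeasure_eq_AE) auto
  then show ?thesis by simp
next
  case False
  have "ennreal c * emeasure M {x \<in> space M. ennreal c < T x}
      = (\<integral>\<^sup>+x. ennreal c * indicator {x \<in> space M. ennreal c < T x} x \<partial>M)"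
    by (rule nn_integral_cmult_indicator[symmetric]) measurable
  also have "\<dots> \<le> (\<integral>\<^sup>+x. T x \<partial>M)"
    by (intro nn_integral_mono) (auto simp: indicator_def)
  also have "\<dots> \<le> ennreal c * ennreal t" using le c t by (simp add: ennreal_mult)
  finally show ?thesis using c False
    by (subst (asm) ennreal_mult_le_mult_iff) auto
qed

text \<open>
  Write \<open>|f| \<le> \<tau> + h\<close> with \<open>\<tau> = f\<^sup>*(t)\<close> and \<open>h\<close> the excess of \<open>|f|\<close> over \<open>\<tau>\<close>. The bounded part
  contributes at most \<open>A \<tau>\<close> at every point. The excess has integral at most \<open>\<phi>\<close>, so that its
  convolution has integral at most \<open>A \<phi>\<close> and exceeds \<open>A \<phi> / t\<close> only on a set of measure at most \<open>t\<close>, by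
  Markov's inequality. Finally \<open>\<tau> \<le> \<phi> / t\<close> because \<open>f\<^sup>*\<close> is nonincreasing.
\<close>

lemma convolution_rearrangement_borel:
  fixes k f :: "real ^ 'n \<Rightarrow> complex"
  assumes k[measurable]: "k \<in> borel_measurable borel"
    and A: "A \<ge> 0" "(\<integral>\<^sup>+x. norm (k x) \<partial>lborel) \<le> ennreal A"
    and f[measurable]: "f \<in> borel_measurable borel"
    and t: "t > 0" and \<phi>: "\<phi> \<ge> 0" "rearrangement_integral f t = ennreal \<phi>"
  shows "AE x in lborel. integrable lborel (\<lambda>y. k (x - y) * f y)"
    and "rearrangement (convolve lborel k f) t \<le> ennreal (2 * A * \<phi> / t)"
proof -
  have "rearrangement f t * ennreal t = (\<integral>\<^sup>+u. rearrangement f t * indicator {0<..<t} u \<partial>lborel)"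
    using t by (subst nn_integral_cmult_indicator) auto
  also have "\<dots> \<le> rearrangement_integral f t"
    by (intro nn_integral_mono) (auto simp: indicator_def intro: rearrangement_antimono)
  finally have le: "rearrangement f t * ennreal t \<le> ennreal \<phi>" using \<phi> by simp
  then have "rearrangement f t \<noteq> \<infinity>" using t by (auto simp: ennreal_top_mult top_unique)
  then obtain \<tau> where \<tau>: "\<tau> \<ge> 0" "rearrangement f t = ennreal \<tau>"
    by (cases "rearrangement f t") auto
  have "\<tau> * t \<le> \<phi>" using le \<tau> t \<phi> by (simp add: ennreal_mult[symmetric] ennreal_le_iff)
  then have \<tau>le: "\<tau> \<le> \<phi> / t" using t by (simp add: field_simps)
  define h where "h = (\<lambda>y. ennreal (norm (f y) - \<tau>))"
  have [measurable]: "h \<in> borel_measurable borel" unfolding h_def by measurable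
  have h: "(\<integral>\<^sup>+y. h y \<partial>lborel) \<le> ennreal \<phi>"
    using nn_integral_excess_le_rearrangement[OF f \<tau>(1) _ t] \<tau> \<phi> by (simp add: h_def)
  define T where "T = (\<lambda>x. \<integral>\<^sup>+y. ennreal (norm (k (x - y))) * h y \<partial>lborel)"
  have [measurable]: "T \<in> borel_measurable borel" unfolding T_def by measurable
  have "(\<integral>\<^sup>+x. T x \<partial>lborel) = (\<integral>\<^sup>+x. ennreal (norm (k x)) \<partial>lborel) * (\<integral>\<^sup>+y. h y \<partial>lborel)"
    unfolding T_def by (rule nn_integral_convolution) measurable
  also have "\<dots> \<le> ennreal A * ennreal \<phi>" by (intro mult_mono A h) auto
  finally have T: "(\<integral>\<^sup>+x. T x \<partial>lborel) \<le> ennreal (A * \<phi>)" using A \<phi> by (simp add: ennreal_mult)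
  have bound: "(\<integral>\<^sup>+y. norm (k (x - y) * f y) \<partial>lborel) \<le> ennreal (A * \<tau>) + T x" for x
  proof -
    have "(\<integral>\<^sup>+y. norm (k (x - y) * f y) \<partial>lborel)
        \<le> (\<integral>\<^sup>+y. (ennreal (norm (k (x - y))) * ennreal \<tau> + ennreal (norm (k (x - y))) * h y) \<partial>lborel)"
    proof (rule nn_integral_mono)
      fix y
      have "ennreal (norm (f y)) \<le> ennreal \<tau> + h y"
        unfolding h_def using \<tau>(1) by (cases "norm (f y) \<le> \<tau>") (auto simp: ennreal_neg ennreal_leI simp flip: ennreal_plus)
      then have "ennreal (norm (k (x - y))) * ennreal (norm (f y)) \<le> ennreal (norm (k (x - y))) * (ennreal \<tau> + h y)"
        by (rule mult_left_mono) simp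
      then show "ennreal (norm (k (x - y) * f y)) \<le> ennreal (norm (k (x - y))) * ennreal \<tau> + ennreal (norm (k (x - y))) * h y"
        by (simp add: norm_mult ennreal_mult distrib_left)
    qed
    also have "\<dots> = (\<integral>\<^sup>+y. ennreal (norm (k (x - y))) * ennreal \<tau> \<partial>lborel) + T x"
      unfolding T_def by (rule nn_integral_add) measurable
    also have "(\<integral>\<^sup>+y. ennreal (norm (k (x - y))) * ennreal \<tau> \<partial>lborel) = (\<integral>\<^sup>+y. ennreal (norm (k (x - y))) \<partial>lborel) * ennreal \<tau>"
      by (rule nn_integral_multc) measurable
    also have "(\<integral>\<^sup>+y. ennreal (norm (k (x - y))) \<partial>lborel) = (\<integral>\<^sup>+y. ennreal (norm (k y)) \<partial>lborel)"
      by (rule nn_integral_lborel_reflect) measurable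
    also have "(\<integral>\<^sup>+y. ennreal (norm (k y)) \<partial>lborel) * ennreal \<tau> \<le> ennreal A * ennreal \<tau>"
      using A by (intro mult_right_mono) auto
    finally show ?thesis using A \<tau> by (simp add: ennreal_mult add_right_mono)
  qed
  have "AE x in lborel. T x < \<infinity>"
  proof -
    have "(\<integral>\<^sup>+x. T x \<partial>lborel) \<noteq> \<infinity>" using T by (auto simp: top_unique)
    then have "AE x in lborel. T x \<noteq> \<infinity>" by (intro nn_integral_noteq_infinite) auto
    then show ?thesis by eventually_elim (simp add: less_top)
  qed
  then show "AE x in lborel. integrable lborel (\<lambda>y. k (x - y) * f y)"
  proof eventually_elim
    case (elim x)
    have "ennreal (A * \<tau>) + T x < \<infinity>" using elim by (simp add: less_top[symmetric])
    then show ?case using bound[of x]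
      by (intro integrableI_bounded) (measurable, auto intro: order_le_less_trans)
  qed
  define F where "F = convolve lborel k f"
  have [measurable]: "F \<in> borel_measurable borel"
    unfolding F_def by (rule lborel.borel_measurable_lebesgue_integral) measurable
  have F: "ennreal (norm (F x)) \<le> ennreal (A * \<tau>) + T x" for x
  proof (cases "integrable lborel (\<lambda>y. k (x - y) * f y)")
    case True
    then show ?thesis unfolding F_def using bound[of x] integral_norm_bound_ennreal order_trans by blast
  next
    case False
    then show ?thesis by (simp add: F_def not_integrable_integral_eq)
  qed
  define c where "c = A * \<phi> / t"
  have c: "c \<ge> 0" "A * \<phi> = c * t" using A \<phi> t by (auto simp: c_def)
  have "{x. A * \<tau> + c < norm (F x)} \<subseteq> {x. ennreal c < T x}"
  proof
    fix x assume "x \<in> {x. A * \<tau> + c < norm (F x)}"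
    then have "ennreal (A * \<tau>) + ennreal c < ennreal (norm (F x))"
      using A \<tau> c by (simp add: ennreal_less_iff flip: ennreal_plus)
    then have "ennreal (A * \<tau>) + ennreal c < ennreal (A * \<tau>) + T x" using F[of x] by (rule order_less_le_trans)
    then show "x \<in> {x. ennreal c < T x}" by (simp add: ennreal_add_left_cancel_less)
  qed
  then have "emeasure lborel {x. A * \<tau> + c < norm (F x)} \<le> emeasure lborel {x. ennreal c < T x}"
    by (intro emeasure_mono) auto
  also have "\<dots> \<le> ennreal t"
    using emeasure_Markov[of T lborel t c] T t c by simp
  finally have "emeasure lborel {x. A * \<tau> + c < norm (F x)} \<le> ennreal t" .
  moreover have "{x. A * \<tau> + c < norm (F x)} \<in> sets lborel" by measurable
  ultimately have "rearrangement F t \<le> ennreal (A * \<tau> + c)"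
    using A \<tau> c by (subst rearrangement_le_iff) (auto simp: measurable_completion)
  also have "A * \<tau> + c \<le> 2 * A * \<phi> / t"
    using mult_left_mono[OF \<tau>le A(1)] by (simp add: c_def)
  finally show "rearrangement (convolve lborel k f) t \<le> ennreal (2 * A * \<phi> / t)"
    unfolding F_def by (simp add: ennreal_leI)
qed

lemma convolution_rearrangement:
  fixes k f :: "real ^ 'n \<Rightarrow> complex"
  assumes k[measurable]: "k \<in> borel_measurable borel"
    and A: "A > 0" "(\<integral>\<^sup>+x. norm (k x) \<partial>lborel) \<le> ennreal A"
    and f: "f \<in> borel_measurable lebesgue"
    and fin: "\<And>t. t > 0 \<Longrightarrow> t < t\<^sub>0 \<Longrightarrow> rearrangement_integral f t < \<infinity>"
    and t0: "t\<^sub>0 > 0"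
  shows "convolution_exists k f"
    and "convolve lebesgue k f \<in> borel_measurable lebesgue"
    and "\<And>t. t > 0 \<Longrightarrow> rearrangement (convolve lebesgue k f) t
           \<le> ennreal (2 * A / t) * rearrangement_integral f t"
proof -
  obtain g where g[measurable]: "g \<in> borel_measurable borel" and fg: "AE y in lebesgue. f y = g y"
    using borel_representative[OF f] .
  have gl: "g \<in> borel_measurable lebesgue" using g by (simp add: measurable_completion)
  have re: "rearrangement f = rearrangement g" by (rule rearrangement_cong_AE[OF f gl fg])
  have kx: "(\<lambda>y. k (x - y)) \<in> borel_measurable lebesgue" for x
    by (intro measurable_completion) measurable
  have AEx: "AE y in lebesgue. k (x - y) * f y = k (x - y) * g y" for x
    using fg by eventually_elim simp
  have int: "integrable lebesgue (\<lambda>y. k (x - y) * f y) \<longleftrightarrow> integrable lborel (\<lambda>y. k (x - y) * g y)" for x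
  proof -
    have "integrable lebesgue (\<lambda>y. k (x - y) * f y) \<longleftrightarrow> integrable lebesgue (\<lambda>y. k (x - y) * g y)"
      using kx f gl AEx by (intro integrable_cong_AE borel_measurable_times) auto
    also have "\<dots> \<longleftrightarrow> integrable lborel (\<lambda>y. k (x - y) * g y)"
      by (rule integrable_completion) measurable
    finally show ?thesis .
  qed
  have eq: "convolve lebesgue k f x = convolve lborel k g x" for x
  proof -
    have "convolve lebesgue k f x = convolve lebesgue k g x"
      using kx f gl AEx by (intro integral_cong_AE borel_measurable_times) auto
    also have "\<dots> = convolve lborel k g x"
      by (rule integral_completion) measurable
    finally show ?thesis .
  qed
  have "convolve lborel k g \<in> borel_measurable borel"
    by (rule lborel.borel_measurable_lebesgue_integral) measurable
  then show "convolve lebesgue k f \<in> borel_measurable lebesgue"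
    by (simp add: eq measurable_completion)
  obtain \<phi> where \<phi>: "\<phi> \<ge> 0" "rearrangement_integral g (t\<^sub>0/2) = ennreal \<phi>"
    using fin[of "t\<^sub>0/2"] t0 by (cases "\<integral>\<^sup>+u. rearrangement g u * indicator {0<..<t\<^sub>0/2} u \<partial>lborel") (auto simp: re)
  show "convolution_exists k f"
    unfolding int using convolution_rearrangement_borel(1)[OF k less_imp_le[OF A(1)] A(2) g _ \<phi>] t0 by (intro AE_completion) auto
  fix t :: real assume t: "t > 0"
  show "rearrangement (convolve lebesgue k f) t
           \<le> ennreal (2 * A / t) * rearrangement_integral f t"
  proof (cases "\<integral>\<^sup>+u. rearrangement f u * indicator {0<..<t} u \<partial>lborel")
    case (real \<psi>)
    then show ?thesis
      using convolution_rearrangement_borel(2)[OF k less_imp_le[OF A(1)] A(2) g t, of \<psi>] A t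
      by (simp add: re eq ennreal_mult[symmetric])
  next
    case top
    have "ennreal (2 * A / t) \<noteq> 0" using A t by simp
    then show ?thesis unfolding top by (simp add: ennreal_mult_top del: ennreal_eq_0_iff)
  qed
qed

section \<open>The Hardy inequality with constant exponents\<close>

abbreviation half_line_integral :: "real measure \<Rightarrow> (real \<Rightarrow> real) \<Rightarrow> ennreal" where
  "half_line_integral M f \<equiv> \<integral>\<^sup>+t. ennreal (f t) * indicator {0<..} t \<partial>M"

abbreviation initial_integral :: "(real \<Rightarrow> real) \<Rightarrow> real \<Rightarrow> ennreal" where
  "initial_integral g t \<equiv> \<integral>\<^sup>+s. ennreal (g s) * indicator {0<..<t} s \<partial>lborel"

text \<open>
  Here \<open>L\<close> stands for \<open>1 + |ln t|\<close> and \<open>|r1 - r2| \<le> A / L\<close> is the logarithmic decay condition.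
  If \<open>|ln Y| \<le> B L\<close> then \<open>Y powr (r1 - r2)\<close> is at most \<open>exp (A B)\<close>. For the
  remaining values \<open>Y < exp (- 2 L) < 1\<close> one has \<open>Y powr r1 \<le> Y\<close>, since \<open>r1 \<ge> 1\<close>.
\<close>

lemma powr_exchange_exponent:
  fixes Y L A B r1 r2 :: real
  assumes r: "1 \<le> r1" "\<bar>r1 - r2\<bar> * L \<le> A" and L: "1 \<le> L" and B: "2 \<le> B"
    and Y: "0 \<le> Y" "Y \<le> exp (B * L)"
  shows "Y powr r1 \<le> exp (A * B) * Y powr r2 + exp (- 2 * L)"
proof (cases "exp (- 2 * L) \<le> Y")
  case True
  then have Y0: "Y > 0" using exp_gt_zero[of "- 2 * L"] by linarith
  have "- 2 * L \<le> ln Y" using True Y0 by (simp add: ln_ge_iff)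
  moreover have "ln Y \<le> B * L" using Y(2) Y0 by (metis exp_gt_zero ln_exp ln_le_cancel_iff)
  moreover have "2 * L \<le> B * L" using B L by (intro mult_right_mono) auto
  ultimately have ab: "\<bar>ln Y\<bar> \<le> B * L" by linarith
  have "(r1 - r2) * ln Y \<le> \<bar>r1 - r2\<bar> * \<bar>ln Y\<bar>" by (metis abs_ge_self abs_mult)
  also have "\<dots> \<le> \<bar>r1 - r2\<bar> * (B * L)" using ab by (intro mult_left_mono) auto
  also have "\<dots> = (\<bar>r1 - r2\<bar> * L) * B" by simp
  also have "\<dots> \<le> A * B" using r B by (intro mult_right_mono) auto
  finally have e: "exp ((r1 - r2) * ln Y) \<le> exp (A * B)" by simp
  have "Y powr r1 = exp ((r1 - r2) * ln Y) * Y powr r2"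
    using Y0 by (simp add: powr_def algebra_simps flip: exp_add)
  also have "\<dots> \<le> exp (A * B) * Y powr r2" using e by (rule mult_right_mono) simp
  finally show ?thesis by (simp add: add_increasing2)
next
  case False
  have "Y \<le> 1" using False L by (smt (verit) exp_le_one_iff)
  then have "Y powr r1 \<le> Y powr 1" using r Y by (intro powr_mono') auto
  also have "\<dots> \<le> exp (- 2 * L)" using False Y by simp
  finally show ?thesis by (simp add: add_increasing)
qed

lemma nn_integral_powr_to_inf:
  fixes a c :: real
  assumes "a < -1" "c > 0"
  shows "(\<integral>\<^sup>+t. ennreal (t powr a) * indicator {c<..} t \<partial>lborel) = ennreal (c powr (a + 1) / (- a - 1))"
proof -
  have "((\<lambda>t. t powr a) has_integral - (c powr (a + 1)) / (a + 1)) {c..}"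
    using has_integral_powr_to_inf[of a c] assms by simp
  then have "(\<integral>\<^sup>+t. ennreal (indicator {c..} t * t powr a) \<partial>lborel) = ennreal (- (c powr (a + 1)) / (a + 1))"
    by (rule nn_integral_has_integral_lebesgue[rotated]) simp
  then have "(\<integral>\<^sup>+t. ennreal (t powr a) * indicator {c..} t \<partial>lborel) = ennreal (- (c powr (a + 1)) / (a + 1))"
    by (simp add: ennreal_mult ennreal_indicator mult.commute)
  also have "- (c powr (a + 1)) / (a + 1) = c powr (a + 1) / (- a - 1)"
    using assms by (simp add: field_simps)
  also have "(\<integral>\<^sup>+t. ennreal (t powr a) * indicator {c..} t \<partial>lborel) = (\<integral>\<^sup>+t. ennreal (t powr a) * indicator {c<..} t \<partial>lborel)"
    using AE_lborel_singleton[of c] by (intro nn_integral_cong_AE) (auto simp: indicator_def)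
  finally show ?thesis .
qed

lemma nn_integral_powr_from_0:
  fixes a c :: real
  assumes "a > -1" "c > 0"
  shows "initial_integral (\<lambda>t. t powr a) c = ennreal (c powr (a + 1) / (a + 1))"
proof -
  have "((\<lambda>t. t powr a) has_integral (c powr (a + 1)) / (a + 1)) {0..c}"
    using has_integral_powr_from_0[of a c] assms by simp
  then have "(\<integral>\<^sup>+t. ennreal (indicator {0..c} t * t powr a) \<partial>lborel) = ennreal ((c powr (a + 1)) / (a + 1))"
    by (rule nn_integral_has_integral_lebesgue[rotated]) simp
  then have "(\<integral>\<^sup>+t. ennreal (t powr a) * indicator {0..c} t \<partial>lborel) = ennreal ((c powr (a + 1)) / (a + 1))"
    by (simp add: ennreal_mult ennreal_indicator mult.commute)
  also have "(\<integral>\<^sup>+t. ennreal (t powr a) * indicator {0..c} t \<partial>lborel) = initial_integral (\<lambda>t. t powr a) c"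
    using AE_lborel_singleton[of c] AE_lborel_singleton[of 0]
    by (intro nn_integral_cong_AE) (auto simp: indicator_def)
  finally show ?thesis .
qed

text \<open>
  The error term left by the exchange of exponents is integrable: it is at most \<open>1\<close> near the origin
  and at most \<open>t powr (-2)\<close> at infinity.
\<close>

lemma nn_integral_exp_ln_decay:
  "half_line_integral lborel (\<lambda>t. exp (- 2 * (1 + \<bar>ln t\<bar>))) \<le> 2"
proof -
  have "half_line_integral lborel (\<lambda>t. exp (- 2 * (1 + \<bar>ln t\<bar>)))
     \<le> (\<integral>\<^sup>+t. (indicator {0<..1} t + ennreal (t powr (-2)) * indicator {1<..} t) \<partial>lborel)"
    (is "integral\<^sup>N _ ?f \<le> integral\<^sup>N _ ?g")
  proof (rule nn_integral_mono)
    fix t :: real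
    show "?f t \<le> ?g t"
    proof -
      consider "t \<le> 0" | "0 < t" "t \<le> 1" | "1 < t" by linarith
      then show ?thesis
      proof cases
        case 2
        have "exp (- 2 * (1 + a)) \<le> 1" if "a \<ge> 0" for a :: real using that by simp
        then have "ennreal (exp (- 2 * (1 + \<bar>ln t\<bar>))) \<le> ennreal 1" by (intro ennreal_leI) simp
        then show ?thesis using 2 by simp
      next
        case 3
        have "exp (- 2 * (1 + \<bar>ln t\<bar>)) \<le> exp (- 2 * ln t)" using 3 by simp
        also have "\<dots> = t powr (-2)" using 3 by (simp add: powr_def)
        finally show ?thesis using 3 by (simp add: ennreal_leI)
      qed simp
    qed
  qed
  also have "\<dots> = (\<integral>\<^sup>+t. indicator {0<..1::real} t \<partial>lborel) + (\<integral>\<^sup>+t. ennreal (t powr (-2)) * indicator {1<..} t \<partial>lborel)"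
    by (rule nn_integral_add) measurable
  also have "\<dots> = ennreal 1 + ennreal 1"
    by (subst nn_integral_powr_to_inf) auto
  also have "\<dots> = 2" by simp
  finally show ?thesis .
qed

text \<open>
  The graph of \<open>x powr q\<close> lies above its tangent at \<open>m\<close>, with the terms arranged so that none is
  negative; in this form it can be integrated without knowing that the integrals are finite.
\<close>

lemma powr_tangent_inequality:
  fixes x m q :: real
  assumes q: "1 \<le> q" and x: "0 \<le> x" and m: "0 < m"
  shows "q * m powr (q - 1) * x \<le> x powr q + (q - 1) * m powr q"
proof (cases "x = 0 \<or> q = 1")
  case True
  then show ?thesis using q m x by auto
next
  case False
  then have x0: "x > 0" and q1: "q > 1" using x q by auto
  have "(x powr q) powr (1 / q) * ((m powr q) powr ((q - 1) / q)) \<le> (1 / q) * x powr q + ((q - 1) / q) * m powr q"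
    using q1 x0 m by (intro Youngs_inequality_0) (auto simp: field_simps)
  also have "(x powr q) powr (1 / q) = x" using q1 x0 by (simp add: powr_powr)
  also have "(m powr q) powr ((q - 1) / q) = m powr (q - 1)" using q1 m by (simp add: powr_powr)
  finally have "q * (x * m powr (q - 1)) \<le> q * ((1 / q) * x powr q + ((q - 1) / q) * m powr q)"
    using q1 by (intro mult_left_mono) auto
  also have "\<dots> = x powr q + (q - 1) * m powr q" using q1 by (simp add: field_simps)
  finally show ?thesis by (simp add: mult_ac)
qed

text \<open>
  Jensen's inequality for \<open>s powr \<theta> * g s\<close> and the probability density proportional to
  \<open>s powr (- \<theta>)\<close> on \<open>(0, t)\<close>: integrate the tangent inequality and choose for \<open>m\<close> the mean
  itself. The choice \<open>m = 1\<close> shows first that the mean is finite.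
\<close>

lemma jensen_average:
  fixes g :: "real \<Rightarrow> real" and q \<theta> t J :: real
  assumes q: "1 \<le> q" and \<theta>: "\<theta> < 1" and g[measurable]: "g \<in> borel_measurable borel" and g0: "\<And>s. 0 \<le> g s"
    and t: "0 < t"
    and J: "initial_integral (\<lambda>s. s powr (\<theta> * (q - 1)) * g s powr q) t \<le> ennreal J" "0 \<le> J"
  shows "initial_integral g t < \<infinity>" (is "?I < \<infinity>")
    and "(enn2real (initial_integral g t) / t) powr q
           \<le> (1 - \<theta>) powr (1 - q) * t powr (- \<theta> * (q - 1) - 1) * J"
proof -
  define \<kappa> where "\<kappa> = (1 - \<theta>) * t powr (\<theta> - 1)"
  have \<kappa>: "\<kappa> > 0" using \<theta> t by (simp add: \<kappa>_def)
  have mass: "initial_integral (\<lambda>s. \<kappa> * s powr (- \<theta>)) t = 1"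
  proof -
    have "initial_integral (\<lambda>s. \<kappa> * s powr (- \<theta>)) t
       = (\<integral>\<^sup>+s. ennreal \<kappa> * (ennreal (s powr (- \<theta>)) * indicator {0<..<t} s) \<partial>lborel)"
      using \<kappa> by (simp add: ennreal_mult mult.assoc)
    also have "\<dots> = ennreal \<kappa> * initial_integral (\<lambda>s. s powr (- \<theta>)) t"
      by (rule nn_integral_cmult) measurable
    also have "\<dots> = ennreal \<kappa> * ennreal (t powr (- \<theta> + 1) / (- \<theta> + 1))"
      using \<theta> t by (subst nn_integral_powr_from_0) auto
    also have "\<dots> = ennreal (\<kappa> * (t powr (- \<theta> + 1) / (- \<theta> + 1)))"
      by (rule ennreal_mult[symmetric]) (use \<kappa> \<theta> in auto)
    also have "\<kappa> * (t powr (- \<theta> + 1) / (- \<theta> + 1)) = t powr (\<theta> - 1) * t powr (- \<theta> + 1)"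
      using \<theta> by (simp add: \<kappa>_def)
    also have "\<dots> = 1" using t by (simp flip: powr_add)
    finally show ?thesis by simp
  qed
  have tangent: "ennreal (q * m powr (q - 1)) * (ennreal \<kappa> * ?I) \<le> ennreal (\<kappa> * J) + ennreal ((q - 1) * m powr q)" if m: "m > 0" for m
  proof -
    have "ennreal (q * m powr (q - 1)) * (ennreal \<kappa> * ?I) = (\<integral>\<^sup>+s. ennreal (q * m powr (q - 1) * \<kappa>) * (ennreal (g s) * indicator {0<..<t} s) \<partial>lborel)"
      using q \<kappa> by (subst nn_integral_cmult) (auto simp: ennreal_mult mult.assoc)
    also have "\<dots> \<le> (\<integral>\<^sup>+s. (ennreal \<kappa> * (ennreal (s powr (\<theta> * (q - 1)) * g s powr q) * indicator {0<..<t} s)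
           + ennreal ((q - 1) * m powr q) * (ennreal (\<kappa> * s powr (- \<theta>)) * indicator {0<..<t} s)) \<partial>lborel)"
      (is "integral\<^sup>N _ ?f \<le> integral\<^sup>N _ ?g")
    proof (rule nn_integral_mono)
      fix s :: real
      show "?f s \<le> ?g s"
      proof (cases "s \<in> {0<..<t}")
        case True
        then have s: "s > 0" by simp
        have "q * m powr (q - 1) * (s powr \<theta> * g s) \<le> (s powr \<theta> * g s) powr q + (q - 1) * m powr q"
          using q m g0 by (intro powr_tangent_inequality) auto
        then have "(q * m powr (q - 1) * (s powr \<theta> * g s)) * (\<kappa> * s powr (- \<theta>))
             \<le> ((s powr \<theta> * g s) powr q + (q - 1) * m powr q) * (\<kappa> * s powr (- \<theta>))"
          using \<kappa> by (intro mult_right_mono) auto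
        moreover have "(q * m powr (q - 1) * (s powr \<theta> * g s)) * (\<kappa> * s powr (- \<theta>)) = q * m powr (q - 1) * \<kappa> * g s"
          using s by (simp add: powr_minus)
        moreover have "(s powr \<theta> * g s) powr q * s powr (- \<theta>) = s powr (\<theta> * (q - 1)) * g s powr q"
        proof -
          have "(s powr \<theta> * g s) powr q * s powr (- \<theta>) = (s powr (\<theta> * q) * s powr (- \<theta>)) * g s powr q"
            using s g0 by (simp add: powr_mult powr_powr)
          also have "s powr (\<theta> * q) * s powr (- \<theta>) = s powr (\<theta> * (q - 1))"
            by (simp add: right_diff_distrib flip: powr_add)
          finally show ?thesis .
        qed
        moreover have "((s powr \<theta> * g s) powr q + (q - 1) * m powr q) * (\<kappa> * s powr (- \<theta>))
           = \<kappa> * ((s powr \<theta> * g s) powr q * s powr (- \<theta>)) + ((q - 1) * m powr q) * (\<kappa> * s powr (- \<theta>))"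
          by (simp add: algebra_simps)
        ultimately have "q * m powr (q - 1) * \<kappa> * g s \<le> \<kappa> * (s powr (\<theta> * (q - 1)) * g s powr q) + ((q - 1) * m powr q) * (\<kappa> * s powr (- \<theta>))"
          by simp
        then have "ennreal (q * m powr (q - 1) * \<kappa> * g s) \<le> ennreal (\<kappa> * (s powr (\<theta> * (q - 1)) * g s powr q)) + ennreal (((q - 1) * m powr q) * (\<kappa> * s powr (- \<theta>)))"
          using ennreal_plus[of "\<kappa> * (s powr (\<theta> * (q - 1)) * g s powr q)" "((q - 1) * m powr q) * (\<kappa> * s powr (- \<theta>))"] \<kappa> q
          by (metis ennreal_leI less_imp_le mult_nonneg_nonneg powr_ge_zero diff_ge_0_iff_ge)
        then show ?thesis using True \<kappa> q g0[of s] by (simp add: ennreal_mult)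
      qed simp
    qed
    also have "\<dots> = (\<integral>\<^sup>+s. ennreal \<kappa> * (ennreal (s powr (\<theta> * (q - 1)) * g s powr q) * indicator {0<..<t} s) \<partial>lborel)
           + (\<integral>\<^sup>+s. ennreal ((q - 1) * m powr q) * (ennreal (\<kappa> * s powr (- \<theta>)) * indicator {0<..<t} s) \<partial>lborel)"
      by (rule nn_integral_add) measurable
    also have "\<dots> = ennreal \<kappa> * initial_integral (\<lambda>s. s powr (\<theta> * (q - 1)) * g s powr q) t
           + ennreal ((q - 1) * m powr q)"
      by (subst nn_integral_cmult, measurable, subst nn_integral_cmult, measurable) (simp only: mass mult_1_right)
    also have "\<dots> \<le> ennreal \<kappa> * ennreal J + ennreal ((q - 1) * m powr q)"
      using J by (intro add_right_mono mult_left_mono) auto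
    finally show ?thesis using \<kappa> J by (simp add: ennreal_mult)
  qed
  show fin: "?I < \<infinity>"
  proof (rule ccontr)
    assume "\<not> ?I < \<infinity>"
    then have "?I = \<infinity>" by (simp add: less_top[symmetric])
    then show False using tangent[of 1] q \<kappa> by (auto simp: ennreal_mult_top top_unique simp flip: ennreal_plus)
  qed
  define i where "i = enn2real ?I"
  have i: "0 \<le> i" "?I = ennreal i" using fin by (auto simp: i_def less_top)
  have main: "(\<kappa> * i) powr q \<le> \<kappa> * J"
  proof (cases "i = 0")
    case False
    (* The tangent at the mean turns the tangent inequality into Jensen's. *)
    define m where "m = \<kappa> * i"
    have m: "m > 0" using False i \<kappa> by (simp add: m_def)
    have "ennreal (q * m powr (q - 1)) * ennreal m \<le> ennreal (\<kappa> * J) + ennreal ((q - 1) * m powr q)"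
      using tangent[OF m] i \<kappa> by (simp add: m_def ennreal_mult)
    moreover have "ennreal (q * m powr (q - 1)) * ennreal m = ennreal (q * m powr (q - 1) * m)"
      by (rule ennreal_mult[symmetric]) (use q m in auto)
    moreover have "ennreal (\<kappa> * J) + ennreal ((q - 1) * m powr q) = ennreal (\<kappa> * J + (q - 1) * m powr q)"
      by (rule ennreal_plus[symmetric]) (use q J \<kappa> in auto)
    ultimately have "ennreal (q * m powr (q - 1) * m) \<le> ennreal (\<kappa> * J + (q - 1) * m powr q)" by simp
    then have "q * m powr (q - 1) * m \<le> \<kappa> * J + (q - 1) * m powr q"
      by (rule ennreal_le_iff[THEN iffD1, rotated]) (use q J \<kappa> in auto)
    moreover have "q * m powr (q - 1) * m = q * m powr q" using m by (simp add: powr_diff)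
    moreover have "(q - 1) * m powr q = q * m powr q - m powr q" by (simp add: algebra_simps)
    ultimately have "m powr q \<le> \<kappa> * J" by linarith
    then show ?thesis by (simp add: m_def)
  qed (use \<kappa> J in auto)
  have "(i / t) powr q = (\<kappa> * i) powr q * (1 / (\<kappa> * t)) powr q"
    using \<kappa> i t by (subst powr_mult[symmetric]) auto
  also have "\<dots> \<le> \<kappa> * J * (1 / (\<kappa> * t)) powr q"
    by (intro mult_right_mono main) auto
  also have "\<kappa> * J * (1 / (\<kappa> * t)) powr q = (1 - \<theta>) powr (1 - q) * t powr (- \<theta> * (q - 1) - 1) * J"
  proof -
    have "\<kappa> * t = (1 - \<theta>) * t powr \<theta>" using t by (simp add: \<kappa>_def powr_diff)
    then have "(1 / (\<kappa> * t)) powr q = (1 - \<theta>) powr (- q) * t powr (- \<theta> * q)"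
      using \<theta> t by (simp only:) (simp add: powr_divide powr_mult powr_powr powr_minus_divide)
    then have "\<kappa> * (1 / (\<kappa> * t)) powr q = ((1 - \<theta>) powr 1 * (1 - \<theta>) powr (- q)) * (t powr (\<theta> - 1) * t powr (- \<theta> * q))"
      using \<theta> by (simp add: \<kappa>_def)
    also have "(1 - \<theta>) powr 1 * (1 - \<theta>) powr (- q) = (1 - \<theta>) powr (1 - q)"
      by (simp only: powr_add[symmetric]) simp
    also have "t powr (\<theta> - 1) * t powr (- \<theta> * q) = t powr (- \<theta> * (q - 1) - 1)"
      by (simp only: powr_add[symmetric]) (simp add: algebra_simps)
    finally show ?thesis by (simp add: mult_ac)
  qed
  finally show "(enn2real ?I / t) powr q \<le> (1 - \<theta>) powr (1 - q) * t powr (- \<theta> * (q - 1) - 1) * J"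
    by (simp add: i_def)
qed

definition hardy :: "(real \<Rightarrow> real) \<Rightarrow> real \<Rightarrow> real" where
  "hardy g t = enn2real (initial_integral g t) / t"

lemma borel_measurable_indicator_Ioo[measurable (raw)]:
  fixes u v :: "'a \<Rightarrow> real"
  assumes [measurable]: "u \<in> borel_measurable M" "v \<in> borel_measurable M"
  shows "(\<lambda>x. indicator {0<..<u x} (v x) :: ennreal) \<in> borel_measurable M"
proof -
  have "(\<lambda>x. if 0 < v x \<and> v x < u x then 1 else 0 :: ennreal) \<in> borel_measurable M" by measurable
  then show ?thesis by (simp add: indicator_def)
qed

lemma borel_measurable_hardy[measurable]:
  assumes [measurable]: "g \<in> borel_measurable borel"
  shows "hardy g \<in> borel_measurable borel"
  unfolding hardy_def[abs_def] by measurable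

lemma hardy_nonneg: "0 \<le> t \<Longrightarrow> 0 \<le> hardy g t"
  by (simp add: hardy_def)

text \<open>
  The classical weighted inequality. By \<open>jensen_average\<close> the average at \<open>t\<close> is bounded by
  an integral of \<open>g powr q\<close> over \<open>(0, t)\<close>, and interchanging the integrals
  gives the claim. The parameter \<open>\<theta> < 1\<close> must satisfy \<open>\<theta> (q - 1) > b q\<close> for the outer integral over \<open>t > s\<close>
  to converge, and such a \<open>\<theta>\<close> exists precisely because \<open>b < 1 - 1/q\<close>. The pointwise bound is
  needed later to control the average before exponents are exchanged.
\<close>

lemma hardy_inequality_power_weight:
  fixes q b :: real
  assumes q: "1 < q" and b: "b < 1 - 1 / q"
  obtains C where "0 \<le> C"
    "\<And>g N. \<lbrakk>g \<in> borel_measurable borel; \<And>s. 0 \<le> g s; 0 \<le> N;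
        half_line_integral lborel (\<lambda>t. t powr (b * q) * g t powr q) \<le> ennreal N\<rbrakk> \<Longrightarrow>
      (\<forall>t>0. initial_integral g t < \<infinity> \<and>
            hardy g t powr q \<le> C * N * t powr (- 1 - b * q)) \<and>
      half_line_integral lborel (\<lambda>t. t powr (b * q) * hardy g t powr q) \<le> ennreal (C * N)"
proof -
  have "b * q < (1 - 1 / q) * q" using b q by (intro mult_strict_right_mono) auto
  also have "\<dots> = q - 1" using q by (simp add: left_diff_distrib)
  finally have "b * q / (q - 1) < 1" using q by simp
  (* e is the rate at which the outer integral converges at infinity. *)
  then obtain \<theta> where \<theta>: "b * q / (q - 1) < \<theta>" "\<theta> < 1" using dense by blast
  define e where "e = \<theta> * (q - 1) - b * q"
  have e: "e > 0" using \<theta>(1) q by (simp add: e_def pos_divide_less_eq)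
  define c where "c = (1 - \<theta>) powr (1 - q)"
  have c: "c \<ge> 0" by (simp add: c_def)
  define C where "C = c + c / e"
  have C: "c \<le> C" "c / e \<le> C" "0 \<le> C" using c e by (auto simp: C_def)
  have *: "(\<forall>t>0. initial_integral g t < \<infinity> \<and>
            hardy g t powr q \<le> C * N * t powr (- 1 - b * q)) \<and>
      half_line_integral lborel (\<lambda>t. t powr (b * q) * hardy g t powr q) \<le> ennreal (C * N)"
    if g[measurable]: "g \<in> borel_measurable borel" and g0: "\<And>s. 0 \<le> g s" and N: "0 \<le> N"
      "half_line_integral lborel (\<lambda>t. t powr (b * q) * g t powr q) \<le> ennreal N" for g N
  proof -
    define J where "J = (\<lambda>t. \<integral>\<^sup>+s. ennreal (s powr (\<theta> * (q - 1)) * g s powr q) * indicator {0<..<t} s \<partial>lborel)"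
    have Jle: "J t \<le> ennreal (t powr e * N)" if t: "t > 0" for t
    proof -
      have "J t \<le> (\<integral>\<^sup>+s. ennreal (t powr e) * (ennreal (s powr (b * q) * g s powr q) * indicator {0<..} s) \<partial>lborel)"
        unfolding J_def
      proof (rule nn_integral_mono)
        fix s :: real
        show "ennreal (s powr (\<theta> * (q - 1)) * g s powr q) * indicator {0<..<t} s
            \<le> ennreal (t powr e) * (ennreal (s powr (b * q) * g s powr q) * indicator {0<..} s)"
        proof (cases "0 < s \<and> s < t")
          case True
          have "s powr (\<theta> * (q - 1)) = s powr e * s powr (b * q)" by (simp add: e_def flip: powr_add)
          also have "\<dots> \<le> t powr e * s powr (b * q)"
            using True e by (intro mult_right_mono powr_mono2) auto
          finally have "s powr (\<theta> * (q - 1)) * g s powr q \<le> (t powr e * s powr (b * q)) * g s powr q"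
            by (rule mult_right_mono) simp
          then have "ennreal (s powr (\<theta> * (q - 1)) * g s powr q) \<le> ennreal (t powr e * (s powr (b * q) * g s powr q))"
            by (intro ennreal_leI) (simp add: mult.assoc)
          then show ?thesis using True by (simp add: ennreal_mult)
        qed auto
      qed
      also have "\<dots> = ennreal (t powr e) * half_line_integral lborel (\<lambda>s. s powr (b * q) * g s powr q)"
        by (rule nn_integral_cmult) measurable
      also have "\<dots> \<le> ennreal (t powr e) * ennreal N" using N by (intro mult_left_mono) auto
      finally show ?thesis using N by (simp add: ennreal_mult)
    qed
    have pt: "initial_integral g t < \<infinity>"
        "hardy g t powr q \<le> C * N * t powr (- 1 - b * q)" if t: "t > 0" for t
    proof -
      have q1: "1 \<le> q" using q by simp
      note ja = jensen_average[OF q1 \<theta>(2) g g0 t Jle[OF t, unfolded J_def]]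
      have nn: "0 \<le> t powr e * N" using N by simp
      show "initial_integral g t < \<infinity>" using ja(1)[OF nn] .
      have "hardy g t powr q \<le> c * t powr (- \<theta> * (q - 1) - 1) * (t powr e * N)"
        using ja(2)[OF nn] by (simp add: hardy_def c_def)
      also have "\<dots> = c * N * (t powr (- \<theta> * (q - 1) - 1) * t powr e)" by (simp add: mult_ac)
      also have "t powr (- \<theta> * (q - 1) - 1) * t powr e = t powr (- 1 - b * q)"
        by (simp add: e_def flip: powr_add)
      also have "c * N * t powr (- 1 - b * q) \<le> C * N * t powr (- 1 - b * q)"
        using C N by (intro mult_right_mono) auto
      finally show "hardy g t powr q \<le> C * N * t powr (- 1 - b * q)" .
    qed
    have "half_line_integral lborel (\<lambda>t. t powr (b * q) * hardy g t powr q)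
       \<le> (\<integral>\<^sup>+t. (\<integral>\<^sup>+s. ennreal (c * t powr (- e - 1)) * (ennreal (s powr (\<theta> * (q - 1)) * g s powr q) * indicator {0<..<t} s) \<partial>lborel) \<partial>lborel)"
      (is "integral\<^sup>N _ ?f \<le> integral\<^sup>N _ ?g")
    proof (rule nn_integral_mono)
      fix t :: real
      show "?f t \<le> ?g t"
      proof (cases "t > 0")
        case t: True
        have fin: "J t < \<infinity>" using Jle[OF t] by (rule order_le_less_trans) simp
        then obtain j where j: "0 \<le> j" "J t = ennreal j" by (cases "J t") auto
        have "hardy g t powr q \<le> c * t powr (- \<theta> * (q - 1) - 1) * j"
          using jensen_average(2)[OF less_imp_le[OF q] \<theta>(2) g g0 t _ j(1)] j(2)
          by (simp add: hardy_def c_def J_def)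
        then have "t powr (b * q) * hardy g t powr q \<le> t powr (b * q) * (c * t powr (- \<theta> * (q - 1) - 1) * j)"
          by (rule mult_left_mono) simp
        also have "\<dots> = c * (t powr (b * q) * t powr (- \<theta> * (q - 1) - 1)) * j" by (simp add: mult_ac)
        also have "t powr (b * q) * t powr (- \<theta> * (q - 1) - 1) = t powr (- e - 1)"
          by (simp add: e_def algebra_simps flip: powr_add)
        finally have "ennreal (t powr (b * q) * hardy g t powr q) \<le> ennreal (c * t powr (- e - 1) * j)"
          by (rule ennreal_leI)
        also have "\<dots> = ennreal (c * t powr (- e - 1)) * J t"
          unfolding j(2) using c j(1) by (intro ennreal_mult) auto
        also have "\<dots> = (\<integral>\<^sup>+s. ennreal (c * t powr (- e - 1)) * (ennreal (s powr (\<theta> * (q - 1)) * g s powr q) * indicator {0<..<t} s) \<partial>lborel)"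
          unfolding J_def by (rule nn_integral_cmult[symmetric]) measurable
        finally show ?thesis using t by simp
      qed simp
    qed
    also have "\<dots> = (\<integral>\<^sup>+s. (\<integral>\<^sup>+t. ennreal (c * t powr (- e - 1)) * (ennreal (s powr (\<theta> * (q - 1)) * g s powr q) * indicator {0<..<t} s) \<partial>lborel) \<partial>lborel)"
      by (rule lborel_pair.Fubini') measurable
    also have "\<dots> = (\<integral>\<^sup>+s. ennreal (c / e) * (ennreal (s powr (b * q) * g s powr q) * indicator {0<..} s) \<partial>lborel)"
      (is "integral\<^sup>N _ ?f = integral\<^sup>N _ ?g")
    proof (rule nn_integral_cong)
      fix s :: real
      show "?f s = ?g s"
      proof (cases "s > 0")
        case s: True
        define G where "G = s powr (\<theta> * (q - 1)) * g s powr q"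
        have G: "G \<ge> 0" by (simp add: G_def)
        have "(\<integral>\<^sup>+t. ennreal (c * t powr (- e - 1)) * (ennreal G * indicator {0<..<t} s) \<partial>lborel)
           = (\<integral>\<^sup>+t. ennreal (c * G) * (ennreal (t powr (- e - 1)) * indicator {s<..} t) \<partial>lborel)"
          using s c G by (intro nn_integral_cong) (auto simp: indicator_def ennreal_mult mult_ac)
        also have "\<dots> = ennreal (c * G) * (\<integral>\<^sup>+t. ennreal (t powr (- e - 1)) * indicator {s<..} t \<partial>lborel)"
          by (rule nn_integral_cmult) measurable
        also have "\<dots> = ennreal (c * G) * ennreal (s powr (- e) / e)"
          using e s by (subst nn_integral_powr_to_inf) auto
        also have "\<dots> = ennreal (c * G * (s powr (- e) / e))"
          by (rule ennreal_mult[symmetric]) (use c G e in auto)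
        also have "c * G * (s powr (- e) / e) = c / e * ((s powr (\<theta> * (q - 1)) * s powr (- e)) * g s powr q)"
          by (simp add: G_def)
        also have "s powr (\<theta> * (q - 1)) * s powr (- e) = s powr (b * q)" by (simp add: e_def flip: powr_add)
        also have "ennreal (c / e * (s powr (b * q) * g s powr q)) = ennreal (c / e) * ennreal (s powr (b * q) * g s powr q)"
          by (rule ennreal_mult) (use c e in auto)
        finally show ?thesis using s by (simp add: G_def)
      qed auto
    qed
    also have "\<dots> = ennreal (c / e) * half_line_integral lborel (\<lambda>s. s powr (b * q) * g s powr q)"
      by (rule nn_integral_cmult) measurable
    also have "\<dots> \<le> ennreal C * ennreal N" using C N by (intro mult_mono ennreal_leI) auto
    also have "\<dots> = ennreal (C * N)" using C N by (simp add: ennreal_mult)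
    finally show ?thesis using pt by blast
  qed
  show ?thesis by (rule that[OF C(3)]) (rule *)
qed

definition two_ended :: "real \<Rightarrow> real \<Rightarrow> real \<Rightarrow> real" where
  "two_ended a c t = (if t \<le> 1 then a else c)"

lemma borel_measurable_two_ended[measurable]: "two_ended a c \<in> borel_measurable borel"
  unfolding two_ended_def[abs_def] by measurable

text \<open>
  The part of \<open>g\<close> on \<open>(0, 1]\<close> contributes to the average at a large \<open>t\<close> only through its total integral,
  divided by \<open>t\<close>.
\<close>

lemma hardy_split:
  fixes g :: "real \<Rightarrow> real"
  assumes [measurable]: "g \<in> borel_measurable borel" and t: "0 < t"
    and fin0: "\<And>t. 0 < t \<Longrightarrow> initial_integral (\<lambda>s. if s \<le> 1 then g s else 0) t < \<infinity>"
    and fin1: "\<And>t. 0 < t \<Longrightarrow> initial_integral (\<lambda>s. if s \<le> 1 then 0 else g s) t < \<infinity>"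
  defines "g0 \<equiv> \<lambda>s. if s \<le> 1 then g s else 0" and "g1 \<equiv> \<lambda>s. if s \<le> 1 then 0 else g s"
  shows "initial_integral g t < \<infinity>"
    and "hardy g t = hardy g0 t + hardy g1 t"
    and "t \<le> 1 \<Longrightarrow> hardy g1 t = 0"
    and "hardy g0 t \<le> 2 * hardy g0 2 / t"
proof -
  have [measurable]: "g0 \<in> borel_measurable borel" "g1 \<in> borel_measurable borel"
    unfolding g0_def g1_def by measurable
  define I0 where "I0 = (\<lambda>t. \<integral>\<^sup>+s. ennreal (g0 s) * indicator {0<..<t} s \<partial>lborel)"
  define I1 where "I1 = (\<lambda>t. \<integral>\<^sup>+s. ennreal (g1 s) * indicator {0<..<t} s \<partial>lborel)"
  have H0: "hardy g0 u = enn2real (I0 u) / u" and H1: "hardy g1 u = enn2real (I1 u) / u" for u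
    by (simp_all add: hardy_def I0_def I1_def)
  have f0: "I0 t < \<infinity>" if "t > 0" for t using fin0[OF that] by (simp add: I0_def g0_def)
  have f1: "I1 t < \<infinity>" using fin1[OF t] by (simp add: I1_def g1_def)
  have "initial_integral g t
      = (\<integral>\<^sup>+s. (ennreal (g0 s) * indicator {0<..<t} s + ennreal (g1 s) * indicator {0<..<t} s) \<partial>lborel)"
    by (intro nn_integral_cong) (auto simp: g0_def g1_def)
  also have "\<dots> = I0 t + I1 t" unfolding I0_def I1_def by (rule nn_integral_add) measurable
  finally have sum: "initial_integral g t = I0 t + I1 t" .
  then show "initial_integral g t < \<infinity>"
    using f0[OF t] f1 by (simp add: less_top[symmetric])
  show "hardy g t = hardy g0 t + hardy g1 t"
    using f0[OF t] f1 unfolding H0 H1 by (simp add: hardy_def sum enn2real_plus add_divide_distrib)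
  show "hardy g1 t = 0" if "t \<le> 1"
  proof -
    have "I1 t = (\<integral>\<^sup>+s. 0 \<partial>(lborel :: real measure))"
      unfolding I1_def using that by (intro nn_integral_cong) (auto simp: g1_def indicator_def)
    then show ?thesis by (simp add: hardy_def I1_def)
  qed
  have "I0 t \<le> I0 2"
    unfolding I0_def by (intro nn_integral_mono) (auto simp: g0_def indicator_def)
  then have "enn2real (I0 t) \<le> enn2real (I0 2)" using f0[of 2] by (intro enn2real_mono) auto
  then show "hardy g0 t \<le> 2 * hardy g0 2 / t"
    using t unfolding H0 by (simp add: divide_right_mono)
qed

lemma le_powr_inverse:
  fixes x a q :: real
  assumes "x powr q \<le> a" "0 \<le> x" "0 < q"
  shows "x \<le> a powr (1 / q)"
proof -
  have "(x powr q) powr (1 / q) \<le> a powr (1 / q)" using assms by (intro powr_mono2) auto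
  then show ?thesis using assms by (simp add: powr_powr)
qed

lemma powr_add_le:
  fixes x y q :: real
  assumes "0 \<le> x" "0 \<le> y" "0 \<le> q"
  shows "(x + y) powr q \<le> 2 powr q * (x powr q + y powr q)"
proof -
  have "(x + y) powr q \<le> (2 * max x y) powr q" using assms by (intro powr_mono2) auto
  also have "\<dots> = 2 powr q * max x y powr q" using assms by (simp add: powr_mult)
  also have "max x y powr q \<le> x powr q + y powr q" by (simp add: max_def)
  finally show ?thesis by simp
qed

text \<open>
  The exponents at the two ends are unrelated, so the parts of \<open>g\<close> on \<open>(0, 1]\<close> and on
  \<open>(1, \<infinity>)\<close> are treated by the inequality for their own exponent. The one interaction is the
  term \<open>K0 / t\<close> that the first part leaves on \<open>(1, \<infinity>)\<close>. It belongs to the weighted space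
  there because \<open>b1 < 1 - 1/q1\<close> means that \<open>(b1 - 1) q1 < -1\<close>.
\<close>

lemma hardy_inequality_two_ended:
  fixes q0 q1 b0 b1 N :: real
  assumes q0: "1 < q0" and q1: "1 < q1" and b0: "b0 < 1 - 1 / q0" and b1: "b1 < 1 - 1 / q1"
    and b1': "-1 - 1 / q1 \<le> b1" and N: "0 \<le> N"
  defines "w \<equiv> \<lambda>t. t powr two_ended b0 b1 t"
  obtains C where "0 \<le> C"
    "\<And>g. \<lbrakk>g \<in> borel_measurable borel; \<And>s. 0 \<le> g s;
        half_line_integral lborel (\<lambda>t. (w t * g t) powr two_ended q0 q1 t) \<le> ennreal N\<rbrakk> \<Longrightarrow>
      (\<forall>t>0. initial_integral g t < \<infinity> \<and> hardy g t \<le> C * exp \<bar>ln t\<bar>) \<and>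
      half_line_integral lborel (\<lambda>t. (w t * hardy g t) powr two_ended q0 q1 t) \<le> ennreal C"
proof -
  obtain C0 where C0: "0 \<le> C0"
    "\<And>g. \<lbrakk>g \<in> borel_measurable borel; \<And>s. 0 \<le> g s; 0 \<le> N;
        half_line_integral lborel (\<lambda>t. t powr (b0 * q0) * g t powr q0) \<le> ennreal N\<rbrakk> \<Longrightarrow>
      (\<forall>t>0. initial_integral g t < \<infinity> \<and>
            hardy g t powr q0 \<le> C0 * N * t powr (- 1 - b0 * q0)) \<and>
      half_line_integral lborel (\<lambda>t. t powr (b0 * q0) * hardy g t powr q0) \<le> ennreal (C0 * N)"
    by (rule hardy_inequality_power_weight[OF q0 b0]) blast
  obtain C1 where C1: "0 \<le> C1"
    "\<And>g. \<lbrakk>g \<in> borel_measurable borel; \<And>s. 0 \<le> g s; 0 \<le> N;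
        half_line_integral lborel (\<lambda>t. t powr (b1 * q1) * g t powr q1) \<le> ennreal N\<rbrakk> \<Longrightarrow>
      (\<forall>t>0. initial_integral g t < \<infinity> \<and>
            hardy g t powr q1 \<le> C1 * N * t powr (- 1 - b1 * q1)) \<and>
      half_line_integral lborel (\<lambda>t. t powr (b1 * q1) * hardy g t powr q1) \<le> ennreal (C1 * N)"
    by (rule hardy_inequality_power_weight[OF q1 b1]) blast
  (* K0 bounds the integral of the first part, read off from its average at t = 2, beyond its
     support (0, 1]; K1 t bounds the average of the second part. *)
  define K0 where "K0 = 2 * (C0 * N * 2 powr (- 1 - b0 * q0)) powr (1 / q0)"
  define K1 where "K1 = (C1 * N) powr (1 / q1)"
  have K: "K0 \<ge> 0" "K1 \<ge> 0" by (auto simp: K0_def K1_def)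
  define d where "d = - ((b1 - 1) * q1) - 1"
  have "(b1 - 1) * q1 < (- 1 / q1) * q1" using b1 q1 by (intro mult_strict_right_mono) auto
  then have d: "d > 0" using q1 by (simp add: d_def)
  define C where "C = K0 + K1 + (C0 * N + 2 powr q1 * (K0 powr q1 / d + C1 * N))"
  have Cnn: "0 \<le> C0 * N + 2 powr q1 * (K0 powr q1 / d + C1 * N)" using C0 C1 N d by simp
  have *: "(\<forall>t>0. initial_integral g t < \<infinity> \<and> hardy g t \<le> C * exp \<bar>ln t\<bar>) \<and>
      half_line_integral lborel (\<lambda>t. (w t * hardy g t) powr two_ended q0 q1 t) \<le> ennreal C"
    if g[measurable]: "g \<in> borel_measurable borel" and gn: "\<And>s. 0 \<le> g s"
      and hyp: "half_line_integral lborel (\<lambda>t. (w t * g t) powr two_ended q0 q1 t) \<le> ennreal N" for g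
  proof -
    define g0 where "g0 = (\<lambda>s. if s \<le> 1 then g s else 0)"
    define g1 where "g1 = (\<lambda>s. if s \<le> 1 then 0 else g s)"
    have [measurable]: "g0 \<in> borel_measurable borel" "g1 \<in> borel_measurable borel"
      unfolding g0_def g1_def by measurable
    have gn': "0 \<le> g0 s" "0 \<le> g1 s" for s using gn by (auto simp: g0_def g1_def)
    have "half_line_integral lborel (\<lambda>t. t powr (b0 * q0) * g0 t powr q0) \<le> ennreal N"
    proof (rule order_trans[OF nn_integral_mono hyp])
      fix t :: real
      show "ennreal (t powr (b0 * q0) * g0 t powr q0) * indicator {0<..} t \<le> ennreal ((w t * g t) powr two_ended q0 q1 t) * indicator {0<..} t"
        using q0 gn[of t] by (cases "t \<le> 1") (auto simp: g0_def w_def two_ended_def powr_mult powr_powr indicator_def)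
    qed
    note H0 = C0(2)[OF _ gn'(1) N this, simplified]
    have "half_line_integral lborel (\<lambda>t. t powr (b1 * q1) * g1 t powr q1) \<le> ennreal N"
    proof (rule order_trans[OF nn_integral_mono hyp])
      fix t :: real
      show "ennreal (t powr (b1 * q1) * g1 t powr q1) * indicator {0<..} t \<le> ennreal ((w t * g t) powr two_ended q0 q1 t) * indicator {0<..} t"
        using q1 gn[of t] by (cases "t \<le> 1") (auto simp: g1_def w_def two_ended_def powr_mult powr_powr indicator_def)
    qed
    note H1 = C1(2)[OF _ gn'(2) N this, simplified]
    have fin0: "initial_integral (\<lambda>s. if s \<le> 1 then g s else 0) t < \<infinity>" if "0 < t" for t
      using H0 that by (simp add: g0_def)
    have fin1: "initial_integral (\<lambda>s. if s \<le> 1 then 0 else g s) t < \<infinity>" if "0 < t" for t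
      using H1 that by (simp add: g1_def)
    note split = hardy_split[OF g _ fin0 fin1, folded g0_def g1_def]
    have h0: "2 * hardy g0 2 \<le> K0"
      unfolding K0_def using H0 q0 by (intro mult_left_mono le_powr_inverse) (auto simp: hardy_nonneg)
    have h0t: "hardy g0 t \<le> K0 / t" if "t > 0" for t
      using split(4)[OF that] h0 that by (meson divide_right_mono less_imp_le order_trans)
    have h1: "hardy g1 t \<le> K1 * t" if t: "1 < t" for t
    proof -
      have "hardy g1 t \<le> (C1 * N * t powr (- 1 - b1 * q1)) powr (1 / q1)"
        using H1 q1 t by (intro le_powr_inverse) (auto simp: hardy_nonneg)
      also have "\<dots> = K1 * t powr ((- 1 - b1 * q1) / q1)" using C1 N by (simp add: K1_def powr_mult powr_powr)
      also have "t powr ((- 1 - b1 * q1) / q1) \<le> t powr 1"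
        using t q1 b1' by (intro powr_mono) (auto simp: field_simps)
      finally show ?thesis using t K by (simp add: mult_left_mono)
    qed
    have pt: "initial_integral g t < \<infinity> \<and> hardy g t \<le> C * exp \<bar>ln t\<bar>" if t: "0 < t" for t
    proof (intro conjI)
      show "initial_integral g t < \<infinity>" by (rule split(1)[OF t])
      have "hardy g t \<le> (K0 + K1) * exp \<bar>ln t\<bar>"
      proof (cases "t \<le> 1")
        case True
        have e: "exp \<bar>ln t\<bar> = 1 / t" using True t by (simp add: exp_minus divide_inverse)
        have "hardy g t \<le> K0 / t" using split(2,3)[OF t] h0t[OF t] True by simp
        also have "\<dots> \<le> (K0 + K1) * (1 / t)" using K t by (simp add: divide_right_mono)
        finally show ?thesis by (simp only: e)
      next
        case False
        have e: "exp \<bar>ln t\<bar> = t" using False t by simp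
        have "K0 / t \<le> K0 / 1" using False K by (intro divide_left_mono) auto
        also have "K0 / 1 \<le> K0 * t" using False K mult_left_mono[of 1 t K0] by simp
        finally have "K0 / t \<le> K0 * t" .
        then have "hardy g t \<le> K0 * t + K1 * t"
          using split(2)[OF t] h0t[OF t] h1[of t] False by simp
        then show ?thesis by (simp only: e distrib_right)
      qed
      also have "\<dots> \<le> C * exp \<bar>ln t\<bar>" using Cnn by (intro mult_right_mono) (auto simp: C_def)
      finally show "hardy g t \<le> C * exp \<bar>ln t\<bar>" .
    qed
    have "half_line_integral lborel (\<lambda>t. (w t * hardy g t) powr two_ended q0 q1 t)
       \<le> (\<integral>\<^sup>+t. (ennreal (t powr (b0 * q0) * hardy g0 t powr q0) * indicator {0<..} t
             + ennreal (2 powr q1) * (ennreal (K0 powr q1) * (ennreal (t powr ((b1 - 1) * q1)) * indicator {1<..} t)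
               + ennreal (t powr (b1 * q1) * hardy g1 t powr q1) * indicator {0<..} t)) \<partial>lborel)"
      (is "integral\<^sup>N _ ?f \<le> integral\<^sup>N _ ?g")
    proof (rule nn_integral_mono)
      fix t :: real
      show "?f t \<le> ?g t"
      proof (cases "0 < t")
        case t: True
        show ?thesis
        proof (cases "t \<le> 1")
          case True
          have "(w t * hardy g t) powr two_ended q0 q1 t = t powr (b0 * q0) * hardy g0 t powr q0"
            using split(2,3)[OF t] True t hardy_nonneg[of t g0] by (simp add: w_def two_ended_def powr_mult powr_powr)
          then show ?thesis using t by (simp add: add_increasing2)
        next
          case False
          have "w t * hardy g t \<le> t powr (b1 - 1) * K0 + t powr b1 * hardy g1 t"
          proof -
            have "w t * hardy g t \<le> t powr b1 * (K0 / t + hardy g1 t)"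
              using False split(2)[OF t] h0t[OF t] by (simp add: w_def two_ended_def mult_left_mono)
            also have "\<dots> = t powr (b1 - 1) * K0 + t powr b1 * hardy g1 t"
              using t by (simp add: powr_diff distrib_left)
            finally show ?thesis .
          qed
          then have "(w t * hardy g t) powr q1 \<le> (t powr (b1 - 1) * K0 + t powr b1 * hardy g1 t) powr q1"
            using q1 t by (intro powr_mono2) (auto simp: w_def hardy_nonneg)
          also have "\<dots> \<le> 2 powr q1 * ((t powr (b1 - 1) * K0) powr q1 + (t powr b1 * hardy g1 t) powr q1)"
            using q1 t K by (intro powr_add_le) (auto simp: hardy_nonneg)
          also have "(t powr (b1 - 1) * K0) powr q1 = K0 powr q1 * t powr ((b1 - 1) * q1)"
            using K by (simp add: powr_mult powr_powr)
          also have "(t powr b1 * hardy g1 t) powr q1 = t powr (b1 * q1) * hardy g1 t powr q1"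
            using t hardy_nonneg[of t g1] by (simp add: powr_mult powr_powr)
          finally have "ennreal ((w t * hardy g t) powr q1) \<le> ennreal (2 powr q1 * (K0 powr q1 * t powr ((b1 - 1) * q1) + t powr (b1 * q1) * hardy g1 t powr q1))"
            by (rule ennreal_leI)
          also have "\<dots> = ennreal (2 powr q1) * (ennreal (K0 powr q1) * ennreal (t powr ((b1 - 1) * q1)) + ennreal (t powr (b1 * q1) * hardy g1 t powr q1))"
            by (simp add: ennreal_mult)
          finally show ?thesis using t False by (simp add: two_ended_def add_increasing)
        qed
      qed simp
    qed
    also have "\<dots> = half_line_integral lborel (\<lambda>t. t powr (b0 * q0) * hardy g0 t powr q0)
       + ennreal (2 powr q1) * (ennreal (K0 powr q1) * (\<integral>\<^sup>+t. ennreal (t powr ((b1 - 1) * q1)) * indicator {1<..} t \<partial>lborel)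
         + half_line_integral lborel (\<lambda>t. t powr (b1 * q1) * hardy g1 t powr q1))"
      by (subst nn_integral_add, measurable, subst nn_integral_cmult, measurable, subst nn_integral_add, measurable,
          subst nn_integral_cmult, measurable)
    also have "\<dots> \<le> ennreal (C0 * N) + ennreal (2 powr q1) * (ennreal (K0 powr q1) * ennreal (1 / d) + ennreal (C1 * N))"
    proof -
      have "(\<integral>\<^sup>+t. ennreal (t powr ((b1 - 1) * q1)) * indicator {1<..} t \<partial>lborel) = ennreal (1 / d)"
        using d by (subst nn_integral_powr_to_inf) (auto simp: d_def)
      then show ?thesis using H0 H1 by (intro add_mono mult_left_mono) auto
    qed
    also have "\<dots> = ennreal (C0 * N + 2 powr q1 * (K0 powr q1 / d + C1 * N))"
      using C0 C1 N d by (simp add: ennreal_mult[symmetric] ennreal_plus[symmetric] del: ennreal_plus)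
    also have "\<dots> \<le> ennreal C" using K by (intro ennreal_leI) (auto simp: C_def)
    finally show ?thesis using pt by blast
  qed
  have C: "0 \<le> C" using K Cnn by (simp add: C_def)
  show ?thesis by (rule that[OF C]) (rule *)
qed

section \<open>The Hardy inequality with variable exponents\<close>

lemma powr_exp_ln_bounds:
  fixes t b :: real
  assumes t: "0 < t" and b: "\<bar>b\<bar> \<le> 1"
  shows "t powr b \<le> exp \<bar>ln t\<bar>" and "exp (- \<bar>ln t\<bar>) \<le> t powr b"
proof -
  have "\<bar>b * ln t\<bar> \<le> 1 * \<bar>ln t\<bar>" unfolding abs_mult using b by (intro mult_right_mono) auto
  then have "b * ln t \<le> \<bar>ln t\<bar>" "- \<bar>ln t\<bar> \<le> b * ln t" by (auto simp: abs_le_iff)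
  then show "t powr b \<le> exp \<bar>ln t\<bar>" "exp (- \<bar>ln t\<bar>) \<le> t powr b"
    using t by (auto simp: powr_def)
qed

text \<open>
  The logarithmic decay conditions at both ends in one formula: \<open>1 + |ln t|\<close> is comparable to \<open>|ln t|\<close>
  near the ends and to \<open>1\<close> in between.
\<close>

abbreviation log_close :: "real \<Rightarrow> real \<Rightarrow> real \<Rightarrow> real \<Rightarrow> bool" where
  "log_close A t x y \<equiv> \<bar>x - y\<bar> * (1 + \<bar>ln t\<bar>) \<le> A"

text \<open>
  An exponent that deviates by \<open>O(1 / (1 + |ln t|))\<close> changes a power of \<open>t\<close> by a bounded factor only.
\<close>

lemma powr_weight_comparison:
  fixes t \<beta> b A :: real
  assumes t: "0 < t" and A: "log_close A t \<beta> b"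
  shows "t powr \<beta> \<le> exp A * t powr b" and "t powr b \<le> exp A * t powr \<beta>"
proof -
  have "\<bar>(\<beta> - b) * ln t\<bar> \<le> \<bar>\<beta> - b\<bar> * (1 + \<bar>ln t\<bar>)" by (simp add: abs_mult distrib_left)
  then have "\<bar>(\<beta> - b) * ln t\<bar> \<le> A" using A by linarith
  then have le: "\<beta> * ln t \<le> A + b * ln t" "b * ln t \<le> A + \<beta> * ln t" by (auto simp: abs_le_iff algebra_simps)
  show "t powr \<beta> \<le> exp A * t powr b" "t powr b \<le> exp A * t powr \<beta>"
    using t le by (auto simp: powr_def simp flip: exp_add)
qed

lemma exp_absorb_constant:
  fixes K :: real
  assumes "0 < K" "0 \<le> m"
  shows "K * exp (m * \<bar>ln t\<bar>) \<le> exp ((m + \<bar>ln K\<bar>) * (1 + \<bar>ln t\<bar>))"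
proof -
  have "ln K + m * \<bar>ln t\<bar> \<le> (m + \<bar>ln K\<bar>) * (1 + \<bar>ln t\<bar>)"
  proof -
    have "(m + \<bar>ln K\<bar>) * (1 + \<bar>ln t\<bar>) = m + \<bar>ln K\<bar> + m * \<bar>ln t\<bar> + \<bar>ln K\<bar> * \<bar>ln t\<bar>" by (simp add: algebra_simps)
    moreover have "0 \<le> \<bar>ln K\<bar> * \<bar>ln t\<bar>" by simp
    ultimately show ?thesis using assms(2) by linarith
  qed
  then have "exp (ln K + m * \<bar>ln t\<bar>) \<le> exp ((m + \<bar>ln K\<bar>) * (1 + \<bar>ln t\<bar>))" by simp
  then show ?thesis using assms by (simp add: exp_add)
qed

text \<open>
  On \<open>(t/2, t)\<close> the weighted function is at least a constant \<open>X\<close>, which differs from \<open>G t\<close> only by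
  a factor polynomial in \<open>exp |ln t|\<close>, by monotonicity. If \<open>X > 1\<close> then \<open>X \<le> X powr q\<close>, hence \<open>X t / 2 \<le> 1\<close>. This is the step
  that uses that rearrangements are nonincreasing; a general function with bounded modular can have
  arbitrarily high peaks.
\<close>

lemma antimono_modular_growth:
  fixes q \<beta> G :: "real \<Rightarrow> real" and A b0 b1 t :: real
  assumes ae: "AE t in lebesgue. 0 < t \<longrightarrow> 1 \<le> q t \<and> log_close A t (\<beta> t) (two_ended b0 b1 t)"
    and b: "\<bar>b0\<bar> \<le> 1" "\<bar>b1\<bar> \<le> 1"
    and G: "\<And>s. 0 \<le> G s" "\<And>s t. 0 < s \<Longrightarrow> s \<le> t \<Longrightarrow> G t \<le> G s"
    and hyp: "half_line_integral lebesgue (\<lambda>t. (t powr \<beta> t * G t) powr q t) \<le> 1"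
    and t: "0 < t"
  shows "t powr two_ended b0 b1 t * G t \<le> 4 * exp A * exp (3 * \<bar>ln t\<bar>)"
proof -
  have bb: "\<bar>two_ended b0 b1 s\<bar> \<le> 1" for s using b by (simp add: two_ended_def)
  (* On (t/2, t) the weight is at least exp (- (|ln t| + ln 2)), up to the factor exp (- A) lost in
     comparing the variable weight with its limit. *)
  define X where "X = G t * exp (- (\<bar>ln t\<bar> + ln 2)) * exp (- A)"
  have X0: "X \<ge> 0" using G by (simp add: X_def)
  have e1: "1 / t \<le> exp \<bar>ln t\<bar>"
    using powr_exp_ln_bounds(1)[OF t, of "-1"] t by (simp add: powr_minus divide_inverse)
  have "X \<le> 2 * exp \<bar>ln t\<bar>"
  proof (cases "X \<le> 1")
    case True
    then show ?thesis by (smt (verit) one_le_exp_iff abs_ge_zero)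
  next
    case False
    have "ennreal (X * (t / 2)) = ennreal X * ennreal (t / 2)"
      by (rule ennreal_mult) (use X0 t in auto)
    also have "\<dots> = (\<integral>\<^sup>+s. ennreal X * indicator {t/2<..<t} s \<partial>lebesgue)"
      using t by (subst nn_integral_cmult_indicator) auto
    also have "\<dots> \<le> half_line_integral lebesgue (\<lambda>t. (t powr \<beta> t * G t) powr q t)"
      (is "integral\<^sup>N _ ?f \<le> integral\<^sup>N _ ?g")
    proof (rule nn_integral_mono_AE)
      show "AE s in lebesgue. ?f s \<le> ?g s"
        using ae
      proof eventually_elim
        case (elim s)
        show ?case
        proof (cases "t / 2 < s \<and> s < t")
          case True
          then have s: "0 < s" "s \<le> t" using t by auto
          have "ln (t / 2) \<le> ln s" using True t s by (subst ln_le_cancel_iff) auto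
          then have "ln t - ln 2 \<le> ln s" using t by (simp add: ln_div)
          moreover have "ln s \<le> ln t" using s by simp
          moreover have "0 \<le> ln (2::real)" by simp
          ultimately have "\<bar>ln s\<bar> \<le> \<bar>ln t\<bar> + ln 2" by linarith
          then have "exp (- (\<bar>ln t\<bar> + ln 2)) \<le> exp (- \<bar>ln s\<bar>)" by simp
          also have "\<dots> \<le> s powr two_ended b0 b1 s" by (rule powr_exp_ln_bounds(2)[OF s(1) bb])
          also have "\<dots> \<le> exp A * s powr \<beta> s" using elim s by (intro powr_weight_comparison(2)) auto
          finally have "exp (- (\<bar>ln t\<bar> + ln 2)) * exp (- A) \<le> exp A * s powr \<beta> s * exp (- A)"
            by (rule mult_right_mono) simp
          also have "\<dots> = s powr \<beta> s" by (simp add: exp_minus)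
          finally have "G t * (exp (- (\<bar>ln t\<bar> + ln 2)) * exp (- A)) \<le> G s * s powr \<beta> s"
            using G s by (intro mult_mono) auto
          then have Xs: "X \<le> s powr \<beta> s * G s" by (simp add: X_def mult_ac)
          have "X = X powr 1" using X0 by simp
          also have "\<dots> \<le> X powr q s" using False elim s by (intro powr_mono) auto
          also have "\<dots> \<le> (s powr \<beta> s * G s) powr q s" using Xs X0 elim s by (intro powr_mono2) auto
          finally show ?thesis using True s by (simp add: ennreal_leI)
        qed simp
      qed
    qed
    also have "\<dots> \<le> 1" by (rule hyp)
    finally have "X * (t / 2) \<le> 1" by simp
    then have "X \<le> 2 * (1 / t)" using t by (simp add: field_simps)
    then show ?thesis using e1 by linarith
  qed
  then have "X * (exp (\<bar>ln t\<bar> + ln 2) * exp A) \<le> 2 * exp \<bar>ln t\<bar> * (exp (\<bar>ln t\<bar> + ln 2) * exp A)"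
    by (rule mult_right_mono) simp
  moreover have "X * (exp (\<bar>ln t\<bar> + ln 2) * exp A) = G t"
  proof -
    have "X * (exp (\<bar>ln t\<bar> + ln 2) * exp A) = G t * (exp (- (\<bar>ln t\<bar> + ln 2)) * exp (\<bar>ln t\<bar> + ln 2)) * (exp (- A) * exp A)"
      by (simp only: X_def mult_ac)
    also have "\<dots> = G t" by (simp only: exp_add[symmetric]) simp
    finally show ?thesis .
  qed
  moreover have "2 * exp \<bar>ln t\<bar> * (exp (\<bar>ln t\<bar> + ln 2) * exp A) = 4 * exp A * exp (2 * \<bar>ln t\<bar>)"
  proof -
    have "exp (2 * \<bar>ln t\<bar>) = exp \<bar>ln t\<bar> * exp \<bar>ln t\<bar>" by (simp flip: exp_add)
    then show ?thesis by (simp only: exp_add) simp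
  qed
  ultimately have Gt: "G t \<le> 4 * exp A * exp (2 * \<bar>ln t\<bar>)" by simp
  have "t powr two_ended b0 b1 t * G t \<le> exp \<bar>ln t\<bar> * (4 * exp A * exp (2 * \<bar>ln t\<bar>))"
    using G by (intro mult_mono Gt powr_exp_ln_bounds(1)[OF t bb]) auto
  also have "\<dots> = 4 * exp A * (exp \<bar>ln t\<bar> * exp (2 * \<bar>ln t\<bar>))" by (simp only: mult_ac)
  also have "exp \<bar>ln t\<bar> * exp (2 * \<bar>ln t\<bar>) = exp (3 * \<bar>ln t\<bar>)" by (simp flip: exp_add)
  finally show ?thesis .
qed

text \<open>
  Pass from the variable exponents to the limiting ones, apply the inequality for these, and
  pass back. Both passages need an upper bound of the form \<open>exp (B (1 + |ln t|))\<close> for the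
  function in question: for \<open>G\<close> it comes from monotonicity, for its average from the
  constant exponent inequality.
\<close>

lemma hardy_inequality_variable_exponent:
  fixes q \<beta> :: "real \<Rightarrow> real" and A M q0 q1 b0 b1 :: real
  assumes q: "q \<in> borel_measurable lebesgue" and \<beta>: "\<beta> \<in> borel_measurable lebesgue"
    and ae: "AE t in lebesgue. 0 < t \<longrightarrow> 1 \<le> q t \<and> q t \<le> M \<and> log_close A t (q t) (two_ended q0 q1 t)
            \<and> log_close A t (\<beta> t) (two_ended b0 b1 t)"
    and A: "0 \<le> A" and q0: "1 < q0" and q1: "1 < q1"
    and b0: "b0 < 1 - 1 / q0" "-1 \<le> b0" and b1: "b1 < 1 - 1 / q1" "-1 \<le> b1"
  obtains C where "0 \<le> C"
    "\<And>G. \<lbrakk>G \<in> borel_measurable borel; \<And>s. 0 \<le> G s; antimono_on {0<..} G;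
        half_line_integral lebesgue (\<lambda>t. (t powr \<beta> t * G t) powr q t) \<le> 1\<rbrakk> \<Longrightarrow>
      (\<forall>t>0. initial_integral G t < \<infinity>) \<and>
      half_line_integral lebesgue (\<lambda>t. (t powr \<beta> t * hardy G t) powr q t) \<le> ennreal C"
proof -
  define w where "w = (\<lambda>t. t powr two_ended b0 b1 t)"
  define qq where "qq = two_ended q0 q1"
  define L where "L = (\<lambda>t::real. 1 + \<bar>ln t\<bar>)"
  have [measurable]: "w \<in> borel_measurable borel" "qq \<in> borel_measurable borel" "L \<in> borel_measurable borel"
    unfolding w_def qq_def L_def by measurable
  have qq1: "1 \<le> qq t" for t using q0 q1 by (simp add: qq_def two_ended_def)
  have L1: "1 \<le> L t" for t by (simp add: L_def)
  have w0: "0 \<le> w t" for t by (simp add: w_def)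
  have "0 < 1 / q0" "0 < 1 / q1" using q0 q1 by auto
  then have "b0 \<le> 1" "b1 \<le> 1" and bb3: "-1 - 1 / q1 \<le> b1" using b0 b1 by linarith+
  then have bb: "\<bar>b0\<bar> \<le> 1" "\<bar>b1\<bar> \<le> 1" using b0 b1 by (auto simp: abs_le_iff)
  have bt: "\<bar>two_ended b0 b1 t\<bar> \<le> 1" for t using bb by (simp add: two_ended_def)
  have idm: "(\<lambda>t::real. t) \<in> borel_measurable lebesgue" by (simp add: measurable_completion)
  have decay_m: "(\<lambda>t. ennreal (exp (- 2 * L t)) * indicator {0<..} t) \<in> borel_measurable lebesgue"
    by (intro measurable_completion) measurable
  define c where "c = exp A"
  have c: "1 \<le> c" using A by (simp add: c_def)
  have decay: "half_line_integral lebesgue (\<lambda>t. exp (- 2 * L t)) \<le> ennreal 2"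
    using nn_integral_exp_ln_decay by (simp add: nn_integral_completion L_def)
  define B where "B = 3 + \<bar>ln (4 * c)\<bar>"
  define N where "N = exp (A * B) * c powr M + 2"
  have N: "0 \<le> N" by (simp add: N_def)
  obtain C1 where C1: "0 \<le> C1"
    "\<And>g. \<lbrakk>g \<in> borel_measurable borel; \<And>s. 0 \<le> g s;
        half_line_integral lborel (\<lambda>t. (t powr two_ended b0 b1 t * g t) powr two_ended q0 q1 t) \<le> ennreal N\<rbrakk> \<Longrightarrow>
      (\<forall>t>0. initial_integral g t < \<infinity> \<and> hardy g t \<le> C1 * exp \<bar>ln t\<bar>) \<and>
      half_line_integral lborel (\<lambda>t. (t powr two_ended b0 b1 t * hardy g t) powr two_ended q0 q1 t) \<le> ennreal C1"
    by (rule hardy_inequality_two_ended[OF q0 q1 b0(1) b1(1) bb3 N]) blast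
  define B2 where "B2 = 2 + \<bar>ln (C1 + 1)\<bar>"
  define C where "C = c powr M * (exp (A * B2) * C1 + 2)"
  have C: "0 \<le> C" using C1 by (simp add: C_def)
  have *: "(\<forall>t>0. initial_integral G t < \<infinity>) \<and>
      half_line_integral lebesgue (\<lambda>t. (t powr \<beta> t * hardy G t) powr q t) \<le> ennreal C"
    if Gm[measurable]: "G \<in> borel_measurable borel" and G0: "\<And>s. 0 \<le> G s"
      and G: "antimono_on {0<..} G"
      and hyp: "half_line_integral lebesgue (\<lambda>t. (t powr \<beta> t * G t) powr q t) \<le> 1" for G
  proof -
    have Ganti: "G t \<le> G s" if "0 < s" "s \<le> t" for s t
      using monotone_onD[OF G, of s t] that by simp
    have Gl: "G \<in> borel_measurable lebesgue" using Gm by (simp add: measurable_completion)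
    have growth: "w t * G t \<le> exp (B * L t)" if t: "0 < t" for t
    proof -
      have "AE t in lebesgue. 0 < t \<longrightarrow> 1 \<le> q t \<and> log_close A t (\<beta> t) (two_ended b0 b1 t)"
        using ae by eventually_elim blast
      then have "w t * G t \<le> 4 * exp A * exp (3 * \<bar>ln t\<bar>)"
        unfolding w_def using bb(1,2) G0 Ganti hyp t by (rule antimono_modular_growth)
      also have "\<dots> \<le> exp (B * L t)"
        unfolding B_def L_def c_def by (rule exp_absorb_constant) auto
      finally show ?thesis .
    qed
    have "half_line_integral lebesgue (\<lambda>t. (w t * G t) powr qq t)
       \<le> (\<integral>\<^sup>+t. (ennreal (exp (A * B) * c powr M) * (ennreal ((t powr \<beta> t * G t) powr q t) * indicator {0<..} t)
             + ennreal (exp (- 2 * L t)) * indicator {0<..} t) \<partial>lebesgue)"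
      (is "integral\<^sup>N _ ?f \<le> integral\<^sup>N _ ?g")
    proof (rule nn_integral_mono_AE)
      show "AE t in lebesgue. ?f t \<le> ?g t"
        using ae
      proof eventually_elim
        case (elim t)
        show ?case
        proof (cases "0 < t")
          case t: True
          have "(w t * G t) powr qq t \<le> exp (A * B) * (w t * G t) powr q t + exp (- 2 * L t)"
          proof (rule powr_exchange_exponent)
            show "\<bar>qq t - q t\<bar> * L t \<le> A" using elim t by (simp add: qq_def L_def abs_minus_commute)
            show "2 \<le> B" by (simp add: B_def)
          qed (use growth[OF t] qq1 L1 w0 G0 in auto)
          also have "(w t * G t) powr q t \<le> c powr M * (t powr \<beta> t * G t) powr q t"
          proof -
            have "w t * G t \<le> (c * t powr \<beta> t) * G t"
              unfolding w_def c_def using elim t G0 by (intro mult_right_mono powr_weight_comparison(2)) auto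
            then have "(w t * G t) powr q t \<le> (c * (t powr \<beta> t * G t)) powr q t"
              using elim t w0 G0 by (intro powr_mono2) (auto simp: mult.assoc)
            also have "\<dots> = c powr q t * (t powr \<beta> t * G t) powr q t" using c G0 by (simp add: powr_mult)
            also have "\<dots> \<le> c powr M * (t powr \<beta> t * G t) powr q t"
              using elim t c by (intro mult_right_mono powr_mono) auto
            finally show ?thesis .
          qed
          finally have "(w t * G t) powr qq t \<le> exp (A * B) * (c powr M * (t powr \<beta> t * G t) powr q t) + exp (- 2 * L t)"
            by simp
          then have "ennreal ((w t * G t) powr qq t) \<le> ennreal (exp (A * B) * (c powr M * (t powr \<beta> t * G t) powr q t) + exp (- 2 * L t))"
            by (rule ennreal_leI)
          then show ?thesis using t by (simp add: ennreal_mult mult.assoc)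
        qed simp
      qed
    qed
    also have "\<dots> = ennreal (exp (A * B) * c powr M) * half_line_integral lebesgue (\<lambda>t. (t powr \<beta> t * G t) powr q t)
             + half_line_integral lebesgue (\<lambda>t. exp (- 2 * L t))"
    proof -
      have m: "(\<lambda>t. ennreal ((t powr \<beta> t * G t) powr q t) * indicator {0<..} t) \<in> borel_measurable lebesgue"
        by (intro borel_measurable_times_ennreal measurable_compose[OF _ measurable_ennreal] powr_real_measurable
              borel_measurable_times idm q \<beta> Gl borel_measurable_indicator) simp
      show ?thesis
        by (subst nn_integral_add[OF borel_measurable_times_ennreal[OF borel_measurable_const m] decay_m])
           (simp only: nn_integral_cmult[OF m])
    qed
    also have "\<dots> \<le> ennreal (exp (A * B) * c powr M) * 1 + ennreal 2"
      by (intro add_mono mult_left_mono hyp decay) simp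
    also have "\<dots> = ennreal N" by (simp add: N_def)
    finally have hN: "half_line_integral lborel (\<lambda>t. (t powr two_ended b0 b1 t * G t) powr two_ended q0 q1 t) \<le> ennreal N"
      by (simp add: nn_integral_completion w_def qq_def)
    note H = C1(2)[OF Gm G0 hN]
    define h where "h = hardy G"
    have [measurable]: "h \<in> borel_measurable borel" by (simp add: h_def)
    have h0: "0 \<le> h t" if "0 < t" for t using that by (simp add: h_def hardy_nonneg)
    have hint: "half_line_integral lebesgue (\<lambda>t. (w t * h t) powr qq t) \<le> ennreal C1"
      using H by (simp add: nn_integral_completion w_def qq_def h_def)
    have growth2: "w t * h t \<le> exp (B2 * L t)" if t: "0 < t" for t
    proof -
      have ht: "h t \<le> (C1 + 1) * exp \<bar>ln t\<bar>"
        using H t C1(1) unfolding h_def by (smt (verit) exp_gt_zero mult_right_mono)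
      have "w t * h t \<le> exp \<bar>ln t\<bar> * ((C1 + 1) * exp \<bar>ln t\<bar>)"
        unfolding w_def using h0[OF t] ht t bt by (intro mult_mono powr_exp_ln_bounds(1)) auto
      also have "\<dots> = (C1 + 1) * (exp \<bar>ln t\<bar> * exp \<bar>ln t\<bar>)" by (simp only: mult_ac)
      also have "exp \<bar>ln t\<bar> * exp \<bar>ln t\<bar> = exp (2 * \<bar>ln t\<bar>)" by (simp flip: exp_add)
      also have "(C1 + 1) * exp (2 * \<bar>ln t\<bar>) \<le> exp (B2 * L t)"
        unfolding B2_def L_def using C1(1) by (intro exp_absorb_constant) auto
      finally show ?thesis .
    qed
    have "half_line_integral lebesgue (\<lambda>t. (t powr \<beta> t * h t) powr q t)
       \<le> (\<integral>\<^sup>+t. ennreal (c powr M) * (ennreal (exp (A * B2)) * (ennreal ((w t * h t) powr qq t) * indicator {0<..} t)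
             + ennreal (exp (- 2 * L t)) * indicator {0<..} t) \<partial>lebesgue)"
      (is "integral\<^sup>N _ ?f \<le> integral\<^sup>N _ ?g")
    proof (rule nn_integral_mono_AE)
      show "AE t in lebesgue. ?f t \<le> ?g t"
        using ae
      proof eventually_elim
        case (elim t)
        show ?case
        proof (cases "0 < t")
          case t: True
          have "t powr \<beta> t * h t \<le> (c * w t) * h t"
            unfolding w_def c_def using elim t h0[OF t] by (intro mult_right_mono powr_weight_comparison(1)) auto
          then have "(t powr \<beta> t * h t) powr q t \<le> (c * (w t * h t)) powr q t"
            using elim t h0[OF t] by (intro powr_mono2) (auto simp: mult.assoc)
          also have "\<dots> = c powr q t * (w t * h t) powr q t" using c h0[OF t] w0 by (simp add: powr_mult)
          also have "\<dots> \<le> c powr M * (w t * h t) powr q t"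
            using elim t c by (intro mult_right_mono powr_mono) auto
          also have "\<dots> \<le> c powr M * (exp (A * B2) * (w t * h t) powr qq t + exp (- 2 * L t))"
          proof (intro mult_left_mono powr_exchange_exponent)
            show "\<bar>q t - qq t\<bar> * L t \<le> A" using elim t by (simp add: qq_def L_def)
            show "2 \<le> B2" by (simp add: B2_def)
          qed (use growth2[OF t] L1 w0 h0[OF t] elim t in auto)
          finally have "ennreal ((t powr \<beta> t * h t) powr q t) \<le> ennreal (c powr M * (exp (A * B2) * (w t * h t) powr qq t + exp (- 2 * L t)))"
            by (rule ennreal_leI)
          then show ?thesis using t by (simp add: ennreal_mult)
        qed simp
      qed
    qed
    also have "\<dots> = ennreal (c powr M) * (ennreal (exp (A * B2)) * half_line_integral lebesgue (\<lambda>t. (w t * h t) powr qq t)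
             + half_line_integral lebesgue (\<lambda>t. exp (- 2 * L t)))"
    proof -
      have m: "(\<lambda>t. ennreal ((w t * h t) powr qq t) * indicator {0<..} t) \<in> borel_measurable lebesgue"
        by (intro measurable_completion) measurable
      have m': "(\<lambda>t. ennreal (exp (A * B2)) * (ennreal ((w t * h t) powr qq t) * indicator {0<..} t)
             + ennreal (exp (- 2 * L t)) * indicator {0<..} t) \<in> borel_measurable lebesgue"
        by (intro measurable_completion) measurable
      show ?thesis
        by (subst nn_integral_cmult[OF m'],
            subst nn_integral_add[OF borel_measurable_times_ennreal[OF borel_measurable_const m] decay_m])
           (simp only: nn_integral_cmult[OF m])
    qed
    also have "\<dots> \<le> ennreal (c powr M) * (ennreal (exp (A * B2)) * ennreal C1 + ennreal 2)"
      by (intro add_mono mult_left_mono hint decay) simp_all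
    also have "\<dots> = ennreal C" using C1(1) by (simp add: C_def ennreal_mult)
    finally show ?thesis using H by (simp add: h_def)
  qed
  show ?thesis by (rule that[OF C]) (rule *)
qed

section \<open>Limits of the exponents\<close>

text \<open>
  Strict inequality for the essential infimum leaves room for a constant \<open>c > 1\<close>, so that the limits
  of the exponent stay strictly above one.
\<close>

lemma ess_inf_AE_gt:
  assumes "1 < ess_inf p"
  obtains c where "1 < c" "AE t in lebesgue. 0 < t \<longrightarrow> c \<le> p t"
proof -
  obtain z :: ereal where z: "1 < z" "z < ess_inf p" using assms dense by blast
  then obtain c where c: "z = ereal c" by (cases z) auto
  have "AE t in lebesgue_on {0<..}. - ereal (p t) \<le> esssup (lebesgue_on {0<..}) (\<lambda>t. - ereal (p t))"
    by (rule esssup_AE)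
  then have "AE t in lebesgue_on {0<..}. c \<le> p t"
  proof eventually_elim
    case (elim t)
    then have "ess_inf p \<le> ereal (p t)" by (simp add: ess_inf_def ereal_uminus_le_reorder)
    then show ?case using z c by (metis ereal_less_eq(3) less_imp_le order_trans)
  qed
  then have "AE t in lebesgue. 0 < t \<longrightarrow> c \<le> p t"
    by (subst (asm) AE_restrict_space_iff) auto
  moreover have "1 < c" using z(1) c by (simp add: one_ereal_def)
  ultimately show ?thesis using that by blast
qed

lemma AE_lower_bound_limit:
  fixes p :: "real \<Rightarrow> real"
  assumes ae: "AE t in lebesgue. 0 < t \<longrightarrow> c \<le> p t" and lim: "(p \<longlongrightarrow> l) F"
    and F: "\<And>P. eventually P F \<Longrightarrow> \<exists>a b. 0 \<le> a \<and> a < b \<and> (\<forall>t\<in>{a<..<b}. P t)"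
  shows "c \<le> l"
proof (rule ccontr)
  assume "\<not> c \<le> l"
  then have "eventually (\<lambda>t. p t < c) F" using lim by (auto simp: order_tendsto_iff)
  then obtain a b where ab: "0 \<le> a" "a < b" "\<forall>t\<in>{a<..<b}. p t < c" using F by blast
  have "AE t in lebesgue. t \<notin> {a<..<b}" using ae by eventually_elim (use ab in force)
  then have "{a<..<b} \<in> null_sets lebesgue" by (subst AE_iff_null_sets) auto
  then have "emeasure lebesgue {a<..<b} = 0" by (rule null_setsD1)
  then show False using ab by simp
qed

lemma two_ended_log_decay:
  assumes z: "log_decay_at_zero p a" and i: "log_decay_at_infinity p c" and M: "\<And>t. 0 < t \<Longrightarrow> \<bar>p t\<bar> \<le> M"
  obtains A where "0 \<le> A" "\<And>t. 0 < t \<Longrightarrow> log_close A t (p t) (two_ended a c t)"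
proof -
  obtain A0 where A0: "A0 > 0" "\<And>t. 0 < t \<Longrightarrow> t \<le> 1/2 \<Longrightarrow> \<bar>p t - a\<bar> \<le> A0 / \<bar>ln t\<bar>"
    using z unfolding log_decay_at_zero_def by blast
  obtain A1 where A1: "A1 > 0" "\<And>t. 2 \<le> t \<Longrightarrow> \<bar>p t - c\<bar> \<le> A1 / ln t"
    using i unfolding log_decay_at_infinity_def by blast
  have l2: "0 < ln (2::real)" "ln (2::real) \<le> 1" using ln_le_minus_one[of "2::real"] by auto
  define K where "K = 1 / ln 2 + (1::real)"
  have K: "0 < K" using l2 by (simp add: K_def add_pos_pos)
  define A where "A = A0 * K + A1 * K + (M + \<bar>a\<bar> + \<bar>c\<bar>) * 2"
  have M0: "0 \<le> M" using M[of 1] by auto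
  have far: "x * (1 + u) \<le> B * K" if "x \<le> B / u" "ln 2 \<le> u" "0 < B" for x u B :: real
  proof -
    have u: "0 < u" using that l2 by linarith
    have "x * (1 + u) \<le> B / u * (1 + u)" using that u by (intro mult_right_mono) auto
    also have "\<dots> = B * (1 / u + 1)" using u by (simp add: field_simps)
    also have "\<dots> \<le> B * K" unfolding K_def using that u l2 by (intro mult_left_mono add_mono frac_le) auto
    finally show ?thesis .
  qed
  have "log_close A t (p t) (two_ended a c t)" if t: "0 < t" for t
  proof -
    have nn: "0 \<le> A0 * K" "0 \<le> A1 * K" "0 \<le> (M + \<bar>a\<bar> + \<bar>c\<bar>) * 2" using A0 A1 K M0 by auto
    consider "t \<le> 1/2" | "2 \<le> t" | "1/2 < t" "t < 2" by linarith
    then show ?thesis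
    proof cases
      case 1
      have "ln t \<le> ln (1/2)" using t 1 by (subst ln_le_cancel_iff) auto
      then have "ln 2 \<le> \<bar>ln t\<bar>" by (simp add: ln_div)
      then have "\<bar>p t - a\<bar> * (1 + \<bar>ln t\<bar>) \<le> A0 * K" using A0 t 1 by (intro far) auto
      then show ?thesis using nn 1 unfolding A_def by (simp add: two_ended_def)
    next
      case 2
      have l: "ln 2 \<le> ln t" using 2 by simp
      then have "\<bar>p t - c\<bar> * (1 + \<bar>ln t\<bar>) \<le> A1 * K" using A1 2 l2 by (intro far) auto
      then show ?thesis using nn 2 unfolding A_def by (simp add: two_ended_def)
    next
      case 3
      have "ln t \<le> ln 2" using t 3 by simp
      moreover have "ln (1/2) \<le> ln t" using t 3 by (subst ln_le_cancel_iff) auto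
      ultimately have "\<bar>ln t\<bar> \<le> 1" using l2 by (auto simp: ln_div abs_le_iff)
      moreover have "\<bar>p t - two_ended a c t\<bar> \<le> M + \<bar>a\<bar> + \<bar>c\<bar>"
        using M[OF t] by (auto simp: two_ended_def)
      ultimately have "\<bar>p t - two_ended a c t\<bar> * (1 + \<bar>ln t\<bar>) \<le> (M + \<bar>a\<bar> + \<bar>c\<bar>) * 2"
        by (intro mult_mono) auto
      then show ?thesis using nn unfolding A_def by linarith
    qed
  qed
  moreover have "0 \<le> A" using A0 A1 K M0 by (simp add: A_def)
  ultimately show ?thesis using that by blast
qed

lemma P_0inf_two_ended:
  assumes p: "p \<in> P_0inf" and inf: "1 < ess_inf p"
  obtains A M where "0 \<le> A" "1 < val_zero p" "1 < val_infinity p"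
    "\<And>t. 0 < t \<Longrightarrow> log_close A t (p t) (two_ended (val_zero p) (val_infinity p) t)"
    "AE t in lebesgue. 0 < t \<longrightarrow> 1 \<le> p t" "\<And>t. 0 < t \<Longrightarrow> \<bar>p t\<bar> \<le> M"
    "(\<lambda>t. if 0 < t then p t else 0) \<in> borel_measurable lebesgue"
proof -
  have m: "p \<in> borel_measurable (lebesgue_on {0<..})" using p by (simp add: P_0inf_def)
  obtain a where a: "log_decay_at_zero p a" using p by (auto simp: P_0inf_def)
  obtain b where b: "log_decay_at_infinity p b" using p by (auto simp: P_0inf_def)
  have va: "val_zero p = a" "val_infinity p = b" using a b by (auto intro: val_zero_eq val_infinity_eq)
  obtain M where M: "\<And>t. 0 < t \<Longrightarrow> \<bar>p t\<bar> \<le> M" using p by (auto simp: P_0inf_def)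
  obtain A where A: "0 \<le> A" "\<And>t. 0 < t \<Longrightarrow> log_close A t (p t) (two_ended a b t)"
    by (rule two_ended_log_decay[OF a b M]) (blast+)
  obtain c where c: "1 < c" "AE t in lebesgue. 0 < t \<longrightarrow> c \<le> p t"
    by (rule ess_inf_AE_gt[OF inf])
  have "c \<le> a"
  proof (rule AE_lower_bound_limit[OF c(2) log_decay_at_zero_tendsto[OF a]])
    fix P :: "real \<Rightarrow> bool" assume "eventually P (at_right 0)"
    then obtain d where "0 < d" "\<And>t. 0 < t \<Longrightarrow> t < d \<Longrightarrow> P t" unfolding eventually_at_right_field by blast
    then show "\<exists>a b. 0 \<le> a \<and> a < b \<and> (\<forall>t\<in>{a<..<b}. P t)"
      by (intro exI[of _ 0] exI[of _ d]) auto
  qed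
  then have "1 < a" using c(1) by linarith
  moreover have "c \<le> b"
  proof (rule AE_lower_bound_limit[OF c(2) log_decay_at_infinity_tendsto[OF b]])
    fix P :: "real \<Rightarrow> bool" assume "eventually P at_top"
    then obtain d where "\<And>t. d \<le> t \<Longrightarrow> P t" unfolding eventually_at_top_linorder by blast
    then show "\<exists>a b. 0 \<le> a \<and> a < b \<and> (\<forall>t\<in>{a<..<b}. P t)"
      by (intro exI[of _ "max d 0"] exI[of _ "max d 0 + 1"]) auto
  qed
  then have "1 < b" using c(1) by linarith
  moreover have "AE t in lebesgue. 0 < t \<longrightarrow> 1 \<le> p t" using c(2) by eventually_elim (use c(1) in auto)
  moreover have "(\<lambda>t. if t \<in> {0<..} then p t else 0) \<in> borel_measurable lebesgue"
    using m by (subst borel_measurable_if) auto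
  ultimately show ?thesis using A M by (intro that[of A M]) (simp_all add: va)
qed

text \<open>
  The map \<open>x \<mapsto> 1/x\<close> is a contraction on \<open>[1, \<infinity>)\<close>, so that \<open>1/p - 1/q\<close> inherits
  the logarithmic decay of \<open>p\<close> and \<open>q\<close>. The exponents may be below one on a null set, so these
  bounds hold almost everywhere.
\<close>

lemma weight_exponent_two_ended:
  fixes p q :: "real \<Rightarrow> real"
  assumes p: "p \<in> P_0inf" "1 < ess_inf p" and q: "q \<in> P_0inf" "1 < ess_inf q"
  defines "p0 \<equiv> val_zero p" and "p1 \<equiv> val_infinity p" and "q0 \<equiv> val_zero q" and "q1 \<equiv> val_infinity q"
  obtains A M where "0 \<le> A" "1 < p0" "1 < p1" "1 < q0" "1 < q1"
    "AE t in lebesgue. 0 < t \<longrightarrow> 1 \<le> q t \<and> q t \<le> M \<and> log_close A t (q t) (two_ended q0 q1 t)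
        \<and> log_close A t (1 / p t - 1 / q t) (two_ended (1 / p0 - 1 / q0) (1 / p1 - 1 / q1) t)"
    "(\<lambda>t. if 0 < t then q t else 0) \<in> borel_measurable lebesgue"
    "(\<lambda>t. if 0 < t then 1 / p t - 1 / q t else 0) \<in> borel_measurable lebesgue"
proof -
  obtain Ap Mp where Ap: "0 \<le> Ap" "1 < p0" "1 < p1"
    "\<And>t. 0 < t \<Longrightarrow> log_close Ap t (p t) (two_ended p0 p1 t)"
    "AE t in lebesgue. 0 < t \<longrightarrow> 1 \<le> p t"
    "(\<lambda>t. if 0 < t then p t else 0) \<in> borel_measurable lebesgue"
    unfolding p0_def p1_def by (rule P_0inf_two_ended[OF p]) blast
  obtain Aq Mq where Aq: "0 \<le> Aq" "1 < q0" "1 < q1"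
    "\<And>t. 0 < t \<Longrightarrow> log_close Aq t (q t) (two_ended q0 q1 t)"
    "AE t in lebesgue. 0 < t \<longrightarrow> 1 \<le> q t" "\<And>t. 0 < t \<Longrightarrow> \<bar>q t\<bar> \<le> Mq"
    "(\<lambda>t. if 0 < t then q t else 0) \<in> borel_measurable lebesgue"
    unfolding q0_def q1_def by (rule P_0inf_two_ended[OF q]) blast
  have inv: "\<bar>1 / x - 1 / y\<bar> \<le> \<bar>x - y\<bar>" if "1 \<le> x" "1 \<le> y" for x y :: real
  proof -
    have "1 / x - 1 / y = (y - x) / (x * y)" using that by (simp add: field_simps)
    then have "\<bar>1 / x - 1 / y\<bar> = \<bar>x - y\<bar> / (x * y)" using that by (simp add: abs_divide abs_mult abs_minus_commute)
    also have "\<dots> \<le> \<bar>x - y\<bar> / 1" using that mult_mono[of 1 x 1 y] by (intro divide_left_mono) auto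
    finally show ?thesis by simp
  qed
  have "AE t in lebesgue. 0 < t \<longrightarrow> 1 \<le> q t \<and> q t \<le> Mq \<and> log_close (Ap + Aq) t (q t) (two_ended q0 q1 t)
        \<and> log_close (Ap + Aq) t (1 / p t - 1 / q t) (two_ended (1 / p0 - 1 / q0) (1 / p1 - 1 / q1) t)"
    using Ap(5) Aq(5)
  proof eventually_elim
    case (elim t)
    show ?case
    proof (intro impI)
      assume t: "0 < t"
      have pq: "1 \<le> p t" "1 \<le> q t" using elim t by auto
      define P Q where "P = two_ended p0 p1 t" and "Q = two_ended q0 q1 t"
      have PQ: "1 \<le> P" "1 \<le> Q" using Ap Aq by (auto simp: P_def Q_def two_ended_def)
      have te: "two_ended (1 / p0 - 1 / q0) (1 / p1 - 1 / q1) t = 1 / P - 1 / Q"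
        by (simp add: P_def Q_def two_ended_def)
      have "\<bar>(1 / p t - 1 / q t) - (1 / P - 1 / Q)\<bar> \<le> \<bar>1 / p t - 1 / P\<bar> + \<bar>1 / q t - 1 / Q\<bar>" by linarith
      also have "\<dots> \<le> \<bar>p t - P\<bar> + \<bar>q t - Q\<bar>" by (intro add_mono inv pq PQ)
      finally have "\<bar>(1 / p t - 1 / q t) - (1 / P - 1 / Q)\<bar> * (1 + \<bar>ln t\<bar>) \<le> (\<bar>p t - P\<bar> + \<bar>q t - Q\<bar>) * (1 + \<bar>ln t\<bar>)"
        by (rule mult_right_mono) simp
      also have "\<dots> \<le> Ap + Aq" using Ap(4)[OF t] Aq(4)[OF t] by (simp add: P_def Q_def distrib_right)
      finally show "1 \<le> q t \<and> q t \<le> Mq \<and> log_close (Ap + Aq) t (q t) (two_ended q0 q1 t)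
        \<and> log_close (Ap + Aq) t (1 / p t - 1 / q t) (two_ended (1 / p0 - 1 / q0) (1 / p1 - 1 / q1) t)"
        using pq Aq(6)[OF t] Aq(4)[OF t] Ap(1) by (simp add: te abs_le_iff)
    qed
  qed
  moreover have "(\<lambda>t. if 0 < t then 1 / p t - 1 / q t else 0) \<in> borel_measurable lebesgue"
  proof -
    have "(\<lambda>t. 1 / (if 0 < t then p t else 0) - 1 / (if 0 < t then q t else 0)) \<in> borel_measurable lebesgue"
      using Ap(6) Aq(7) by (intro borel_measurable_diff borel_measurable_divide borel_measurable_const)
    also have "(\<lambda>t. 1 / (if 0 < t then p t else 0) - 1 / (if 0 < t then q t else 0)) = (\<lambda>t. if 0 < t then 1 / p t - 1 / q t else 0)"
      by auto
    finally show ?thesis .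
  qed
  moreover have "0 \<le> Ap + Aq" using Ap Aq by simp
  ultimately show ?thesis using that[of "Ap + Aq" Mq] Ap(2,3) Aq(2,3,7) by blast
qed

section \<open>Boundedness on the local Morrey-Lorentz space\<close>

lemma le_cmult_Inf_ennreal:
  fixes S :: "ennreal set"
  assumes D: "0 < D" and le: "\<And>x. x \<in> S \<Longrightarrow> y \<le> ennreal D * x"
  shows "y \<le> ennreal D * Inf S"
proof -
  have "y / ennreal D \<le> Inf S"
    using D le by (intro Inf_greatest divide_le_posI_ennreal) auto
  then have "ennreal D * (y / ennreal D) \<le> ennreal D * Inf S" by (rule mult_left_mono) simp
  moreover have "ennreal D * (y / ennreal D) = y"
    using D by (simp add: ennreal_times_divide mult.commute[of _ y] ennreal_mult_divide_eq)
  ultimately show ?thesis by simp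
qed

abbreviation weighted_norm :: "(real \<Rightarrow> real) \<Rightarrow> (real \<Rightarrow> real) \<Rightarrow> real \<Rightarrow> (real ^ 'n \<Rightarrow> complex) \<Rightarrow> ennreal" where
  "weighted_norm q \<beta> r f \<equiv> Lq_norm q {0<..<r} (\<lambda>t. ennreal (t powr \<beta> t) * rearrangement f t)"

text \<open>
  For \<open>\<eta>\<close> admissible in the norm of \<open>f\<^sup>*\<close> on \<open>(0, r)\<close>, the Hardy inequality is applied to
  \<open>G = f\<^sup>* 1\<^bsub>(0, r)\<^esub> / \<eta>\<close>, which is again nonincreasing; this makes the constant independent of
  \<open>r\<close>. It bounds the modular of the average by \<open>C\<close>, and dividing by \<open>C' = max 1 C\<close> brings it down to \<open>1\<close> since
  \<open>q \<ge> 1\<close>. A finite norm for a single \<open>r\<close> already makes \<open>f\<close> a sum of an integrable and a bounded function, so that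
  the convolution integral exists almost everywhere.
\<close>

lemma Lq_norm_convolution:
  fixes k :: "real ^ 'n \<Rightarrow> complex" and q \<beta> :: "real \<Rightarrow> real" and Q M q0 q1 b0 b1 A :: real
  assumes k: "k \<in> borel_measurable borel" and A: "0 < A" "(\<integral>\<^sup>+x. norm (k x) \<partial>lborel) \<le> ennreal A"
    and q: "(\<lambda>t. if 0 < t then q t else 0) \<in> borel_measurable lebesgue"
    and \<beta>: "(\<lambda>t. if 0 < t then \<beta> t else 0) \<in> borel_measurable lebesgue"
    and ae: "AE t in lebesgue. 0 < t \<longrightarrow> 1 \<le> q t \<and> q t \<le> M \<and> log_close Q t (q t) (two_ended q0 q1 t)
            \<and> log_close Q t (\<beta> t) (two_ended b0 b1 t)"
    and Q: "0 \<le> Q" and q0: "1 < q0" and q1: "1 < q1"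
    and b0: "b0 < 1 - 1 / q0" "-1 \<le> b0" and b1: "b1 < 1 - 1 / q1" "-1 \<le> b1"
  obtains D where "0 < D"
    "\<And>f r. f \<in> borel_measurable lebesgue \<Longrightarrow> 0 < r \<Longrightarrow>
       weighted_norm q \<beta> r f < \<infinity> \<Longrightarrow>
       convolution_exists k f \<and>
       convolve lebesgue k f \<in> borel_measurable lebesgue"
    "\<And>f r. f \<in> borel_measurable lebesgue \<Longrightarrow> 0 < r \<Longrightarrow>
       weighted_norm q \<beta> r (convolve lebesgue k f)
        \<le> ennreal D * weighted_norm q \<beta> r f"
proof -
  define q' where "q' = (\<lambda>t. if 0 < t then q t else 0)"
  define \<beta>' where "\<beta>' = (\<lambda>t. if 0 < t then \<beta> t else 0)"
  have ae': "AE t in lebesgue. 0 < t \<longrightarrow> 1 \<le> q' t \<and> q' t \<le> M \<and> log_close Q t (q' t) (two_ended q0 q1 t)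
            \<and> log_close Q t (\<beta>' t) (two_ended b0 b1 t)"
    using ae by eventually_elim (simp add: q'_def \<beta>'_def)
  obtain C where C: "0 \<le> C"
    "\<And>G. \<lbrakk>G \<in> borel_measurable borel; \<And>s. 0 \<le> G s; antimono_on {0<..} G;
        half_line_integral lebesgue (\<lambda>t. (t powr \<beta>' t * G t) powr q' t) \<le> 1\<rbrakk> \<Longrightarrow>
      (\<forall>t>0. initial_integral G t < \<infinity>) \<and>
      half_line_integral lebesgue (\<lambda>t. (t powr \<beta>' t * hardy G t) powr q' t) \<le> ennreal C"
    by (rule hardy_inequality_variable_exponent[OF q[folded q'_def] \<beta>[folded \<beta>'_def] ae' Q q0 q1 b0 b1]) blast
  define C' where "C' = max 1 C"
  have C': "1 \<le> C'" "C \<le> C'" by (auto simp: C'_def)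
  define D where "D = 2 * A * C'"
  have D: "0 < D" using A C' by (simp add: D_def)
  have core: "convolution_exists k f \<and>
       convolve lebesgue k f \<in> borel_measurable lebesgue \<and>
       weighted_norm q \<beta> r (convolve lebesgue k f) \<le> ennreal D * ennreal \<eta>"
    if f: "f \<in> borel_measurable lebesgue" and r: "0 < r" and \<eta>: "0 < \<eta>"
      and mod: "(\<integral>\<^sup>+s\<in>{0<..<r}. ennreal_powr (ennreal (s powr \<beta> s) * rearrangement f s / ennreal \<eta>) (q s) \<partial>lebesgue) \<le> 1"
    for f :: "real ^ 'n \<Rightarrow> complex" and r \<eta>
  proof -
    define R where "R = rearrangement f"
    have Rm: "R \<in> borel_measurable borel" by (simp add: R_def)
    have anti: "s \<le> t \<Longrightarrow> R t \<le> R s" for s t by (simp add: R_def rearrangement_antimono)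
    have fin: "R t < \<infinity>" if t: "0 < t" "t < r" for t
    proof (rule ccontr)
      assume "\<not> R t < \<infinity>"
      then have "R t = \<infinity>" by (simp add: less_top[symmetric])
      then have Rs: "R s = \<infinity>" if "s \<le> t" for s using anti[OF that] by (simp add: top_unique)
      have "(\<integral>\<^sup>+s. \<infinity> * indicator {0<..<t} s \<partial>lebesgue)
          \<le> (\<integral>\<^sup>+s\<in>{0<..<r}. ennreal_powr (ennreal (s powr \<beta> s) * rearrangement f s / ennreal \<eta>) (q s) \<partial>lebesgue)"
        (is "integral\<^sup>N _ ?f \<le> integral\<^sup>N _ ?g")
      proof (rule nn_integral_mono)
        fix s
        show "?f s \<le> ?g s"
        proof (cases "0 < s \<and> s < t")
          case True
          then have "ennreal (s powr \<beta> s) * rearrangement f s / ennreal \<eta> = \<infinity>"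
            using Rs[of s] \<eta> by (simp add: R_def ennreal_mult_top ennreal_top_divide)
          then show ?thesis using True t by (simp add: ennreal_powr_def)
        qed auto
      qed
      then have "\<infinity> * emeasure lebesgue {0<..<t} \<le> 1"
        using mod by (subst (asm) nn_integral_cmult_indicator) (auto intro: order_trans)
      then show False using t by (simp add: ennreal_top_mult top_unique)
    qed
    define G where "G = (\<lambda>s. if s < r then enn2real (R s) / \<eta> else 0)"
    have Gm[measurable]: "G \<in> borel_measurable borel" unfolding G_def using Rm by measurable
    have G0: "0 \<le> G s" for s using \<eta> by (simp add: G_def)
    have Ganti: "antimono_on {0<..} G"
    proof (rule monotone_onI)
      fix s t :: real assume "s \<in> {0<..}" "s \<le> t"
      then show "G t \<le> G s"
        using \<eta> fin[of s] anti[of s t]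
        by (auto simp: G_def intro!: divide_right_mono enn2real_mono)
    qed
    have RG: "R s = ennreal (\<eta> * G s)" if "0 < s" "s < r" for s
      using fin[OF that] \<eta> that by (simp add: G_def less_top)
    have "half_line_integral lebesgue (\<lambda>t. (t powr \<beta>' t * G t) powr q' t)
      \<le> (\<integral>\<^sup>+s\<in>{0<..<r}. ennreal_powr (ennreal (s powr \<beta> s) * rearrangement f s / ennreal \<eta>) (q s) \<partial>lebesgue)"
      (is "integral\<^sup>N _ ?f \<le> integral\<^sup>N _ ?g")
    proof (rule nn_integral_mono)
      fix s
      show "?f s \<le> ?g s"
      proof (cases "0 < s \<and> s < r")
        case True
        have "ennreal (s powr \<beta> s) * rearrangement f s / ennreal \<eta> = ennreal (s powr \<beta> s * (\<eta> * G s)) / ennreal \<eta>"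
          using RG[of s] True ennreal_mult[of "s powr \<beta> s" "\<eta> * G s"] \<eta> G0[of s] by (simp add: R_def[symmetric])
        also have "\<dots> = ennreal (s powr \<beta> s * (\<eta> * G s) / \<eta>)" using \<eta> G0[of s] by (intro divide_ennreal) auto
        also have "s powr \<beta> s * (\<eta> * G s) / \<eta> = s powr \<beta> s * G s" using \<eta> by simp
        finally show ?thesis using True G0[of s] by (simp add: ennreal_powr_def q'_def \<beta>'_def)
      next
        case False
        then show ?thesis by (auto simp: G_def indicator_def)
      qed
    qed
    also note mod
    finally have mod': "half_line_integral lebesgue (\<lambda>t. (t powr \<beta>' t * G t) powr q' t) \<le> 1" .
    note H = C(2)[OF Gm G0 Ganti mod']
    have int: "(\<integral>\<^sup>+u. R u * indicator {0<..<t} u \<partial>lborel) = ennreal (\<eta> * (t * hardy G t))" if t: "0 < t" "t < r" for t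
    proof -
      have "(\<integral>\<^sup>+u. R u * indicator {0<..<t} u \<partial>lborel) = (\<integral>\<^sup>+u. ennreal \<eta> * (ennreal (G u) * indicator {0<..<t} u) \<partial>lborel)"
        using RG t \<eta> G0 by (intro nn_integral_cong) (auto simp: indicator_def ennreal_mult)
      also have "\<dots> = ennreal \<eta> * initial_integral G t"
        by (rule nn_integral_cmult) measurable
      also have "initial_integral G t = ennreal (t * hardy G t)"
        using H t by (simp add: hardy_def less_top)
      also have "ennreal \<eta> * ennreal (t * hardy G t) = ennreal (\<eta> * (t * hardy G t))"
        using \<eta> t hardy_nonneg[of t G] by (simp add: ennreal_mult)
      finally show ?thesis .
    qed
    have finint: "rearrangement_integral f t < \<infinity>" if "0 < t" "t < r" for t
      using int[OF that] by (simp add: R_def)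
    note conv = convolution_rearrangement[OF k A f finint r]
    define S where "S = rearrangement (convolve lebesgue k f)"
    have S: "S t \<le> ennreal (2 * A * \<eta> * hardy G t)" if t: "0 < t" "t < r" for t
    proof -
      have "S t \<le> ennreal (2 * A / t) * ennreal (\<eta> * (t * hardy G t))"
        using conv(3)[OF _ _ t(1)] int[OF t] by (simp add: S_def R_def)
      also have "\<dots> = ennreal (2 * A / t * (\<eta> * (t * hardy G t)))"
        by (rule ennreal_mult[symmetric]) (use A \<eta> t hardy_nonneg[of t G] in auto)
      also have "2 * A / t * (\<eta> * (t * hardy G t)) = 2 * A * \<eta> * hardy G t" using t by simp
      finally show ?thesis .
    qed
    have "(\<integral>\<^sup>+s\<in>{0<..<r}. ennreal_powr (ennreal (s powr \<beta> s) * S s / ennreal (D * \<eta>)) (q s) \<partial>lebesgue)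
       \<le> (\<integral>\<^sup>+t. ennreal (1 / C') * (ennreal ((t powr \<beta>' t * hardy G t) powr q' t) * indicator {0<..} t) \<partial>lebesgue)"
      (is "integral\<^sup>N _ ?f \<le> integral\<^sup>N _ ?g")
    proof (rule nn_integral_mono_AE)
      show "AE s in lebesgue. ?f s \<le> ?g s"
        using ae
      proof eventually_elim
        case (elim s)
        show ?case
        proof (cases "0 < s \<and> s < r")
          case True
          define h where "h = s powr \<beta> s * hardy G s"
          have h0: "0 \<le> h" using True hardy_nonneg[of s G] by (simp add: h_def)
          have "S s < \<infinity>" using S[of s] True by (auto intro: order_le_less_trans)
          then obtain x where x: "0 \<le> x" "S s = ennreal x" by (cases "S s") auto
          have xle: "x \<le> 2 * A * \<eta> * hardy G s"
            using S[of s] True x A \<eta> hardy_nonneg[of s G] by (simp add: ennreal_le_iff)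
          have "s powr \<beta> s * x / (D * \<eta>) \<le> s powr \<beta> s * (2 * A * \<eta> * hardy G s) / (D * \<eta>)"
            using xle D \<eta> by (intro divide_right_mono mult_left_mono) auto
          also have "\<dots> = h / C'" using A \<eta> by (simp add: h_def D_def)
          finally have le: "s powr \<beta> s * x / (D * \<eta>) \<le> h / C'" .
          have "(s powr \<beta> s * x / (D * \<eta>)) powr q s \<le> (h / C') powr q s"
            using le elim True x D \<eta> by (intro powr_mono2) auto
          also have "\<dots> = h powr q s / C' powr q s" using h0 C' by (simp add: powr_divide)
          also have "\<dots> \<le> h powr q s / C' powr 1"
            using elim True C' by (intro divide_left_mono powr_mono) auto
          also have "\<dots> = 1 / C' * h powr q s" using C' by simp
          finally have fin: "(s powr \<beta> s * x / (D * \<eta>)) powr q s \<le> 1 / C' * h powr q s" .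
          have "ennreal (s powr \<beta> s) * S s / ennreal (D * \<eta>) = ennreal (s powr \<beta> s * x / (D * \<eta>))"
            using x D \<eta> by (simp add: ennreal_mult[symmetric] divide_ennreal)
          then have "ennreal_powr (ennreal (s powr \<beta> s) * S s / ennreal (D * \<eta>)) (q s) = ennreal ((s powr \<beta> s * x / (D * \<eta>)) powr q s)"
            using x D \<eta> by (simp add: ennreal_powr_def)
          also have "\<dots> \<le> ennreal (1 / C' * h powr q s)" by (rule ennreal_leI[OF fin])
          also have "\<dots> = ennreal (1 / C') * ennreal (h powr q s)" using C' by (intro ennreal_mult) auto
          finally show ?thesis using True by (simp add: h_def q'_def \<beta>'_def)
        qed auto
      qed
    qed
    also have "\<dots> = ennreal (1 / C') * half_line_integral lebesgue (\<lambda>t. (t powr \<beta>' t * hardy G t) powr q' t)"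
    proof (rule nn_integral_cmult)
      have idm: "(\<lambda>t::real. t) \<in> borel_measurable lebesgue" by (simp add: measurable_completion)
      have "hardy G \<in> borel_measurable lebesgue" by (intro measurable_completion) simp
      then show "(\<lambda>t. ennreal ((t powr \<beta>' t * hardy G t) powr q' t) * indicator {0<..} t) \<in> borel_measurable lebesgue"
        by (intro borel_measurable_times_ennreal measurable_compose[OF _ measurable_ennreal] powr_real_measurable
              borel_measurable_times idm q[folded q'_def] \<beta>[folded \<beta>'_def] borel_measurable_indicator) simp_all
    qed
    also have "\<dots> \<le> ennreal (1 / C') * ennreal C" using H by (intro mult_left_mono) auto
    also have "\<dots> = ennreal (1 / C' * C)" by (rule ennreal_mult[symmetric]) (use C C' in auto)
    also have "\<dots> \<le> 1" using C C' by simp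
    finally have "Lq_norm q {0<..<r} (\<lambda>t. ennreal (t powr \<beta> t) * S t) \<le> ennreal (D * \<eta>)"
      unfolding Lq_norm_def using D \<eta> by (intro Inf_lower CollectI exI[of _ "D * \<eta>"]) auto
    also have "\<dots> = ennreal D * ennreal \<eta>" using D \<eta> by (simp add: ennreal_mult)
    finally have "Lq_norm q {0<..<r} (\<lambda>t. ennreal (t powr \<beta> t) * S t) \<le> ennreal D * ennreal \<eta>" .
    then show ?thesis using conv(1,2) by (simp add: S_def)
  qed
  show ?thesis
  proof (rule that[OF D])
    fix f :: "real ^ 'n \<Rightarrow> complex" and r :: real
    assume f: "f \<in> borel_measurable lebesgue" and r: "0 < r"
    show "weighted_norm q \<beta> r (convolve lebesgue k f)
        \<le> ennreal D * weighted_norm q \<beta> r f"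
      unfolding Lq_norm_def[of q _ "\<lambda>t. ennreal (t powr \<beta> t) * rearrangement f t"]
      by (rule le_cmult_Inf_ennreal[OF D]) (use core[OF f r] in blast)
    assume "weighted_norm q \<beta> r f < \<infinity>"
    then obtain \<eta> where "0 < \<eta>"
      "(\<integral>\<^sup>+s\<in>{0<..<r}. ennreal_powr (ennreal (s powr \<beta> s) * rearrangement f s / ennreal \<eta>) (q s) \<partial>lebesgue) \<le> 1"
      unfolding Lq_norm_def Inf_less_iff by blast
    then show "convolution_exists k f \<and>
       convolve lebesgue k f \<in> borel_measurable lebesgue"
      using core[OF f r] by blast
  qed
qed

theorem corollary1:
  fixes p q :: "real \<Rightarrow> real" and lam \<delta> r :: real and \<beta> :: "real \<Rightarrow> real"
  assumes "1 < ess_inf p" and "ess_inf p \<le> ess_sup p" and "ess_sup p < \<infinity>"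
    and "1 < ess_inf q" and "ess_inf q \<le> ess_sup q" and "ess_sup q < \<infinity>"
    and "p \<in> P_0inf" and "q \<in> P_0inf"
    and "0 \<le> lam" and "lam < 1"
    and \<beta>_def: "\<beta> = (\<lambda>t. 1 / p t - 1 / q t)"
    and "(SUP s\<in>{0<..}. ennreal (min 1 s powr (1 / val_zero q) *
           s powr (- (lam / q_star q s)))) < \<infinity>"
    and "\<exists>L. ((\<lambda>t. t powr \<beta> t) \<longlongrightarrow> L) (at_right 0)"
    and "\<exists>a. almost_decreasing (\<lambda>t. t powr (\<beta> t - a)) \<and>
             almost_decreasing (\<lambda>t. t powr (lam / q_star q t - \<beta> t - a))"
    and "\<exists>b. almost_increasing (\<lambda>t. t powr (- \<beta> t + b)) \<and>
             almost_increasing (\<lambda>t. t powr (lam / q_star q t - \<beta> t + b))"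
    and "\<forall>t>0. lam / q_star q t - 1 / val_infinity q < \<beta> t \<and>
               \<beta> t < lam / q_star q t + (1 - 1 / val_zero q)"
    and "\<delta> > (real CARD('n) - 1) / 2" and "r > 0"
  shows "\<exists>C>0. \<forall>f \<in> (morrey_lorentz p q lam :: (real ^ 'n \<Rightarrow> complex) set).
           bochner_riesz_defined \<delta> r f \<and>
           bochner_riesz \<delta> r f \<in> morrey_lorentz p q lam \<and>
           morrey_lorentz_norm p q lam (bochner_riesz \<delta> r f)
             \<le> ennreal C * morrey_lorentz_norm p q lam f"
proof -
  define p0 p1 q0 q1 where "p0 = val_zero p" and "p1 = val_infinity p" and "q0 = val_zero q" and "q1 = val_infinity q"
  obtain Q M where c: "0 \<le> Q" "1 < p0" "1 < p1" "1 < q0" "1 < q1"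
    and ae: "AE t in lebesgue. 0 < t \<longrightarrow> 1 \<le> q t \<and> q t \<le> M \<and> log_close Q t (q t) (two_ended q0 q1 t)
        \<and> log_close Q t (1 / p t - 1 / q t) (two_ended (1 / p0 - 1 / q0) (1 / p1 - 1 / q1) t)"
    and qm: "(\<lambda>t. if 0 < t then q t else 0) \<in> borel_measurable lebesgue"
    and \<beta>m: "(\<lambda>t. if 0 < t then 1 / p t - 1 / q t else 0) \<in> borel_measurable lebesgue"
    unfolding p0_def p1_def q0_def q1_def
    by (rule weight_exponent_two_ended[OF \<open>p \<in> P_0inf\<close> \<open>1 < ess_inf p\<close> \<open>q \<in> P_0inf\<close> \<open>1 < ess_inf q\<close>]) blast
  have b: "1 / p0 - 1 / q0 < 1 - 1 / q0" "-1 \<le> 1 / p0 - 1 / q0" "1 / p1 - 1 / q1 < 1 - 1 / q1" "-1 \<le> 1 / p1 - 1 / q1"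
  proof -
    have "1 / p0 < 1" "1 / p1 < 1" "0 < 1 / p0" "0 < 1 / p1" "1 / q0 < 1" "1 / q1 < 1" using c by auto
    then show "1 / p0 - 1 / q0 < 1 - 1 / q0" "-1 \<le> 1 / p0 - 1 / q0" "1 / p1 - 1 / q1 < 1 - 1 / q1" "-1 \<le> 1 / p1 - 1 / q1"
      by linarith+
  qed
  define k :: "real ^ 'n \<Rightarrow> complex" where "k = bochner_riesz_kernel_scaled \<delta> r"
  have km: "k \<in> borel_measurable borel" by (simp add: k_def)
  have "(\<integral>\<^sup>+x. ennreal (norm (k x)) \<partial>lborel) < \<infinity>"
    unfolding k_def by (rule bochner_riesz_kernel_scaled_integrable[OF \<open>\<delta> > (real CARD('n) - 1) / 2\<close> \<open>r > 0\<close>])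
  then obtain A0 where A0: "0 \<le> A0" "(\<integral>\<^sup>+x. ennreal (norm (k x)) \<partial>lborel) = ennreal A0"
    by (cases "\<integral>\<^sup>+x. ennreal (norm (k x)) \<partial>lborel") auto
  have A: "0 < A0 + 1" "(\<integral>\<^sup>+x. ennreal (norm (k x)) \<partial>lborel) \<le> ennreal (A0 + 1)"
    using A0 by (auto intro: ennreal_leI simp del: ennreal_plus)
  define \<phi> where "\<phi> = (\<lambda>(f :: real ^ 'n \<Rightarrow> complex) s. Lq_norm q {0<..<s} (\<lambda>t. ennreal (t powr (1 / p t - 1 / q t)) * rearrangement f t))"
  obtain D where D: "0 < D"
    "\<And>f s. f \<in> borel_measurable lebesgue \<Longrightarrow> 0 < s \<Longrightarrow> \<phi> f s < \<infinity> \<Longrightarrow>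
       convolution_exists k f \<and>
       convolve lebesgue k f \<in> borel_measurable lebesgue"
    "\<And>f s. f \<in> borel_measurable lebesgue \<Longrightarrow> 0 < s \<Longrightarrow>
       \<phi> (convolve lebesgue k f) s \<le> ennreal D * \<phi> f s"
    unfolding \<phi>_def by (rule Lq_norm_convolution[OF km A qm \<beta>m ae c(1) c(4) c(5) b]) blast
  have norm: "morrey_lorentz_norm p q lam f = (SUP s\<in>{0<..}. ennreal (s powr (- (lam / q_star q s))) * \<phi> f s)" for f :: "real ^ 'n \<Rightarrow> complex"
    by (simp add: morrey_lorentz_norm_def \<phi>_def)
  have T: "bochner_riesz \<delta> r f = convolve lebesgue k f" for f :: "real ^ 'n \<Rightarrow> complex"
    by (simp add: bochner_riesz_def[abs_def] k_def)
  have bound: "morrey_lorentz_norm p q lam (bochner_riesz \<delta> r f) \<le> ennreal D * morrey_lorentz_norm p q lam f"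
    if f: "f \<in> borel_measurable lebesgue" for f :: "real ^ 'n \<Rightarrow> complex"
    unfolding norm
  proof (rule SUP_least)
    fix s :: real assume s: "s \<in> {0<..}"
    have "ennreal (s powr (- (lam / q_star q s))) * \<phi> (bochner_riesz \<delta> r f) s
       \<le> ennreal (s powr (- (lam / q_star q s))) * (ennreal D * \<phi> f s)"
      unfolding T using D(3)[OF f, of s] s by (intro mult_left_mono) auto
    also have "\<dots> = ennreal D * (ennreal (s powr (- (lam / q_star q s))) * \<phi> f s)" by (simp only: mult_ac)
    also have "\<dots> \<le> ennreal D * (SUP s\<in>{0<..}. ennreal (s powr (- (lam / q_star q s))) * \<phi> f s)"
      using s by (intro mult_left_mono SUP_upper) auto
    finally show "ennreal (s powr (- (lam / q_star q s))) * \<phi> (bochner_riesz \<delta> r f) s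
       \<le> ennreal D * (SUP s\<in>{0<..}. ennreal (s powr (- (lam / q_star q s))) * \<phi> f s)" .
  qed
  show ?thesis
  proof (intro exI[of _ D] conjI ballI)
    show "0 < D" by (rule D(1))
    fix f :: "real ^ 'n \<Rightarrow> complex" assume "f \<in> morrey_lorentz p q lam"
    then have f: "f \<in> borel_measurable lebesgue" and fin: "morrey_lorentz_norm p q lam f < \<infinity>"
      by (auto simp: morrey_lorentz_def)
    have "\<phi> f 1 \<le> morrey_lorentz_norm p q lam f"
      unfolding norm using SUP_upper[of "1::real" "{0<..}" "\<lambda>s. ennreal (s powr (- (lam / q_star q s))) * \<phi> f s"] by simp
    then have "\<phi> f 1 < \<infinity>" using fin by (rule order_le_less_trans)
    note int = D(2)[OF f zero_less_one this]
    show "bochner_riesz_defined \<delta> r f" using int by (simp add: bochner_riesz_defined_def k_def)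
    show le: "morrey_lorentz_norm p q lam (bochner_riesz \<delta> r f) \<le> ennreal D * morrey_lorentz_norm p q lam f"
      by (rule bound[OF f])
    have "ennreal D * morrey_lorentz_norm p q lam f < \<infinity>" using fin by (simp add: ennreal_mult_less_top)
    then have "morrey_lorentz_norm p q lam (bochner_riesz \<delta> r f) < \<infinity>" using le by (rule order_le_less_trans[rotated])
    then show "bochner_riesz \<delta> r f \<in> morrey_lorentz p q lam"
      using int by (simp add: morrey_lorentz_def T)
  qed
qed

end
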